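(* Let $x\in M^4$ be a fixed point of an arbitrary quasitoric manifold $M^4$ of dimension $4$. Let $B^4=\mathbb{C}P^2\,\widetilde{\sharp}\,\overline{\mathbb{C}P^2}$, and let $x_+,x_-\in B^4$ be fixed points with signs $\sigma(x_+)=1$, $\sigma(x_-)=-1$. If $\sigma(x)=-1$, then the equivariant connected sum $M^4\,\widetilde{\sharp}_{x,x_+}B^4$ is a TNS-manifold; if $\sigma(x)=1$, then the equivariant connected sum $M^4\,\widetilde{\sharp}_{x,x_-}B^4$ is a TNS-manifold. In each case the respective orientation is compatible with the orientations of $M^4$ and $B^4$.
   Context: Quasitoric manifolds. A characteristic pair $(P,\Lambda)$ consists of a simple convex $n$-polytope $P$ with facets $F_1,\dots,F_m$ and an integer $n\times m$ matrix $\Lambda$ with columns $\lambda_1,\dots,\lambda_m\in\mathbb{Z}^n$ such that $\lambda_{i_1},\dots,\lambda_{i_n}$ is a basis of $\mathbb{Z}^n$ whenever $F_{i_1}\cap\dots\cap F_{i_n}$ is a vertex of $P$. The quasitoric manifold $M^{2n}=M(P,\Lambda)$ is the quotient $P\times T^n/\sim$, $T^n=\mathbb{R}^n/\mathbb{Z}^n$, where $(p,t)\sim(p,t')$ iff $t-t'$ lies in the subtorus generated by the circles in the directions $\lambda_i$ with $p\in F_i$. It is a closed simply connected smooth manifold, taken oriented. There are canonical complex line bundles $\theta_1,\dots,\theta_m\to M^{2n}$, where $c_1(\theta_i)$ is Poincaré dual to the codimension-2 characteristic submanifold lying over $F_i$, and an isomorphism of real bundles $TM^{2n}\oplus\underline{\mathbb{R}}^{2(m-n)}\simeq\theta_1\oplus\dots\oplus\theta_m$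 (the canonical stably complex structure). $M^{2n}$ is a TNS-manifold if its complex normal bundle is stably isomorphic to a Whitney sum of complex line bundles, i.e. there are complex line bundles $\alpha_1,\dots,\alpha_b$ and $N$ with $\theta_1\oplus\dots\oplus\theta_m\oplus\alpha_1\oplus\dots\oplus\alpha_b\simeq\underline{\mathbb{C}}^N$. Signs. A fixed point $x$ corresponds to a vertex $F_{j_1}\cap\dots\cap F_{j_n}$; its sign is $\sigma(x)=1$ if the orientation of $T_xM\oplus\mathbb{R}^{2(m-n)}$ agrees with that of $(\theta_{j_1}\oplus\dots\oplus\theta_{j_n})_x$ given by the complex structures, and $-1$ otherwise. Equivalently $\sigma(x)=\det(\lambda_{j_1},\dots,\lambda_{j_n})$ when the facets are ordered so that their inward normals form a positive basis of $\mathbb{R}^n$. Equivariant connected sum. $M_1\widetilde{\sharp}_{x_1,x_2}M_2$ at fixed points $x_1,x_2$ is obtained by removing invariant balls around $x_1,x_2$ and gluing the boundaries equivariantly (after an automorphism of the torus); explicitly, after ordering facets and changing bases so that the facets through the vertex of $x_i$ come first and $\Lambda_i=(\mathrm{Id}_n\,|\,A_i)$, it is the quasitoric manifold over the connected sum $P_1\#P_2$ of polytopes at these vertices with characteristic matrix $(\mathrm{Id}_n\,|\,A_1\,|\,A_2)$. Its orientation is compatible with those of $M_1,M_2$ if it restricts to the given orientation on each of $M_1,M_2$ minus a ball. All fixed points of $\mathbb{C}P^2$ have sign $1$ and all fixed points of $\overline{\mathbb{C}P^2}$ (reversed orientation) have sign $-1$. $B^4$ is the equivariant connected sum with compatible orientation;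 it does not depend on the choice of fixed points, its polygon is a quadrilateral, and it has exactly two fixed points of each sign. *)

theory Defs
  imports "HOL-Analysis.Analysis"
begin

section \<open>Quotient topology\<close>

definition quotient_of :: "'a topology \<Rightarrow> ('a \<Rightarrow> 'b) \<Rightarrow> 'b topology" where
  "quotient_of X q = topology (\<lambda>U. U \<subseteq> q ` topspace X \<and> openin X {x \<in> topspace X. q x \<in> U})"

lemma openin_quotient_of:
  "openin (quotient_of X q) U \<longleftrightarrow> U \<subseteq> q ` topspace X \<and> openin X {x \<in> topspace X. q x \<in> U}"
proof -
  have eq1: "{x \<in> topspace X. q x \<in> S \<inter> T}
      = {x \<in> topspace X. q x \<in> S} \<inter> {x \<in> topspace X. q x \<in> T}" for S T
    by auto
  have eq2: "{x \<in> topspace X. q x \<in> \<Union>K} = (\<Union>S\<in>K. {x \<in> topspace X. q x \<in> S})" for K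
    by auto
  have "istopology (\<lambda>U. U \<subseteq> q ` topspace X \<and> openin X {x \<in> topspace X. q x \<in> U})"
    unfolding istopology_def eq1 eq2 by (auto intro!: openin_Union)
  then show ?thesis
    unfolding quotient_of_def by (simp add: topology_inverse')
qed

lemma topspace_quotient_of: "topspace (quotient_of X q) = q ` topspace X"
proof -
  have "{x \<in> topspace X. q x \<in> q ` topspace X} = topspace X"
    by auto
  then have "openin (quotient_of X q) (q ` topspace X)"
    by (simp add: openin_quotient_of)
  then show ?thesis
    unfolding topspace_def[of "quotient_of X q"] by (auto simp: openin_quotient_of)
qed

lemma quotient_map_quotient_of: "quotient_map X (quotient_of X q) q"
  by (simp add: quotient_map_def topspace_quotient_of openin_quotient_of)


section \<open>Complex vector bundles\<close>

text \<open>Only the behaviour of \<open>vadd\<close> and \<open>vscale\<close> on points of the total space lying in a common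
  fibre matters; elsewhere they are unconstrained.\<close>

record ('b, 'e) cbundle =
  total :: "'e topology"
  proj :: "'e \<Rightarrow> 'b"
  vadd :: "'e \<Rightarrow> 'e \<Rightarrow> 'e"
  vscale :: "complex \<Rightarrow> 'e \<Rightarrow> 'e"

definition bundle_iso :: "('b, 'e) cbundle \<Rightarrow> ('b, 'f) cbundle \<Rightarrow> bool" where
  "bundle_iso \<xi> \<eta> \<longleftrightarrow> (\<exists>h. homeomorphic_map (total \<xi>) (total \<eta>) h \<and>
     (\<forall>e \<in> topspace (total \<xi>). proj \<eta> (h e) = proj \<xi> e \<and>
        (\<forall>c. h (vscale \<xi> c e) = vscale \<eta> c (h e)) \<and>
        (\<forall>e' \<in> topspace (total \<xi>). proj \<xi> e' = proj \<xi> e \<longrightarrow>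
            h (vadd \<xi> e e') = vadd \<eta> (h e) (h e'))))"

text \<open>Vectors of \<open>\<complex>\<^sup>r\<close> are the extensional functions on \<open>{..<r}\<close>.\<close>

definition trivial_bundle :: "'b topology \<Rightarrow> nat \<Rightarrow> ('b, 'b \<times> (nat \<Rightarrow> complex)) cbundle" where
  "trivial_bundle X r =
    \<lparr> total = prod_topology X (product_topology (\<lambda>_. euclidean) {..<r}),
      proj = fst,
      vadd = (\<lambda>(x, u) (_, v). (x, \<lambda>i\<in>{..<r}. u i + v i)),
      vscale = (\<lambda>c (x, u). (x, \<lambda>i\<in>{..<r}. c * u i)) \<rparr>"

definition restrict_bundle :: "('b, 'e) cbundle \<Rightarrow> 'b set \<Rightarrow> ('b, 'e) cbundle" where
  "restrict_bundle \<xi> U = \<xi>\<lparr>total := subtopology (total \<xi>) {e. proj \<xi> e \<in> U}\<rparr>"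

definition complex_vector_bundle :: "'b topology \<Rightarrow> nat \<Rightarrow> ('b, 'e) cbundle \<Rightarrow> bool" where
  "complex_vector_bundle X r \<xi> \<longleftrightarrow>
     continuous_map (total \<xi>) X (proj \<xi>) \<and>
     (\<forall>e \<in> topspace (total \<xi>).
        (\<forall>c. vscale \<xi> c e \<in> topspace (total \<xi>) \<and> proj \<xi> (vscale \<xi> c e) = proj \<xi> e) \<and>
        (\<forall>e' \<in> topspace (total \<xi>). proj \<xi> e' = proj \<xi> e \<longrightarrow>
            vadd \<xi> e e' \<in> topspace (total \<xi>) \<and> proj \<xi> (vadd \<xi> e e') = proj \<xi> e)) \<and>
     (\<forall>x \<in> topspace X. \<exists>U. openin X U \<and> x \<in> U \<and>
        bundle_iso (restrict_bundle \<xi> U) (trivial_bundle (subtopology X U) r))"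

abbreviation complex_line_bundle :: "'b topology \<Rightarrow> ('b, 'e) cbundle \<Rightarrow> bool" where
  "complex_line_bundle X \<equiv> complex_vector_bundle X 1"

text \<open>The base point is kept as a component of the total space so that the empty sum is the zero
  bundle over \<open>X\<close>.\<close>

definition whitney_family ::
    "'b topology \<Rightarrow> 'i set \<Rightarrow> ('i \<Rightarrow> ('b, 'e) cbundle) \<Rightarrow> ('b, 'b \<times> ('i \<Rightarrow> 'e)) cbundle" where
  "whitney_family X I \<xi> =
    \<lparr> total = subtopology (prod_topology X (product_topology (\<lambda>i. total (\<xi> i)) I))
                {(x, u). \<forall>i\<in>I. proj (\<xi> i) (u i) = x},
      proj = fst,
      vadd = (\<lambda>(x, u) (_, v). (x, \<lambda>i\<in>I. vadd (\<xi> i) (u i) (v i))),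
      vscale = (\<lambda>c (x, u). (x, \<lambda>i\<in>I. vscale (\<xi> i) c (u i))) \<rparr>"

definition whitney_sum ::
    "('b, 'e) cbundle \<Rightarrow> ('b, 'f) cbundle \<Rightarrow> ('b, 'e \<times> 'f) cbundle" where
  "whitney_sum \<xi> \<eta> =
    \<lparr> total = subtopology (prod_topology (total \<xi>) (total \<eta>)) {(e, f). proj \<xi> e = proj \<eta> f},
      proj = (\<lambda>(e, f). proj \<xi> e),
      vadd = (\<lambda>(e, f) (e', f'). (vadd \<xi> e e', vadd \<eta> f f')),
      vscale = (\<lambda>c (e, f). (vscale \<xi> c e, vscale \<eta> c f)) \<rparr>"


section \<open>Quasitoric manifolds\<close>

text \<open>The data \<open>(P, \<Lambda>)\<close> with \<open>n = CARD('n)\<close>, facets and columns of \<open>\<Lambda>\<close> numbered by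
  \<open>{..<nfacets}\<close>, and an orientation of \<open>M(P, \<Lambda>)\<close>. The interior of \<open>P\<close> times \<open>T\<^sup>n\<close> is a connected
  dense open subset of \<open>M(P, \<Lambda>)\<close>, so an orientation is a sign \<open>orient\<close>: \<open>1\<close> if it restricts to the
  standard orientation of \<open>P \<times> T\<^sup>n \<subseteq> \<real>\<^sup>n \<times> \<real>\<^sup>n/\<int>\<^sup>n\<close>, and \<open>-1\<close> for the reversed one.\<close>

record 'n quasitoric =
  orbit_polytope :: "(real^'n) set"
  nfacets :: nat
  facet :: "nat \<Rightarrow> (real^'n) set"
  charvec :: "nat \<Rightarrow> int^'n"
  orient :: int

definition Z_basis :: "'i set \<Rightarrow> ('i \<Rightarrow> int^'n) \<Rightarrow> bool" where
  "Z_basis J b \<longleftrightarrow> (\<forall>z. \<exists>!c. c \<in> extensional J \<and> z = (\<Sum>j\<in>J. c j *s b j))"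

definition simple_polytope :: "(real^'n) set \<Rightarrow> bool" where
  "simple_polytope P \<longleftrightarrow> polytope P \<and> aff_dim P = int CARD('n) \<and>
     (\<forall>v. v extreme_point_of P \<longrightarrow> card {F. F facet_of P \<and> v \<in> F} = CARD('n))"

definition characteristic_pair :: "'n::finite quasitoric \<Rightarrow> bool" where
  "characteristic_pair M \<longleftrightarrow>
     simple_polytope (orbit_polytope M) \<and>
     bij_betw (facet M) {..<nfacets M} {F. F facet_of orbit_polytope M} \<and>
     (\<forall>J v. J \<subseteq> {..<nfacets M} \<and> card J = CARD('n) \<and>
        v extreme_point_of orbit_polytope M \<and> (\<Inter>j\<in>J. facet M j) = {v}
        \<longrightarrow> Z_basis J (charvec M))"

definition oriented_quasitoric :: "'n::finite quasitoric \<Rightarrow> bool" where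
  "oriented_quasitoric M \<longleftrightarrow> characteristic_pair M \<and> orient M \<in> {1, -1}"

definition real_vec :: "int^'n \<Rightarrow> real^'n" where
  "real_vec z = (\<chi> i. of_int (z $ i))"

text \<open>Since \<open>T\<^sup>n = \<real>\<^sup>n/\<int>\<^sup>n\<close>, the space \<open>P \<times> T\<^sup>n / \<sim>\<close> is written as a quotient of \<open>P \<times> \<real>\<^sup>n\<close>: the
  preimage in \<open>\<real>\<^sup>n\<close> of the subtorus attached to \<open>p\<close> is the sum of \<open>\<int>\<^sup>n\<close> and of the real span of the
  vectors \<open>\<lambda>\<^sub>i\<close> with \<open>p \<in> F\<^sub>i\<close>.\<close>

definition stabilizer_lift :: "'n::finite quasitoric \<Rightarrow> real^'n \<Rightarrow> (real^'n) set" where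
  "stabilizer_lift M p =
     {real_vec z + w | z w. w \<in> span {real_vec (charvec M i) | i. i < nfacets M \<and> p \<in> facet M i}}"

definition qt_point ::
    "'n::finite quasitoric \<Rightarrow> (real^'n) \<times> (real^'n) \<Rightarrow> ((real^'n) \<times> (real^'n)) set" where
  "qt_point M = (\<lambda>(p, t). {(p, t') | t'. t - t' \<in> stabilizer_lift M p})"

definition qt_space :: "'n::finite quasitoric \<Rightarrow> ((real^'n) \<times> (real^'n)) set topology" where
  "qt_space M = quotient_of (top_of_set (orbit_polytope M \<times> UNIV)) (qt_point M)"

definition fixed_points :: "'n::finite quasitoric \<Rightarrow> ((real^'n) \<times> (real^'n)) set set" where
  "fixed_points M = {x \<in> topspace (qt_space M). \<forall>t. (\<lambda>(p, s). (p, s + t)) ` x = x}"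

definition characteristic_submanifold ::
    "'n::finite quasitoric \<Rightarrow> nat \<Rightarrow> ((real^'n) \<times> (real^'n)) set set" where
  "characteristic_submanifold M i = qt_point M ` (facet M i \<times> UNIV)"

definition facets_at :: "'n::finite quasitoric \<Rightarrow> ((real^'n) \<times> (real^'n)) set \<Rightarrow> nat set" where
  "facets_at M x = {i. i < nfacets M \<and> x \<in> characteristic_submanifold M i}"

definition vertex_sets :: "'n::finite quasitoric \<Rightarrow> nat set set" where
  "vertex_sets M =
     {{i. i < nfacets M \<and> v \<in> facet M i} | v. v extreme_point_of orbit_polytope M}"


section \<open>The canonical line bundles\<close>

text \<open>With \<open>\<Lambda> : T\<^sup>m \<rightarrow> T\<^sup>n\<close>, \<open>K = ker \<Lambda>\<close> and the moment-angle manifold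
  \<open>Z = P \<times> T\<^sup>m / \<sim>\<close>, where \<open>(p, s) \<sim> (p, s')\<close> iff \<open>s - s'\<close> lies in the coordinate subtorus
  of the \<open>i\<close> with \<open>p \<in> F\<^sub>i\<close>, one has \<open>M = Z/K\<close> and \<open>\<theta>\<^sub>k = Z \<times>\<^sub>K \<complex>\<close>, the quotient by the diagonal
  action of \<open>K\<close>, which acts on \<open>\<complex>\<close> through the \<open>k\<close>-th coordinate of \<open>T\<^sup>m\<close>. The tautological \<open>k\<close>-th
  coordinate of \<open>Z \<subseteq> \<complex>\<^sup>m\<close> is then a section of \<open>\<theta>\<^sub>k\<close> vanishing transversally along the
  characteristic submanifold over \<open>F\<^sub>k\<close>. As before, \<open>T\<^sup>m\<close> is lifted to \<open>\<real>\<^sup>m\<close>, i.e. to the extensional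
  functions on \<open>{..<m}\<close>.\<close>

definition torus_map :: "'n::finite quasitoric \<Rightarrow> (nat \<Rightarrow> real) \<Rightarrow> real^'n" where
  "torus_map M s = (\<Sum>i<nfacets M. s i *\<^sub>R real_vec (charvec M i))"

definition kernel_lift :: "'n::finite quasitoric \<Rightarrow> (nat \<Rightarrow> real) set" where
  "kernel_lift M = {\<kappa> \<in> extensional {..<nfacets M}. torus_map M \<kappa> \<in> range real_vec}"

definition theta_point :: "'n::finite quasitoric \<Rightarrow> nat \<Rightarrow> (real^'n) \<times> (nat \<Rightarrow> real) \<times> complex
    \<Rightarrow> ((real^'n) \<times> (nat \<Rightarrow> real) \<times> complex) set" where
  "theta_point M k = (\<lambda>(p, s, z).
     {(p, \<lambda>i\<in>{..<nfacets M}. s i + \<kappa> i + c i, cis (2 * pi * \<kappa> k) * z) | \<kappa> c.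
        \<kappa> \<in> kernel_lift M \<and> (\<forall>i<nfacets M. p \<notin> facet M i \<longrightarrow> c i = 0)})"

definition theta :: "'n::finite quasitoric \<Rightarrow> nat \<Rightarrow>
    (((real^'n) \<times> (real^'n)) set, ((real^'n) \<times> (nat \<Rightarrow> real) \<times> complex) set) cbundle" where
  "theta M k =
    \<lparr> total = quotient_of
        (prod_topology (top_of_set (orbit_polytope M))
          (prod_topology (product_topology (\<lambda>_. euclidean) {..<nfacets M}) euclidean))
        (theta_point M k),
      proj = (\<lambda>E. \<Union>(p, s, z)\<in>E. qt_point M (p, torus_map M s)),
      vadd = (\<lambda>E E'. {(p, s, z + z') | p s z z'. (p, s, z) \<in> E \<and> (p, s, z') \<in> E'}),
      vscale = (\<lambda>c E. (\<lambda>(p, s, z). (p, s, c * z)) ` E) \<rparr>"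

text \<open>The total space of a complex line bundle over a space with points in \<open>'b\<close> can always be
  relabelled, fibre by fibre, by elements of \<open>'b \<times> complex\<close>, so fixing this type for the total spaces of
  the \<open>\<alpha>\<^sub>j\<close> does not restrict them.\<close>

definition TNS_manifold :: "'n::finite quasitoric \<Rightarrow> bool" where
  "TNS_manifold M \<longleftrightarrow>
     (\<exists>b N. \<exists>\<alpha> :: nat \<Rightarrow>
          (((real^'n) \<times> (real^'n)) set, ((real^'n) \<times> (real^'n)) set \<times> complex) cbundle.
        (\<forall>j<b. complex_line_bundle (qt_space M) (\<alpha> j)) \<and>
        bundle_iso
          (whitney_sum (whitney_family (qt_space M) {..<nfacets M} (theta M))
                       (whitney_family (qt_space M) {..<b} \<alpha>))
          (trivial_bundle (qt_space M) N))"


section \<open>Signs of fixed points\<close>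

definition inward_normal :: "(real^'n) set \<Rightarrow> (real^'n) set \<Rightarrow> real^'n \<Rightarrow> bool" where
  "inward_normal P F \<nu> \<longleftrightarrow> \<nu> \<noteq> 0 \<and>
     (\<exists>c. (\<forall>y\<in>P. c \<le> \<nu> \<bullet> y) \<and> F = {y \<in> P. \<nu> \<bullet> y = c})"

text \<open>\<open>J\<close> is the set of facets through a vertex and \<open>j\<close> a listing of it for which the inward normals
  form a positive basis. Determinants are taken with the vectors as rows.\<close>

definition vertex_sign :: "'n::finite quasitoric \<Rightarrow> nat set \<Rightarrow> int" where
  "vertex_sign M J = orient M * (THE d. \<exists>(j :: 'n \<Rightarrow> nat) \<nu>. bij_betw j UNIV J \<and>
     (\<forall>i\<in>J. inward_normal (orbit_polytope M) (facet M i) (\<nu> i)) \<and>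
     det (\<chi> a. \<nu> (j a)) > 0 \<and> d = det (\<chi> a. charvec M (j a)))"

definition fp_sign :: "'n::finite quasitoric \<Rightarrow> ((real^'n) \<times> (real^'n)) set \<Rightarrow> int" where
  "fp_sign M x = vertex_sign M (facets_at M x)"


section \<open>Equivariant connected sum\<close>

text \<open>\<open>M\<close> is an equivariant connected sum of \<open>M\<^sub>1\<close> and \<open>M\<^sub>2\<close> at the fixed points \<open>x\<^sub>1\<close>, \<open>x\<^sub>2\<close>, orientations
  being ignored. The maps \<open>a\<^sub>1\<close>, \<open>a\<^sub>2\<close> send the facets of \<open>P\<^sub>1\<close>, \<open>P\<^sub>2\<close> to the corresponding facets of
  \<open>P = P\<^sub>1 # P\<^sub>2\<close>: the facets through the two removed vertices are merged in pairs, all other facets stay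
  distinct, and the vertices of \<open>P\<close> are the remaining vertices of \<open>P\<^sub>1\<close> and \<open>P\<^sub>2\<close>. After the changes of
  basis \<open>g\<^sub>1\<close>, \<open>g\<^sub>2\<close> the merged facets carry the standard basis, so that up to the numbering of facets
  and coordinates the matrices are \<open>(Id | A\<^sub>1)\<close>, \<open>(Id | A\<^sub>2)\<close> and \<open>(Id | A\<^sub>1 | A\<^sub>2)\<close>.\<close>

definition equivariant_connected_sum ::
    "'n::finite quasitoric \<Rightarrow> ((real^'n) \<times> (real^'n)) set \<Rightarrow>
     'n quasitoric \<Rightarrow> ((real^'n) \<times> (real^'n)) set \<Rightarrow>
     'n quasitoric \<Rightarrow> (nat \<Rightarrow> nat) \<Rightarrow> (nat \<Rightarrow> nat) \<Rightarrow> bool" where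
  "equivariant_connected_sum M1 x1 M2 x2 M a1 a2 \<longleftrightarrow>
     characteristic_pair M1 \<and> characteristic_pair M2 \<and> characteristic_pair M \<and>
     x1 \<in> fixed_points M1 \<and> x2 \<in> fixed_points M2 \<and>
     inj_on a1 {..<nfacets M1} \<and> inj_on a2 {..<nfacets M2} \<and>
     a1 ` {..<nfacets M1} \<union> a2 ` {..<nfacets M2} = {..<nfacets M} \<and>
     a1 ` {..<nfacets M1} \<inter> a2 ` {..<nfacets M2} = a1 ` facets_at M1 x1 \<and>
     a1 ` facets_at M1 x1 = a2 ` facets_at M2 x2 \<and>
     vertex_sets M = (\<lambda>J. a1 ` J) ` (vertex_sets M1 - {facets_at M1 x1})
                     \<union> (\<lambda>J. a2 ` J) ` (vertex_sets M2 - {facets_at M2 x2}) \<and>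
     (\<exists>g1 g2 :: int^'n^'n. invertible g1 \<and> invertible g2 \<and>
        (\<forall>i<nfacets M1. charvec M (a1 i) = g1 *v charvec M1 i) \<and>
        (\<forall>i<nfacets M2. charvec M (a2 i) = g2 *v charvec M2 i) \<and>
        (\<lambda>i. charvec M (a1 i)) ` facets_at M1 x1 = range (\<lambda>a. axis a 1))"

text \<open>The orientation of \<open>M\<close> restricts to the ones of \<open>M\<^sub>1\<close> and \<open>M\<^sub>2\<close>. The complements of the balls are
  connected and the bundles \<open>\<theta>\<close> restrict to each other on them; as the sign of a fixed point compares the
  orientation with the complex orientation given by the \<open>\<theta>\<close>, this says that the fixed points outside the
  balls keep their signs.\<close>

definition compatible_orientation ::
    "'n::finite quasitoric \<Rightarrow> ((real^'n) \<times> (real^'n)) set \<Rightarrow>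
     'n quasitoric \<Rightarrow> ((real^'n) \<times> (real^'n)) set \<Rightarrow>
     'n quasitoric \<Rightarrow> (nat \<Rightarrow> nat) \<Rightarrow> (nat \<Rightarrow> nat) \<Rightarrow> bool" where
  "compatible_orientation M1 x1 M2 x2 M a1 a2 \<longleftrightarrow>
     (\<forall>J \<in> vertex_sets M1 - {facets_at M1 x1}. vertex_sign M (a1 ` J) = vertex_sign M1 J) \<and>
     (\<forall>J \<in> vertex_sets M2 - {facets_at M2 x2}. vertex_sign M (a2 ` J) = vertex_sign M2 J)"

definition CP2 :: "2 quasitoric" where
  "CP2 = (let P = convex hull {0, axis 1 1, axis 2 1} in
    \<lparr> orbit_polytope = P,
      nfacets = 3,
      facet = (\<lambda>i. if i = 0 then {p \<in> P. p $ 1 = 0}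
                   else if i = 1 then {p \<in> P. p $ 2 = 0}
                   else {p \<in> P. p $ 1 + p $ 2 = 1}),
      charvec = (\<lambda>i. if i = 0 then axis 1 1 else if i = 1 then axis 2 1 else vector [-1, -1]),
      orient = 1 \<rparr>)"

definition CP2_bar :: "2 quasitoric" where
  "CP2_bar = CP2\<lparr>orient := -1\<rparr>"

definition is_B4 :: "2 quasitoric \<Rightarrow> bool" where
  "is_B4 B \<longleftrightarrow> oriented_quasitoric B \<and>
     (\<exists>x1 x2 a1 a2. equivariant_connected_sum CP2 x1 CP2_bar x2 B a1 a2 \<and>
        compatible_orientation CP2 x1 CP2_bar x2 B a1 a2)"

end

theory Submission
  imports Defs "HOL-Library.Poly_Mapping" "HOL-Combinatorics.List_Permutation"
begin

text \<open>Sums of the line bundles \<open>Z \<times>\<^sub>K \<complex>\<^sub>w\<close> are compared through matrices of \<open>K\<close>-equivariant functions on the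
  moment-angle manifold \<open>Z\<close>. In the ring of their stable classes put \<open>X\<^sub>i = \<theta>\<^sub>i - 1\<close>. The Koszul complex of
  the coordinate sections gives \<open>X\<^sub>i X\<^sub>j = 0\<close> for disjoint facets, and the rows of \<open>\<Lambda>\<close> give monomial
  relations between the \<open>\<theta>\<^sub>i\<close>. The sum with \<open>B\<^sup>4\<close> has two adjacent new facets \<open>C\<close>, \<open>Q\<close>; with
  \<open>\<pi> = X\<^sub>C X\<^sub>Q\<close> the relations yield \<open>X\<^sub>C\<^sup>2 = \<pi>\<close>, \<open>X\<^sub>Q\<^sup>2 = 0\<close>, and, moving along the edges of the polygon,
  \<open>X\<^sub>i X\<^sub>j \<in> \<int> \<pi>\<close> for all \<open>i, j\<close>. Hence \<open>\<Sum>\<^sub>i (\<theta>\<^sub>i + \<theta>\<^sub>i\<^sup>-\<^sup>1 - 2) = n \<pi>\<close> for an integer \<open>n\<close>, while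
  \<open>L + L\<^sup>-\<^sup>1 - 2\<close> equals \<open>\<pi>\<close> for \<open>L = \<theta>\<^sub>C\<close> and \<open>-\<pi>\<close> for \<open>L = \<theta>\<^sub>C \<theta>\<^sub>Q\<^sup>-\<^sup>1\<close>, so adding copies of
  \<open>L \<oplus> L\<^sup>-\<^sup>1\<close> makes the sum stably trivial. The signs of the fixed points only enter through the
  orientation: along an edge of a polygon the orientation of consecutive normals is preserved.\<close>

section \<open>Vertices and charts\<close>

text \<open>The definition of a TNS-manifold asks for an honest isomorphism with a trivial bundle,
  while ring identities control only virtual sums. Cancellation closes the gap: a line bundle with
  finitely many sections without common zeros is a summand of a trivial bundle, so a common summand
  can be traded for trivial ones. The free group ring on the characters of \<open>T^m\<close> takes
  the place of K-theory; a class vanishes when it is a difference of isomorphic sums. Each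
  \<open>\<theta>\<close> is paired with its inverse because
  \<open>L + L^-1 - 2 = L^-1 (L - 1)^2\<close> leaves only products of two classes, and these lie in
  \<open>\<int> \<pi>\<close>. The integer \<open>n\<close> can have either sign, but only genuine
  bundles can be added, so a correction of each sign must be at hand. The piece coming from
  \<open>B^4\<close> supplies both: the neighbours of \<open>C\<close> carry vectors adding up to
  minus that of \<open>C\<close> (self-intersection \<open>\<plusminus>1\<close>), the neighbours of
  \<open>Q\<close> carry equal vectors (self-intersection 0). Connectedness of the boundary of a
  polygon after removing one vertex serves twice: to spread
  \<open>X\<^sub>i X\<^sub>j \<in> \<int> \<pi>\<close> over all facets, and to compare the
  orientations of the sum with those of its summands.\<close>

type_synonym 'n point_class = "((real^'n) \<times> (real^'n)) set"

definition facets_through :: "'n::finite quasitoric \<Rightarrow> real^'n \<Rightarrow> nat set" where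
  "facets_through M p = {i. i < nfacets M \<and> p \<in> facet M i}"

lemma finite_facets_through [simp]: "finite (facets_through M p)"
  by (simp add: facets_through_def)

lemma vertex_sets_eq:
  "vertex_sets M = facets_through M ` {v. v extreme_point_of orbit_polytope M}"
  by (auto simp: vertex_sets_def facets_through_def)

definition int_dot :: "int^'n::finite \<Rightarrow> int^'n \<Rightarrow> int" where
  "int_dot x y = (\<Sum>a\<in>UNIV. x $ a * y $ a)"

text \<open>The dual basis is the inverse of the integer matrix with columns \<open>b j\<close>: its
  entries are the coefficients of the standard vectors. Existence of coefficients gives the
  expansion of \<open>z\<close>, uniqueness the biorthogonality.\<close>

lemma Z_basis_dual:
  assumes "Z_basis J b" and fin: "finite J"
  obtains d where "\<And>i j. i \<in> J \<Longrightarrow> j \<in> J \<Longrightarrow> int_dot (d i) (b j) = (if i = j then 1 else 0)"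
    and "\<And>z. z = (\<Sum>j\<in>J. int_dot (d j) z *s b j)"
proof -
  have ex: "\<exists>!c. c \<in> extensional J \<and> z = (\<Sum>j\<in>J. c j *s b j)" for z
    using assms unfolding Z_basis_def by blast
  have "\<forall>a. \<exists>c. axis a 1 = (\<Sum>j\<in>J. c j *s b j)"
    using ex by blast
  from choice[OF this] obtain c where c: "\<And>a. axis a 1 = (\<Sum>j\<in>J. c a j *s b j)" by blast
  define d where "d j = (\<chi> a. c a j)" for j
  have rep: "z = (\<Sum>j\<in>J. int_dot (d j) z *s b j)" for z
  proof -
    have "z = (\<Sum>a\<in>UNIV. z $ a *s axis a 1)"
      by (simp add: vec_eq_iff axis_def if_distrib cong: if_cong)
    also have "\<dots> = (\<Sum>a\<in>UNIV. \<Sum>j\<in>J. (z $ a * c a j) *s b j)"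
      unfolding c by (simp add: vec_eq_iff sum_distrib_left mult.assoc)
    also have "\<dots> = (\<Sum>j\<in>J. \<Sum>a\<in>UNIV. (z $ a * c a j) *s b j)"
      by (rule sum.swap)
    also have "\<dots> = (\<Sum>j\<in>J. int_dot (d j) z *s b j)"
      by (simp add: vec_eq_iff int_dot_def d_def sum_distrib_right sum_distrib_left mult_ac)
    finally show ?thesis .
  qed
  have "int_dot (d i) (b j) = (if i = j then 1 else 0)" if "i \<in> J" "j \<in> J" for i j
  proof -
    let ?c1 = "restrict (\<lambda>i. int_dot (d i) (b j)) J" and ?c2 = "restrict (\<lambda>i. if i = j then 1 else 0 :: int) J"
    have 1: "b j = (\<Sum>i\<in>J. ?c1 i *s b i)"
      by (subst rep[of "b j"]) (auto intro: sum.cong)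
    have "(\<Sum>i\<in>J. ?c2 i *s b i) = (\<Sum>i\<in>J. if i = j then b i else 0)"
      by (rule sum.cong) auto
    then have 2: "b j = (\<Sum>i\<in>J. ?c2 i *s b i)"
      using that fin by simp
    obtain c0 where "\<And>c. c \<in> extensional J \<and> b j = (\<Sum>i\<in>J. c i *s b i) \<Longrightarrow> c = c0"
      using ex[of "b j"] by blast
    then have "?c1 = c0" "?c2 = c0" using 1 2 restrict_extensional by blast+
    then have "?c1 i = ?c2 i" by simp
    then show ?thesis using that by simp
  qed
  then show thesis using rep that by blast
qed

locale char_pair =
  fixes M :: "'n::finite quasitoric"
  assumes cp: "characteristic_pair M"
begin

abbreviation "P \<equiv> orbit_polytope M"
abbreviation "m \<equiv> nfacets M"
abbreviation "V \<equiv> vertex_sets M"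
abbreviation "lam \<equiv> charvec M"

lemma polytope_P: "polytope P" and aff_dim_P: "aff_dim P = int CARD('n)"
  and simple_P: "v extreme_point_of P \<Longrightarrow> card {F. F facet_of P \<and> v \<in> F} = CARD('n)"
  using cp unfolding characteristic_pair_def simple_polytope_def by auto

lemma facet_bij: "bij_betw (facet M) {..<m} {F. F facet_of P}"
  using cp unfolding characteristic_pair_def by auto

lemma facet_facet_of: "i < m \<Longrightarrow> facet M i facet_of P"
  using facet_bij unfolding bij_betw_def by auto

lemma facet_inj: "i < m \<Longrightarrow> j < m \<Longrightarrow> facet M i = facet M j \<Longrightarrow> i = j"
  using facet_bij unfolding bij_betw_def inj_on_def by auto

lemma facet_face_of: "i < m \<Longrightarrow> facet M i face_of P"
  using facet_facet_of facet_of_imp_face_of by blast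

lemma closed_facet: "i < m \<Longrightarrow> closed (facet M i)"
  using facet_face_of polytope_P face_of_polytope_polytope polytope_imp_closed by blast

lemma convex_P: "convex P" and compact_P: "compact P"
  using polytope_P polytope_imp_convex polytope_imp_compact by auto

lemma polyhedron_P: "polyhedron P"
  using polytope_P polytope_imp_polyhedron by blast

lemma vertex_point:
  assumes "v extreme_point_of P"
  shows "(\<Inter>j\<in>facets_through M v. facet M j) = {v}" and "card (facets_through M v) = CARD('n)"
    and "facets_through M v \<in> V"
proof -
  have im: "facet M ` facets_through M v = {F. F facet_of P \<and> v \<in> F}"
    using facet_bij unfolding bij_betw_def facets_through_def by auto
  have inj: "inj_on (facet M) (facets_through M v)"
    using facet_inj by (auto simp: inj_on_def facets_through_def)
  show "card (facets_through M v) = CARD('n)"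
    using simple_P[OF assms] card_image[OF inj] im by simp
  have f: "{v} face_of P" using assms face_of_singleton by blast
  \<comment> \<open>A proper face of a polyhedron is the intersection of the facets containing it;
    properness holds because \<open>P\<close> has positive dimension.\<close>
  have "{v} \<noteq> P"
  proof
    assume "{v} = P"
    then have "aff_dim P = 0" using aff_dim_sing by metis
    then show False using aff_dim_P by simp
  qed
  then have "{v} = \<Inter>{F. F facet_of P \<and> {v} \<subseteq> F}"
    using face_of_polyhedron[OF polyhedron_P f] by blast
  also have "\<dots> = (\<Inter>j\<in>facets_through M v. facet M j)"
    using im by (metis (mono_tags, lifting) Collect_cong empty_subsetI insert_subset)
  finally show "(\<Inter>j\<in>facets_through M v. facet M j) = {v}" by simp
  show "facets_through M v \<in> V" using assms by (auto simp: vertex_sets_eq)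
qed

lemma vertex_set_point:
  assumes "J \<in> V"
  obtains v where "v extreme_point_of P" "J = facets_through M v"
  using assms by (auto simp: vertex_sets_eq)

lemma vertex_set_subset: "J \<in> V \<Longrightarrow> J \<subseteq> {..<m}"
  by (auto simp: vertex_sets_def)

lemma vertex_set_finite: "J \<in> V \<Longrightarrow> finite J"
  using vertex_set_subset finite_subset by blast

lemma finite_V: "finite V"
  using vertex_set_subset by (meson PowI finite_Pow_iff finite_lessThan finite_subset subsetI)

lemma vertex_set_card: "J \<in> V \<Longrightarrow> card J = CARD('n)"
  using vertex_point(2) vertex_set_point by metis

lemma vertex_set_basis:
  assumes "J \<in> V" shows "Z_basis J lam"
proof -
  obtain v where v: "v extreme_point_of P" "J = facets_through M v"
    using assms vertex_set_point by blast
  show ?thesis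
    using cp v vertex_point[OF v(1)] vertex_set_subset[OF assms]
    unfolding characteristic_pair_def by auto
qed

lemma facets_through_eqD:
  assumes "v extreme_point_of P" "w extreme_point_of P" "facets_through M v = facets_through M w"
  shows "v = w"
  using vertex_point(1) assms by (metis singleton_inject)

text \<open>The facets through \<open>p\<close> meet in a compact face, and any extreme point of
  that face will do. This is what makes the charts around the vertices cover the manifold.\<close>

lemma exists_vertex:
  assumes "p \<in> P"
  obtains v where "v extreme_point_of P" "facets_through M p \<subseteq> facets_through M v"
proof -
  \<comment> \<open>The empty intersection is treated apart: it would be the whole space and not
    \<open>P\<close>.\<close>
  define K where "K = (if facets_through M p = {} then P else (\<Inter>j\<in>facets_through M p. facet M j))"
  have K: "K face_of P"
  proof (cases "facets_through M p = {}")
    case False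
    then have "(\<Inter>j\<in>facets_through M p. facet M j) face_of P"
      by (intro face_of_Inter) (auto simp: facets_through_def facet_face_of)
    then show ?thesis using False by (simp add: K_def)
  qed (simp add: K_def face_of_refl convex_P)
  have "p \<in> K" using assms by (auto simp: K_def facets_through_def)
  moreover have "compact K" "convex K"
    using K compact_P convex_P face_of_imp_compact face_of_imp_convex by blast+
  ultimately obtain v where v: "v extreme_point_of K"
    using extreme_point_exists_convex by blast
  then have "v extreme_point_of P" using K extreme_point_of_face by blast
  moreover have "facets_through M p \<subseteq> facets_through M v"
  proof
    fix i assume i: "i \<in> facets_through M p"
    then have "facets_through M p \<noteq> {}" by blast
    then have "v \<in> facet M i" using v i by (auto simp: K_def extreme_point_of_def)
    with i show "i \<in> facets_through M v" by (simp add: facets_through_def)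
  qed
  ultimately show thesis using that by blast
qed

lemma exists_vertex_set:
  assumes "p \<in> P" obtains J where "J \<in> V" "facets_through M p \<subseteq> J"
  using exists_vertex[OF assms] vertex_point(3) by metis

definition dualvec :: "nat set \<Rightarrow> nat \<Rightarrow> int^'n" where
  "dualvec J = (SOME d. (\<forall>i\<in>J. \<forall>j\<in>J. int_dot (d i) (lam j) = (if i = j then 1 else 0)) \<and>
     (\<forall>z. z = (\<Sum>j\<in>J. int_dot (d j) z *s lam j)))"

lemma dualvec:
  assumes "J \<in> V"
  shows "i \<in> J \<Longrightarrow> j \<in> J \<Longrightarrow> int_dot (dualvec J i) (lam j) = (if i = j then 1 else 0)"
    and "z = (\<Sum>j\<in>J. int_dot (dualvec J j) z *s lam j)"
proof -
  have "\<exists>d. (\<forall>i\<in>J. \<forall>j\<in>J. int_dot (d i) (lam j) = (if i = j then 1 else 0)) \<and>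
     (\<forall>z. z = (\<Sum>j\<in>J. int_dot (d j) z *s lam j))"
    by (rule Z_basis_dual[OF vertex_set_basis[OF assms] vertex_set_finite[OF assms]]) blast
  from someI_ex[OF this, folded dualvec_def]
  show "i \<in> J \<Longrightarrow> j \<in> J \<Longrightarrow> int_dot (dualvec J i) (lam j) = (if i = j then 1 else 0)"
    and "z = (\<Sum>j\<in>J. int_dot (dualvec J j) z *s lam j)"
    by blast+
qed

text \<open>On the chart around a vertex with facets \<open>J\<close> the map \<open>T\<^sup>m \<rightarrow> T\<^sup>n\<close> has a section supported
  on the coordinates in \<open>J\<close>.\<close>

definition lift :: "nat set \<Rightarrow> real^'n \<Rightarrow> nat \<Rightarrow> real" where
  "lift J t = (\<lambda>i\<in>{..<m}. if i \<in> J then real_vec (dualvec J i) \<bullet> t else 0)"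

lemma lift_add: "i < m \<Longrightarrow> lift J (t + u) i = lift J t i + lift J u i"
  by (simp add: lift_def inner_add_right)

lemma lift_diff: "i < m \<Longrightarrow> lift J (t - u) i = lift J t i - lift J u i"
  by (simp add: lift_def inner_diff_right)

lemma lift_extensional [simp]: "lift J t \<in> extensional {..<m}"
  by (simp add: lift_def)

lemma real_vec_inner: "real_vec x \<bullet> real_vec y = of_int (int_dot x y)"
  by (simp add: real_vec_def inner_vec_def int_dot_def)

lemma real_vec_add: "real_vec (x + y) = real_vec x + real_vec y"
  and real_vec_diff: "real_vec (x - y) = real_vec x - real_vec y"
  and real_vec_0 [simp]: "real_vec 0 = 0"
  and real_vec_scale: "real_vec (a *s x) = of_int a *\<^sub>R real_vec x"
  by (simp_all add: real_vec_def vec_eq_iff)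

lemma real_vec_sum: "real_vec (\<Sum>i\<in>A. f i) = (\<Sum>i\<in>A. real_vec (f i))"
  by (induction A rule: infinite_finite_induct) (simp_all add: real_vec_add)

lemma torus_map_add: "torus_map M (\<lambda>i. s i + s' i) = torus_map M s + torus_map M s'"
  by (simp add: torus_map_def scaleR_add_left sum.distrib)

lemma torus_map_diff: "torus_map M (\<lambda>i. s i - s' i) = torus_map M s - torus_map M s'"
  by (simp add: torus_map_def scaleR_diff_left sum_subtractf)

lemma torus_map_cong: "(\<And>i. i < m \<Longrightarrow> s i = s' i) \<Longrightarrow> torus_map M s = torus_map M s'"
  by (simp add: torus_map_def)

lemma torus_map_int:
  assumes "\<And>i. i < m \<Longrightarrow> s i \<in> \<int>" shows "torus_map M s \<in> range real_vec"
proof -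
  have "torus_map M s = real_vec (\<Sum>i<m. \<lfloor>s i\<rfloor> *s lam i)"
    using assms by (simp add: torus_map_def real_vec_sum real_vec_scale)
  then show ?thesis by blast
qed

lemma torus_map_lift:
  assumes "J \<in> V" shows "torus_map M (lift J t) = t"
proof -
  have "torus_map M (lift J t) = (\<Sum>i<m. (if i \<in> J then real_vec (dualvec J i) \<bullet> t else 0) *\<^sub>R real_vec (lam i))"
    by (simp add: torus_map_def lift_def)
  also have "\<dots> = (\<Sum>i\<in>J. (real_vec (dualvec J i) \<bullet> t) *\<^sub>R real_vec (lam i))"
    using vertex_set_subset[OF assms]
    by (intro sum.mono_neutral_cong_right) auto
  finally have eq: "torus_map M (lift J t) = (\<Sum>i\<in>J. (real_vec (dualvec J i) \<bullet> t) *\<^sub>R real_vec (lam i))" .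
  have "linear (\<lambda>t. \<Sum>i\<in>J. (real_vec (dualvec J i) \<bullet> t) *\<^sub>R real_vec (lam i))"
    by (intro linear_compose_sum ballI linearI) (simp_all add: inner_add_right scaleR_add_left)
  moreover have "(\<Sum>i\<in>J. (real_vec (dualvec J i) \<bullet> b) *\<^sub>R real_vec (lam i)) = b" if "b \<in> Basis" for b :: "real^'n"
  proof -
    obtain a where "b = axis a 1" using \<open>b \<in> Basis\<close> by (auto simp: Basis_vec_def)
    then have "b = real_vec (axis a 1)" by (simp add: real_vec_def vec_eq_iff axis_def)
    then have "(\<Sum>i\<in>J. (real_vec (dualvec J i) \<bullet> b) *\<^sub>R real_vec (lam i))
       = real_vec (\<Sum>i\<in>J. int_dot (dualvec J i) (axis a 1) *s lam i)"
      by (simp add: real_vec_inner real_vec_sum real_vec_scale)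
    also have "\<dots> = real_vec (axis a 1)"
      using dualvec(2)[OF assms, of "axis a 1"] by simp
    finally show ?thesis using \<open>b = real_vec (axis a 1)\<close> by simp
  qed
  ultimately have "(\<lambda>t. \<Sum>i\<in>J. (real_vec (dualvec J i) \<bullet> t) *\<^sub>R real_vec (lam i)) = (\<lambda>t. t)"
    by (intro linear_eq_stdbasis linear_ident)
  then show ?thesis unfolding eq by meson
qed

lemma lift_int:
  assumes "i < m" shows "lift J (real_vec z) i \<in> \<int>"
  using assms by (simp add: lift_def real_vec_inner)

lemma lift_torus_map:
  assumes J: "J \<in> V" and s: "\<And>i. i < m \<Longrightarrow> i \<notin> J \<Longrightarrow> s i = 0" and i: "i < m"
  shows "lift J (torus_map M s) i = s i"
proof (cases "i \<in> J")
  case True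
  have "torus_map M s = (\<Sum>j\<in>J. s j *\<^sub>R real_vec (lam j))"
    unfolding torus_map_def using vertex_set_subset[OF J] s
    by (intro sum.mono_neutral_right) auto
  then have "lift J (torus_map M s) i = (\<Sum>j\<in>J. s j * of_int (int_dot (dualvec J i) (lam j)))"
    using True i by (simp add: lift_def inner_sum_right real_vec_inner)
  also have "\<dots> = (\<Sum>j\<in>J. if j = i then s j else 0)"
    using dualvec(1)[OF J True] by (intro sum.cong) auto
  also have "\<dots> = s i" using True vertex_set_finite[OF J] by simp
  finally show ?thesis .
next
  case False
  then show ?thesis using i s by (simp add: lift_def)
qed

section \<open>Points of the manifold\<close>

text \<open>Puts the span into the shape used by \<open>theta_point\<close>: a coefficient vector
  supported on the facets through \<open>p\<close>, plus an integral vector.\<close>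

lemma stabilizer_lift_iff:
  "u \<in> stabilizer_lift M p \<longleftrightarrow>
     (\<exists>z c. (\<forall>i<m. p \<notin> facet M i \<longrightarrow> c i = 0) \<and> u = real_vec z + torus_map M c)"
proof -
  let ?S = "{real_vec (lam i) | i. i < m \<and> p \<in> facet M i}"
  have span: "w \<in> span ?S \<longleftrightarrow> (\<exists>c. (\<forall>i<m. p \<notin> facet M i \<longrightarrow> c i = 0) \<and> w = torus_map M c)" for w
  proof
    assume "w \<in> span ?S"
    then show "\<exists>c. (\<forall>i<m. p \<notin> facet M i \<longrightarrow> c i = 0) \<and> w = torus_map M c"
    proof (induction rule: span_induct_alt)
      case base
      show ?case by (rule exI[of _ "\<lambda>_. 0"]) (simp add: torus_map_def)
    next
      case (step a x y)
      then obtain i c where i: "i < m" "p \<in> facet M i" "x = real_vec (lam i)"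
        and c: "\<forall>i<m. p \<notin> facet M i \<longrightarrow> c i = 0" "y = torus_map M c" by blast
      have "torus_map M (\<lambda>j. if j = i then a else 0)
          = (\<Sum>j<m. if j = i then a *\<^sub>R real_vec (lam i) else 0)"
        unfolding torus_map_def by (rule sum.cong) auto
      also have "\<dots> = a *\<^sub>R x" using i by simp
      finally have "a *\<^sub>R x + y = torus_map M (\<lambda>j. (if j = i then a else 0) + c j)"
        using c by (simp add: torus_map_add)
      moreover have "\<forall>j<m. p \<notin> facet M j \<longrightarrow> (if j = i then a else 0) + c j = 0"
        using i c by auto
      ultimately show ?case
        by (intro exI[of _ "\<lambda>j. (if j = i then a else 0) + c j"] conjI)
    qed
  next
    assume "\<exists>c. (\<forall>i<m. p \<notin> facet M i \<longrightarrow> c i = 0) \<and> w = torus_map M c"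
    then obtain c where c: "\<forall>i<m. p \<notin> facet M i \<longrightarrow> c i = 0" "w = torus_map M c" by blast
    have "c i *\<^sub>R real_vec (lam i) \<in> span ?S" if "i < m" for i
    proof (cases "p \<in> facet M i")
      case True
      then have "real_vec (lam i) \<in> ?S" using that by blast
      then show ?thesis by (intro span_scale span_base)
    qed (use c that in \<open>simp add: span_zero\<close>)
    then show "w \<in> span ?S" unfolding c torus_map_def by (intro span_sum) auto
  qed
  show ?thesis unfolding stabilizer_lift_def mem_Collect_eq span by auto
qed

lemma stabilizer_lift_0: "0 \<in> stabilizer_lift M p"
  unfolding stabilizer_lift_iff
  by (rule exI[of _ 0], rule exI[of _ "\<lambda>_. 0"]) (simp add: torus_map_def)

lemma stabilizer_lift_diff:
  assumes "u \<in> stabilizer_lift M p" "u' \<in> stabilizer_lift M p"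
  shows "u - u' \<in> stabilizer_lift M p"
proof -
  from assms obtain z c z' c' where
    "\<forall>i<m. p \<notin> facet M i \<longrightarrow> c i = 0" "u = real_vec z + torus_map M c"
    "\<forall>i<m. p \<notin> facet M i \<longrightarrow> c' i = 0" "u' = real_vec z' + torus_map M c'"
    unfolding stabilizer_lift_iff by blast
  then show ?thesis unfolding stabilizer_lift_iff
    by (intro exI[of _ "z - z'"] exI[of _ "\<lambda>i. c i - c' i"]) (auto simp: torus_map_diff real_vec_diff)
qed

lemma qt_point_eq_iff:
  "qt_point M (p, t) = qt_point M (p', t') \<longleftrightarrow> p = p' \<and> t - t' \<in> stabilizer_lift M p"
proof
  assume a: "qt_point M (p, t) = qt_point M (p', t')"
  have "(p', t') \<in> qt_point M (p', t')" by (simp add: qt_point_def stabilizer_lift_0)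
  then have "(p', t') \<in> qt_point M (p, t)" by (simp only: a)
  then show "p = p' \<and> t - t' \<in> stabilizer_lift M p" by (auto simp: qt_point_def)
next
  assume a: "p = p' \<and> t - t' \<in> stabilizer_lift M p"
  then have "t - x \<in> stabilizer_lift M p \<longleftrightarrow> t' - x \<in> stabilizer_lift M p" for x
    using stabilizer_lift_diff[of "t - x" p "t - t'"] stabilizer_lift_diff[of "t' - x" p "t' - t"]
      stabilizer_lift_diff[of 0 p "t - t'"] stabilizer_lift_0 by (auto simp: algebra_simps)
  then show "qt_point M (p, t) = qt_point M (p', t')" using a by (auto simp: qt_point_def)
qed

lemma topspace_qt: "topspace (qt_space M) = qt_point M ` (P \<times> UNIV)"
  by (simp add: qt_space_def topspace_quotient_of)

text \<open>Two representatives of a point of the chart at \<open>J\<close> differ, after lifting,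
  by integers and by coordinates collapsed at \<open>p\<close>. Functions that ignore both therefore
  descend to the chart.\<close>

lemma lift_stabilizer:
  assumes J: "J \<in> V" and p: "facets_through M p \<subseteq> J" and u: "u \<in> stabilizer_lift M p"
  obtains \<kappa> c where "\<And>i. i < m \<Longrightarrow> \<kappa> i \<in> \<int>" "\<And>i. i < m \<Longrightarrow> p \<notin> facet M i \<Longrightarrow> c i = 0"
    "\<And>i. i < m \<Longrightarrow> lift J u i = \<kappa> i + c i"
proof -
  obtain z c where zc: "\<forall>i<m. p \<notin> facet M i \<longrightarrow> c i = 0" "u = real_vec z + torus_map M c"
    using u unfolding stabilizer_lift_iff by blast
  have "lift J u i = lift J (real_vec z) i + c i" if "i < m" for i
  proof -
    have "lift J (torus_map M c) i = c i"
      using that zc p by (intro lift_torus_map[OF J]) (auto simp: facets_through_def)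
    then show ?thesis by (simp add: zc lift_add that)
  qed
  then show thesis using that[of "\<lambda>i. lift J (real_vec z) i" c] zc lift_int by blast
qed

lemma facets_at_qt_point:
  assumes "p \<in> P" shows "facets_at M (qt_point M (p, t)) = facets_through M p"
proof -
  have "qt_point M (p, t) \<in> qt_point M ` (facet M i \<times> UNIV) \<longleftrightarrow> p \<in> facet M i" for i
  proof
    assume "qt_point M (p, t) \<in> qt_point M ` (facet M i \<times> UNIV)"
    then obtain p' t' where "p' \<in> facet M i" "qt_point M (p, t) = qt_point M (p', t')" by auto
    then show "p \<in> facet M i" using qt_point_eq_iff by metis
  qed auto
  then show ?thesis by (auto simp: facets_at_def facets_through_def characteristic_submanifold_def)
qed

text \<open>At a fixed point the stabilizer lift is all of \<open>\<real>\<^sup>n\<close>. Embedding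
  the facets through \<open>p\<close> into a vertex set \<open>J\<close>, no facet of
  \<open>J\<close> can be missing without making the stabilizer smaller.\<close>

lemma fixed_point_vertex_set:
  assumes "x \<in> fixed_points M" shows "facets_at M x \<in> V"
proof -
  have "x \<in> topspace (qt_space M)" using assms by (simp add: fixed_points_def)
  then obtain p t where p: "p \<in> P" and x: "x = qt_point M (p, t)"
    by (auto simp: topspace_qt)
  obtain J where J: "J \<in> V" "facets_through M p \<subseteq> J" using exists_vertex_set p by blast
  have all: "u \<in> stabilizer_lift M p" for u
  proof -
    have "(p, t) \<in> x" by (simp add: x qt_point_def stabilizer_lift_0)
    then have "(p, t + (- u)) \<in> (\<lambda>(p, s). (p, s + - u)) ` x" by force
    also have "\<dots> = x" using assms unfolding fixed_points_def mem_Collect_eq by blast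
    finally show ?thesis by (simp add: x qt_point_def)
  qed
  have "j \<in> facets_through M p" if j: "j \<in> J" for j
  proof (rule ccontr)
    assume nj: "j \<notin> facets_through M p"
    have jm: "j < m" using j vertex_set_subset[OF J(1)] by auto
    \<comment> \<open>Half a turn in the direction of \<open>lam j\<close>: a stabilizer that misses
      facet \<open>j\<close> has only integers in this coordinate, and 1/2 is none.\<close>
    let ?s = "\<lambda>i. if i = j then 1/2 else 0 :: real"
    have s: "?s i = 0" if "i < m" "i \<notin> J" for i using that j by auto
    obtain \<kappa> c where "\<kappa> j \<in> \<int>" "c j = 0" "lift J (torus_map M ?s) j = \<kappa> j + c j"
      using lift_stabilizer[OF J all[of "torus_map M ?s"]] jm nj unfolding facets_through_def
      by (smt (verit, ccfv_SIG) mem_Collect_eq)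
    moreover have "lift J (torus_map M ?s) j = 1/2"
      using lift_torus_map[OF J(1) s jm] by simp
    ultimately have "\<kappa> j = 1/2" "\<kappa> j \<in> \<int>" by linarith+
    then have "(1/2::real) \<in> \<int>" by metis
    then obtain k where "(1/2::real) = of_int k" by (auto elim: Ints_cases)
    then have "2 * k = 1" by linarith
    then show False by presburger
  qed
  then have "facets_through M p = J" using J by blast
  then show ?thesis using facets_at_qt_point[OF p] x J by simp
qed

end

section \<open>Polygons\<close>

definition det2 :: "real^2 \<Rightarrow> real^2 \<Rightarrow> real" where
  "det2 x y = x $ 1 * y $ 2 - x $ 2 * y $ 1"

lemma inner_2: "x \<bullet> y = x $ 1 * y $ 1 + x $ 2 * y $ 2" for x y :: "real^2"
  by (simp add: inner_vec_def UNIV_2)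

lemma vec2_eq_iff: "x = y \<longleftrightarrow> x $ 1 = y $ 1 \<and> x $ 2 = y $ 2" for x y :: "'a^2"
  by (simp add: vec_eq_iff forall_2)

text \<open>\<open>e\<close> is \<open>c\<close> times \<open>x\<close> turned by a right angle,
  which turns inner products with \<open>e\<close> into determinants with \<open>x\<close>.\<close>

lemma orthogonal_2:
  fixes x e :: "real^2"
  assumes "x \<bullet> e = 0" "x \<noteq> 0"
  obtains c where "e $ 1 = - c * x $ 2" "e $ 2 = c * x $ 1" "\<And>y. y \<bullet> e = c * det2 x y"
proof -
  let ?n = "x $ 1 * x $ 1 + x $ 2 * x $ 2"
  have n: "?n \<noteq> 0" using assms(2) by (simp add: vec2_eq_iff sum_squares_eq_zero_iff)
  define c where "c = (x $ 1 * e $ 2 - x $ 2 * e $ 1) / ?n"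
  have o: "x $ 1 * e $ 1 + x $ 2 * e $ 2 = 0" using assms(1) by (simp add: inner_2)
  have "e $ 1 * ?n = - (x $ 1 * e $ 2 - x $ 2 * e $ 1) * x $ 2"
    using o by algebra
  then have 1: "e $ 1 = - c * x $ 2" using n by (simp add: c_def field_simps)
  have "e $ 2 * ?n = (x $ 1 * e $ 2 - x $ 2 * e $ 1) * x $ 1"
    using o by algebra
  then have 2: "e $ 2 = c * x $ 1" using n by (simp add: c_def field_simps)
  show thesis using that[OF 1 2] unfolding inner_2 det2_def 1 2 by (simp add: algebra_simps)
qed

lemma two_orthogonal_2:
  fixes x y e :: "real^2"
  assumes "x \<bullet> e = 0" "x \<noteq> 0" "e \<noteq> 0" "x \<bullet> z = 0"
  obtains c where "z = c *\<^sub>R e"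
proof -
  obtain a where a: "e $ 1 = - a * x $ 2" "e $ 2 = a * x $ 1"
    using orthogonal_2[OF assms(1,2)] by metis
  obtain b where b: "z $ 1 = - b * x $ 2" "z $ 2 = b * x $ 1"
    using orthogonal_2[OF assms(4,2)] by metis
  have "a \<noteq> 0" using a assms(3) by (auto simp: vec2_eq_iff)
  then have "z = (b / a) *\<^sub>R e" by (simp add: vec2_eq_iff a b)
  then show thesis using that by blast
qed

definition det_int :: "int^2 \<Rightarrow> int^2 \<Rightarrow> int" where
  "det_int x y = x $ 1 * y $ 2 - x $ 2 * y $ 1"

section \<open>Edges, neighbouring vertices and inward normals of a polygon\<close>

locale polygon_pair = char_pair M for M :: "2 quasitoric"
begin

lemma vertex_set_pair:
  assumes "J \<in> V" "i \<in> J" obtains j where "J = {i, j}" "j \<noteq> i"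
proof -
  have "card J = 2" using vertex_set_card[OF assms(1)] by simp
  then show thesis using that assms(2) by (metis card_2_iff insert_iff singletonD insert_commute)
qed

lemma vertex_pair_less: "{i, j} \<in> V \<Longrightarrow> i < m \<and> j < m"
  using vertex_set_subset by fastforce

lemma vertex_pair_neq: "{i, j} \<in> V \<Longrightarrow> i \<noteq> j"
  using vertex_set_card by fastforce

lemma disjoint_facets:
  assumes "i < m" "j < m" "i \<noteq> j" "{i, j} \<notin> V"
  shows "facet M i \<inter> facet M j = {}"
proof (rule ccontr)
  assume "facet M i \<inter> facet M j \<noteq> {}"
  then obtain p where p: "p \<in> facet M i" "p \<in> facet M j" by blast
  then have "p \<in> P" using facet_facet_of[OF assms(1)] facet_of_imp_subset by blast
  then obtain J where J: "J \<in> V" "facets_through M p \<subseteq> J" using exists_vertex_set by blast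
  then have "i \<in> J" "j \<in> J" using p assms by (auto simp: facets_through_def)
  then have "J = {i, j}" using vertex_set_pair[OF J(1)] assms(3) by (metis empty_iff insert_iff)
  then show False using assms J by simp
qed

lemma facet_endpoints:
  assumes "i < m"
  obtains v w where "v \<noteq> w" "\<And>u. u extreme_point_of P \<and> u \<in> facet M i \<longleftrightarrow> u = v \<or> u = w"
proof -
  have f: "facet M i facet_of P" using facet_facet_of assms by blast
  then have dim: "aff_dim (facet M i) = 1" using aff_dim_P unfolding facet_of_def by simp
  have pt: "polytope (facet M i)" using facet_face_of[OF assms] polytope_P face_of_polytope_polytope by blast
  have "collinear (facet M i)" using dim collinear_aff_dim by force
  moreover have "facet M i \<noteq> {}" using f by (simp add: facet_of_def)
  ultimately obtain v w where vw: "facet M i = closed_segment v w"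
    using compact_convex_collinear_segment pt polytope_imp_compact polytope_imp_convex by metis
  have "v \<noteq> w" using dim vw by (metis aff_dim_sing closed_segment_idem zero_neq_one)
  moreover have "u extreme_point_of P \<and> u \<in> facet M i \<longleftrightarrow> u = v \<or> u = w" for u
    using extreme_point_of_face[OF facet_face_of[OF assms], of u] extreme_point_of_segment[of u v w] vw
    by auto
  ultimately show thesis using that by blast
qed

text \<open>The length is left open: only signs of determinants and inner products are read off, and
  \<open>normal_unique\<close> shows that they do not depend on the choice.\<close>

definition normal :: "nat \<Rightarrow> real^2" where
  "normal i = (SOME \<nu>. inward_normal P (facet M i) \<nu>)"

lemma inward_normal_normal:
  assumes "i < m" shows "inward_normal P (facet M i) (normal i)"
proof -
  obtain a b where ab: "a \<noteq> 0" "P \<subseteq> {x. a \<bullet> x \<le> b}" "facet M i = P \<inter> {x. a \<bullet> x = b}"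
    using facet_of_polyhedron[OF polyhedron_P facet_facet_of[OF assms]] by metis
  then have "inward_normal P (facet M i) (- a)"
    unfolding inward_normal_def by (intro conjI exI[of _ "- b"]) auto
  then show ?thesis unfolding normal_def by (rule someI)
qed

lemma inward_normalD:
  assumes n: "inward_normal P (facet M i) \<nu>"
  shows "\<nu> \<noteq> 0"
    and "y \<in> facet M i \<Longrightarrow> z \<in> facet M i \<Longrightarrow> \<nu> \<bullet> (y - z) = 0"
    and "z \<in> facet M i \<Longrightarrow> y \<in> P \<Longrightarrow> 0 \<le> \<nu> \<bullet> (y - z)"
    and "z \<in> facet M i \<Longrightarrow> y \<in> P \<Longrightarrow> y \<notin> facet M i \<Longrightarrow> 0 < \<nu> \<bullet> (y - z)"
    and "z \<in> facet M i \<Longrightarrow> y \<in> P \<Longrightarrow> \<nu> \<bullet> (y - z) = 0 \<Longrightarrow> y \<in> facet M i"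
proof -
  obtain c where c: "\<And>y. y \<in> P \<Longrightarrow> c \<le> \<nu> \<bullet> y" "facet M i = {y \<in> P. \<nu> \<bullet> y = c}"
    using n unfolding inward_normal_def by blast
  show "\<nu> \<noteq> 0" using n by (simp add: inward_normal_def)
  show "y \<in> facet M i \<Longrightarrow> z \<in> facet M i \<Longrightarrow> \<nu> \<bullet> (y - z) = 0"
    and "z \<in> facet M i \<Longrightarrow> y \<in> P \<Longrightarrow> 0 \<le> \<nu> \<bullet> (y - z)"
    and "z \<in> facet M i \<Longrightarrow> y \<in> P \<Longrightarrow> \<nu> \<bullet> (y - z) = 0 \<Longrightarrow> y \<in> facet M i"
    using c by (auto simp: inner_diff_right)
  show "z \<in> facet M i \<Longrightarrow> y \<in> P \<Longrightarrow> y \<notin> facet M i \<Longrightarrow> 0 < \<nu> \<bullet> (y - z)"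
    using c(1)[of y] c(2) by (auto simp: inner_diff_right less_le)
qed

lemma extreme_point_facet:
  assumes "v extreme_point_of P"
  shows "v \<in> P" "i \<in> facets_through M v \<longleftrightarrow> i < m \<and> v \<in> facet M i"
  using assms by (auto simp: extreme_point_of_def facets_through_def)

lemma other_endpoint:
  assumes v: "v extreme_point_of P" "facets_through M v = {i, j}" "i \<noteq> j"
  obtains w k where "w extreme_point_of P" "facets_through M w = {i, k}" "k \<noteq> i" "k \<noteq> j" "w \<noteq> v"
    "w \<notin> facet M j" "v \<notin> facet M k" "w \<in> facet M i"
proof -
  have ij: "i < m" "j < m" "v \<in> facet M i" "v \<in> facet M j" using extreme_point_facet[OF v(1)] v(2) by blast+
  obtain w where w: "w extreme_point_of P" "w \<in> facet M i" "w \<noteq> v"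
    using facet_endpoints[OF ij(1)] v(1) ij by metis
  have iw: "i \<in> facets_through M w" using extreme_point_facet[OF w(1)] w(2) ij(1) by blast
  obtain k where k: "facets_through M w = {i, k}" "k \<noteq> i"
    using vertex_set_pair[OF vertex_point(3)[OF w(1)] iw] by blast
  have kj: "k \<noteq> j" using facets_through_eqD[OF v(1) w(1)] v(2) k(1) w(3) by auto
  have "j \<notin> facets_through M w" using k(1) kj v(3) by simp
  then have wj: "w \<notin> facet M j" using ij(2) by (simp add: facets_through_def)
  have "k \<in> facets_through M w" "k \<notin> facets_through M v" using k v(2) kj by simp_all
  then have "v \<notin> facet M k" by (simp add: facets_through_def)
  then show thesis using that[OF w(1) k kj w(3) wj _ w(2)] by blast
qed

lemma two_vertices:
  assumes "i < m"
  obtains j k where "{i, j} \<in> V" "{i, k} \<in> V" "j \<noteq> k" "\<And>l. {i, l} \<in> V \<Longrightarrow> l = j \<or> l = k"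
proof -
  obtain v w where vw: "v \<noteq> w" "\<And>u. u extreme_point_of P \<and> u \<in> facet M i \<longleftrightarrow> u = v \<or> u = w"
    using facet_endpoints[OF assms] by blast
  have e: "v extreme_point_of P" "w extreme_point_of P" "v \<in> facet M i" "w \<in> facet M i" using vw by blast+
  have iv: "i \<in> facets_through M v" "i \<in> facets_through M w"
    using e assms by (auto simp: facets_through_def)
  obtain j where j: "facets_through M v = {i, j}" "j \<noteq> i"
    using vertex_set_pair[OF vertex_point(3)[OF e(1)] iv(1)] by blast
  obtain k where k: "facets_through M w = {i, k}" "k \<noteq> i"
    using vertex_set_pair[OF vertex_point(3)[OF e(2)] iv(2)] by blast
  have "j \<noteq> k" using j k facets_through_eqD[OF e(1,2)] vw(1) by auto
  moreover have "l = j \<or> l = k" if il: "{i, l} \<in> V" for l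
  proof -
    obtain u where u: "u extreme_point_of P" "{i, l} = facets_through M u"
      using vertex_set_point[OF il] by blast
    then have "u \<in> facet M i" using extreme_point_facet[OF u(1)] by blast
    then have "u = v \<or> u = w" using vw(2) u(1) by blast
    then show ?thesis using u(2) j k vertex_pair_neq[OF il] by (metis doubleton_eq_iff)
  qed
  moreover have "{i, j} \<in> V" "{i, k} \<in> V"
    using vertex_point(3)[OF e(1)] vertex_point(3)[OF e(2)] j k by auto
  ultimately show thesis using that[of j k] by simp
qed

text \<open>The edge vector \<open>w - v\<close> along facet \<open>i\<close> is orthogonal to
  \<open>a\<close>, so \<open>b\<close> pairs with it as a multiple of \<open>det2 a b\<close>; this
  pairing is positive since \<open>w\<close> lies off facet \<open>j\<close>.\<close>

lemma normals_at_vertex: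
  assumes "v extreme_point_of P" "facets_through M v = {i, j}" "i \<noteq> j"
    and "inward_normal P (facet M i) a" "inward_normal P (facet M j) b"
  shows "det2 a b \<noteq> 0"
proof -
  obtain w k where w: "w extreme_point_of P" "w \<notin> facet M j" "w \<in> facet M i" "w \<noteq> v"
    using other_endpoint[OF assms(1-3)] by metis
  have vf: "v \<in> facet M i" "v \<in> facet M j" using extreme_point_facet[OF assms(1)] assms(2) by blast+
  have "a \<bullet> (w - v) = 0" using inward_normalD(2)[OF assms(4)] w vf by blast
  then obtain c where "\<And>y. y \<bullet> (w - v) = c * det2 a y"
    using orthogonal_2 inward_normalD(1)[OF assms(4)] by metis
  moreover have "0 < b \<bullet> (w - v)"
    using inward_normalD(4)[OF assms(5) vf(2)] w extreme_point_facet(1) by blast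
  ultimately show ?thesis by (metis less_irrefl mult_zero_right)
qed

text \<open>Both normals are orthogonal to the edge, hence proportional; a vertex off the edge shows
  that the factor is positive.\<close>

lemma normal_unique:
  assumes "i < m" and a: "inward_normal P (facet M i) a" and b: "inward_normal P (facet M i) b"
  obtains c where "0 < c" "a = c *\<^sub>R b"
proof -
  obtain v w where vw: "v \<noteq> w" "\<And>u. u extreme_point_of P \<and> u \<in> facet M i \<longleftrightarrow> u = v \<or> u = w"
    using facet_endpoints[OF assms(1)] by blast
  have e: "v extreme_point_of P" "w extreme_point_of P" "v \<in> facet M i" "w \<in> facet M i" using vw by blast+
  have "i \<in> facets_through M v" using e assms(1) by (simp add: facets_through_def)
  then obtain j where j: "facets_through M v = {i, j}" "j \<noteq> i"
    using vertex_set_pair[OF vertex_point(3)[OF e(1)]] by blast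
  obtain u where u: "u extreme_point_of P" "u \<notin> facet M i"
    using other_endpoint[OF e(1), of j i] j by (metis insert_commute)
  have "(w - v) \<bullet> a = 0" "(w - v) \<bullet> b = 0" "w - v \<noteq> 0"
    using inward_normalD(2)[OF a e(4,3)] inward_normalD(2)[OF b e(4,3)] vw(1) by (auto simp: inner_commute)
  then obtain c where c: "a = c *\<^sub>R b"
    using two_orthogonal_2[of "w - v" b a] inward_normalD(1)[OF b] by blast
  have "0 < a \<bullet> (u - v)" "0 < b \<bullet> (u - v)"
    using inward_normalD(4)[OF a e(3)] inward_normalD(4)[OF b e(3)] u extreme_point_facet(1) by blast+
  then have "0 < c" unfolding c by (simp add: zero_less_mult_iff)
  then show thesis using c that by blast
qed

text \<open>The listing demanded by \<open>vertex_sign\<close> is \<open>i, j\<close> if the value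
  is 1 and \<open>j, i\<close> if it is -1.\<close>

definition ori :: "nat \<Rightarrow> nat \<Rightarrow> int" where
  "ori i j = (if det2 (normal i) (normal j) > 0 then 1 else if det2 (normal i) (normal j) < 0 then -1 else 0)"

lemma ori_swap: "ori j i = - ori i j"
  by (auto simp: ori_def det2_def algebra_simps)

lemma vertex_pair_point:
  assumes "{i, j} \<in> V"
  obtains v where "v extreme_point_of P" "facets_through M v = {i, j}" "i \<noteq> j"
  using vertex_set_point[OF assms] vertex_pair_neq[OF assms] by metis

lemma ori_vertex: "{i, j} \<in> V \<Longrightarrow> ori i j = 1 \<or> ori i j = -1"
  using vertex_pair_point[of i j] normals_at_vertex inward_normal_normal vertex_pair_less
  unfolding ori_def by (metis linorder_less_linear)

text \<open>Pairing with the edge vector \<open>w - v\<close> of facet \<open>i\<close> expresses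
  both determinants with the same factor \<open>c\<close>. The vector leads away from facet
  \<open>j\<close> and into facet \<open>k\<close>, so the two signs are opposite.\<close>

lemma ori_adjacent:
  assumes "{i, j} \<in> V" "{i, k} \<in> V" "j \<noteq> k"
  shows "ori i k = - ori i j"
proof -
  obtain v where v: "v extreme_point_of P" "facets_through M v = {i, j}" "i \<noteq> j"
    using vertex_pair_point[OF assms(1)] by blast
  obtain w where w: "w extreme_point_of P" "facets_through M w = {i, k}" "i \<noteq> k"
    using vertex_pair_point[OF assms(2)] by blast
  have m: "i < m" "j < m" "k < m" using vertex_pair_less assms by blast+
  have "i \<in> facets_through M v" "j \<in> facets_through M v" "k \<notin> facets_through M v"
    "i \<in> facets_through M w" "k \<in> facets_through M w" "j \<notin> facets_through M w"
    using v w assms(3) by simp_all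
  then have vf: "v \<in> facet M i" "v \<in> facet M j" "v \<notin> facet M k" "v \<in> P"
    and wf: "w \<in> facet M i" "w \<in> facet M k" "w \<notin> facet M j" "w \<in> P"
    using m v(1) w(1) by (simp_all add: facets_through_def extreme_point_facet(1))
  note n = inward_normal_normal[OF m(1)] inward_normal_normal[OF m(2)] inward_normal_normal[OF m(3)]
  have "normal i \<bullet> (w - v) = 0" using inward_normalD(2)[OF n(1)] vf wf by blast
  then obtain c where c: "\<And>y. y \<bullet> (w - v) = c * det2 (normal i) y"
    using orthogonal_2 inward_normalD(1)[OF n(1)] by metis
  have "0 < normal j \<bullet> (w - v)" using inward_normalD(4)[OF n(2)] vf wf by blast
  moreover have "0 < normal k \<bullet> (v - w)" using inward_normalD(4)[OF n(3)] vf wf by blast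
  then have "normal k \<bullet> (w - v) < 0" by (simp add: inner_diff_right)
  ultimately show ?thesis unfolding c ori_def by (auto simp: zero_less_mult_iff mult_less_0_iff)
qed

text \<open>Consequently a vertex that is at least as high as its two neighbours is a highest one.\<close>

lemma vertex_cone:
  assumes v: "v extreme_point_of P" "facets_through M v = {i, j}" "i \<noteq> j"
    and w1: "w1 \<in> facet M i" "w1 \<in> P" "w1 \<notin> facet M j"
    and w2: "w2 \<in> facet M j" "w2 \<in> P" "w2 \<notin> facet M i"
    and y: "y \<in> P"
  obtains \<alpha> \<beta> where "0 \<le> \<alpha>" "0 \<le> \<beta>" "y - v = \<alpha> *\<^sub>R (w1 - v) + \<beta> *\<^sub>R (w2 - v)"
proof -
  have vf: "v \<in> facet M i" "v \<in> facet M j" "i < m" "j < m"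
    using extreme_point_facet[OF v(1)] v(2) by blast+
  note n = inward_normal_normal[OF vf(3)] inward_normal_normal[OF vf(4)]
  have 1: "normal i \<bullet> (w1 - v) = 0" "normal j \<bullet> (w2 - v) = 0"
    using inward_normalD(2)[OF n(1)] inward_normalD(2)[OF n(2)] vf w1 w2 by blast+
  have 2: "0 < normal i \<bullet> (w2 - v)" "0 < normal j \<bullet> (w1 - v)"
    using inward_normalD(4)[OF n(1)] inward_normalD(4)[OF n(2)] vf w1 w2 by blast+
  have 3: "0 \<le> normal i \<bullet> (y - v)" "0 \<le> normal j \<bullet> (y - v)"
    using inward_normalD(3)[OF n(1)] inward_normalD(3)[OF n(2)] vf y by blast+
  \<comment> \<open>Pairing with \<open>normal j\<close> kills \<open>w2 - v\<close> and pairing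
    with \<open>normal i\<close> kills \<open>w1 - v\<close>, which dictates both coefficients; the
    remainder \<open>z\<close> is then orthogonal to two independent normals.\<close>
  define \<alpha> where "\<alpha> = (normal j \<bullet> (y - v)) / (normal j \<bullet> (w1 - v))"
  define \<beta> where "\<beta> = (normal i \<bullet> (y - v)) / (normal i \<bullet> (w2 - v))"
  define z where "z = y - v - \<alpha> *\<^sub>R (w1 - v) - \<beta> *\<^sub>R (w2 - v)"
  have z: "normal i \<bullet> z = 0" "normal j \<bullet> z = 0"
    using 1 2 unfolding z_def \<alpha>_def \<beta>_def inner_diff_right[of _ "_ - _ - _"]
      inner_diff_right[of _ "y - v"] by simp_all
  have ne: "w1 - v \<noteq> 0" using 2(2) by auto
  obtain c where c: "z = c *\<^sub>R (w1 - v)"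
    using two_orthogonal_2[OF 1(1) inward_normalD(1)[OF n(1)] ne z(1)] by blast
  then have "c = 0" using z(2) 2(2) by simp
  then have "y - v = \<alpha> *\<^sub>R (w1 - v) + \<beta> *\<^sub>R (w2 - v)" using c by (simp add: z_def algebra_simps)
  moreover have "0 \<le> \<alpha>" "0 \<le> \<beta>" using 2 3 by (simp_all add: \<alpha>_def \<beta>_def)
  ultimately show thesis using that by blast
qed

text \<open>A linear functional with its strict minimum at the removed vertex is maximised over \<open>P\<close> on every
  component of the rest.\<close>

lemma vertex_sets_connected:
  assumes X: "X \<in> V" and S: "S \<subseteq> V - {X}" "S \<noteq> {}"
    and closed: "\<And>J K. J \<in> S \<Longrightarrow> K \<in> V - {X} \<Longrightarrow> J \<inter> K \<noteq> {} \<Longrightarrow> K \<in> S"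
  shows "S = V - {X}"
proof (rule ccontr)
  assume "S \<noteq> V - {X}"
  define S' where "S' = V - {X} - S"
  have S': "S' \<subseteq> V - {X}" "S' \<noteq> {}" using \<open>S \<noteq> V - {X}\<close> S by (auto simp: S'_def)
  have closed': "K \<in> S'" if "J \<in> S'" "K \<in> V - {X}" "J \<inter> K \<noteq> {}" for J K
    using closed[of K J] that by (auto simp: S'_def)
  obtain x where x: "x extreme_point_of P" "X = facets_through M x" using vertex_set_point[OF X] by blast
  obtain i0 where "i0 \<in> X" using vertex_set_card[OF X] by fastforce
  then obtain j0 where X0: "X = {i0, j0}" "j0 \<noteq> i0" using vertex_set_pair[OF X] by blast
  have x0: "x \<in> facet M i0" "x \<in> facet M j0" "i0 < m" "j0 < m"
    using extreme_point_facet[OF x(1)] x(2) X0 by blast+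
  note n = inward_normal_normal[OF x0(3)] inward_normal_normal[OF x0(4)]
  define f where "f y = (normal i0 + normal j0) \<bullet> y" for y
  have xmin: "f x < f y" if "y extreme_point_of P" "y \<noteq> x" for y
  proof -
    have yP: "y \<in> P" using that extreme_point_facet(1) by blast
    have "\<not> (y \<in> facet M i0 \<and> y \<in> facet M j0)"
    proof
      assume "y \<in> facet M i0 \<and> y \<in> facet M j0"
      then have "X \<subseteq> facets_through M y" using X0 x0 by (auto simp: facets_through_def)
      then have "X = facets_through M y"
        using vertex_set_card[OF X] vertex_point(2)[OF that(1)] by (metis card_subset_eq finite_facets_through)
      then show False using facets_through_eqD x that by metis
    qed
    moreover have "0 \<le> normal i0 \<bullet> (y - x)" "0 \<le> normal j0 \<bullet> (y - x)"
      using inward_normalD(3)[OF n(1)] inward_normalD(3)[OF n(2)] x0 yP by blast+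
    moreover have "y \<notin> facet M i0 \<Longrightarrow> 0 < normal i0 \<bullet> (y - x)" "y \<notin> facet M j0 \<Longrightarrow> 0 < normal j0 \<bullet> (y - x)"
      using inward_normalD(4)[OF n(1)] inward_normalD(4)[OF n(2)] x0 yP by blast+
    ultimately have "0 < (normal i0 + normal j0) \<bullet> (y - x)" unfolding inner_add_left
      by (smt (verit))
    then show ?thesis by (simp add: f_def inner_diff_right)
  qed
  \<comment> \<open>In a class \<open>T\<close> closed under adjacency away from \<open>X\<close>, a
    highest vertex is at least as high as both its neighbours: a neighbour outside \<open>T\<close>
    can only be \<open>x\<close>, the lowest vertex of all.\<close>
  have max: "\<exists>v i j w1 w2. v extreme_point_of P \<and> facets_through M v \<in> T \<and> facets_through M v = {i, j} \<and> i \<noteq> j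
      \<and> w1 \<in> facet M i \<and> w1 \<in> P \<and> w1 \<notin> facet M j \<and> w2 \<in> facet M j \<and> w2 \<in> P \<and> w2 \<notin> facet M i
      \<and> f w1 \<le> f v \<and> f w2 \<le> f v"
    if T: "T \<subseteq> V - {X}" "T \<noteq> {}" and cl: "\<forall>J\<in>T. \<forall>K\<in>V - {X}. J \<inter> K \<noteq> {} \<longrightarrow> K \<in> T" for T
  proof -
    define E where "E = {v. v extreme_point_of P \<and> facets_through M v \<in> T}"
    have "inj_on (facets_through M) E" using facets_through_eqD by (auto simp: inj_on_def E_def)
    moreover have "facets_through M ` E \<subseteq> V" using T by (auto simp: E_def)
    ultimately have "finite E" using finite_V finite_imageD finite_subset by metis
    moreover have "E \<noteq> {}" using T vertex_set_point unfolding E_def by blast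
    ultimately have "Max (f ` E) \<in> f ` E" and le_Max: "\<And>u. u \<in> E \<Longrightarrow> f u \<le> Max (f ` E)"
      by (auto intro: Max_in)
    then obtain v where vE: "v \<in> E" and vmax: "\<And>u. u \<in> E \<Longrightarrow> f u \<le> f v"
      by (metis imageE)
    have v: "v extreme_point_of P" "facets_through M v \<in> T" using vE by (auto simp: E_def)
    then have vV: "facets_through M v \<in> V" using T by blast
    obtain i where i: "i \<in> facets_through M v" using vertex_set_card[OF vV] by fastforce
    obtain j where ij: "facets_through M v = {i, j}" "j \<noteq> i" using vertex_set_pair[OF vV i] by blast
    have nb: "f w \<le> f v" if "w extreme_point_of P" "facets_through M w \<inter> facets_through M v \<noteq> {}" for w
    proof (cases "w = x")
      case True
      then have "v \<noteq> x" using T v x by auto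
      then show ?thesis using xmin[OF v(1)] True by simp
    next
      case False
      then have "facets_through M w \<in> V - {X}"
        using vertex_point(3)[OF that(1)] facets_through_eqD[OF that(1) x(1)] x(2) by auto
      then have "facets_through M w \<in> T" using cl v(2) that(2) by (metis Int_commute)
      then have "w \<in> E" using that(1) by (simp add: E_def)
      then show ?thesis using vmax by blast
    qed
    obtain w1 k1 where w1: "w1 extreme_point_of P" "facets_through M w1 = {i, k1}" "w1 \<notin> facet M j" "w1 \<in> facet M i"
      using other_endpoint[OF v(1) ij(1)] ij(2) by metis
    have "facets_through M v = {j, i}" "j \<noteq> i" using ij by auto
    from other_endpoint[OF v(1) this]
    obtain w2 k2 where w2: "w2 extreme_point_of P" "facets_through M w2 = {j, k2}" "w2 \<notin> facet M i" "w2 \<in> facet M j"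
      by metis
    have "f w1 \<le> f v" "f w2 \<le> f v" using nb w1 w2 ij by blast+
    then show ?thesis using v ij w1 w2 extreme_point_facet(1)
      by (intro exI[of _ v] exI[of _ i] exI[of _ j] exI[of _ w1] exI[of _ w2]) auto
  qed
  have glob: "f y \<le> f v" if g: "v extreme_point_of P" "facets_through M v = {i, j}" "i \<noteq> j"
      "w1 \<in> facet M i" "w1 \<in> P" "w1 \<notin> facet M j" "w2 \<in> facet M j" "w2 \<in> P" "w2 \<notin> facet M i"
      "f w1 \<le> f v" "f w2 \<le> f v" "y \<in> P" for v i j w1 w2 y
  proof -
    obtain a b where ab: "0 \<le> a" "0 \<le> b" "y - v = a *\<^sub>R (w1 - v) + b *\<^sub>R (w2 - v)"
      using vertex_cone[OF g(1-9,12)] by blast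
    have "f y - f v = (normal i0 + normal j0) \<bullet> (y - v)" by (simp add: f_def inner_diff_right)
    also have "\<dots> = a * (f w1 - f v) + b * (f w2 - f v)"
      unfolding ab(3) by (simp add: f_def inner_add_right inner_diff_right)
    also have "\<dots> \<le> 0" using ab that by (intro add_nonpos_nonpos mult_nonneg_nonpos) auto
    finally show ?thesis by simp
  qed
  obtain v i j w1 w2 where v: "v extreme_point_of P" "facets_through M v \<in> S" "facets_through M v = {i, j}" "i \<noteq> j"
      "w1 \<in> facet M i" "w1 \<in> P" "w1 \<notin> facet M j" "w2 \<in> facet M j" "w2 \<in> P" "w2 \<notin> facet M i"
      "f w1 \<le> f v" "f w2 \<le> f v"
    using max[OF S] closed by blast
  obtain v' where v': "v' extreme_point_of P" "facets_through M v' \<in> S'" "\<And>y. y \<in> P \<Longrightarrow> f y \<le> f v'"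
  proof -
    obtain u i j w1 w2 where u: "u extreme_point_of P" "facets_through M u \<in> S'" "facets_through M u = {i, j}" "i \<noteq> j"
      "w1 \<in> facet M i" "w1 \<in> P" "w1 \<notin> facet M j" "w2 \<in> facet M j" "w2 \<in> P" "w2 \<notin> facet M i"
      "f w1 \<le> f u" "f w2 \<le> f u"
      using max[OF S'] closed' by blast
    show thesis by (rule that[OF u(1,2)]) (rule glob[OF u(1,3-12)])
  qed
  have vP: "v \<in> P" "v' \<in> P" using v v' extreme_point_facet(1) by blast+
  have ij: "i < m" "j < m" "v \<in> facet M i" "v \<in> facet M j" using extreme_point_facet[OF v(1)] v(3) by blast+
  \<comment> \<open>Both classes attain the global maximum of \<open>f\<close>, at \<open>v\<close>
    and at \<open>v'\<close>. As \<open>v'\<close> shares no facet with \<open>v\<close>, the cone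
    coefficients \<open>a\<close>, \<open>b\<close> are positive, so \<open>w1\<close> and
    \<open>w2\<close> are as high as \<open>v\<close>. Then \<open>f\<close> is constant on the cone
    at \<open>v\<close>, and \<open>x\<close> cannot be lower.\<close>
  have eq: "f v' = f v" using glob[OF v(1,3-12) vP(2)] v'(3)[OF vP(1)] by simp
  obtain a b where ab: "0 \<le> a" "0 \<le> b" "v' - v = a *\<^sub>R (w1 - v) + b *\<^sub>R (w2 - v)"
    using vertex_cone[OF v(1,3-10) vP(2)] by blast
  have "f v' - f v = (normal i0 + normal j0) \<bullet> (v' - v)" by (simp add: f_def inner_diff_right)
  also have "\<dots> = a * (f w1 - f v) + b * (f w2 - f v)"
    unfolding ab(3) by (simp add: f_def inner_add_right inner_diff_right)
  finally have sum0: "a * (f w1 - f v) + b * (f w2 - f v) = 0" using eq by simp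
  have le: "a * (f w1 - f v) \<le> 0" "b * (f w2 - f v) \<le> 0" using ab v by (auto intro: mult_nonneg_nonpos)
  have disj: "k \<notin> facets_through M v'" if "k \<in> facets_through M v" for k
    using closed[OF v(2), of "facets_through M v'"] v'(2) that S' by (auto simp: S'_def)
  have apart: "v' \<notin> facet M i" "v' \<notin> facet M j"
    using disj v(3) ij extreme_point_facet[OF v'(1)] by blast+
  have "a \<noteq> 0"
  proof
    assume "a = 0"
    then have "normal j \<bullet> (v' - v) = 0"
      using ab(3) inward_normalD(2)[OF inward_normal_normal[OF ij(2)] v(8) ij(4)] by simp
    then show False using inward_normalD(5)[OF inward_normal_normal[OF ij(2)] ij(4) vP(2)] apart by blast
  qed
  moreover have "b \<noteq> 0"
  proof
    assume "b = 0"
    then have "normal i \<bullet> (v' - v) = 0"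
      using ab(3) inward_normalD(2)[OF inward_normal_normal[OF ij(1)] v(5) ij(3)] by simp
    then show False using inward_normalD(5)[OF inward_normal_normal[OF ij(1)] ij(3) vP(2)] apart by blast
  qed
  moreover have "a * (f w1 - f v) = 0" "b * (f w2 - f v) = 0" using sum0 le by linarith+
  ultimately have w: "f w1 = f v" "f w2 = f v" by simp_all
  have xP: "x \<in> P" using x extreme_point_facet(1) by blast
  obtain c d where cd: "x - v = c *\<^sub>R (w1 - v) + d *\<^sub>R (w2 - v)"
    using vertex_cone[OF v(1,3-10) xP] by blast
  have "f x - f v = (normal i0 + normal j0) \<bullet> (x - v)" by (simp add: f_def inner_diff_right)
  also have "\<dots> = c * (f w1 - f v) + d * (f w2 - f v)"
    unfolding cd by (simp add: f_def inner_add_right inner_diff_right)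
  finally have "f x = f v" using w by simp
  moreover have "v \<noteq> x" using v(2) S x by auto
  ultimately show False using xmin[OF v(1)] by simp
qed

text \<open>Multiplied by the determinant of the dual basis it becomes the determinant of the
  pairing matrix, which is the identity; so it is an integer unit.\<close>

lemma det_int_vertex:
  assumes "{i, j} \<in> V" shows "det_int (lam i) (lam j) = 1 \<or> det_int (lam i) (lam j) = -1"
proof -
  let ?d = "dualvec {i, j}"
  have "det_int (?d i) (?d j) * det_int (lam i) (lam j)
     = int_dot (?d i) (lam i) * int_dot (?d j) (lam j) - int_dot (?d i) (lam j) * int_dot (?d j) (lam i)"
    by (simp add: det_int_def int_dot_def UNIV_2 algebra_simps)
  also have "\<dots> = 1" using dualvec(1)[OF assms] vertex_pair_neq[OF assms] by simp
  finally have "det_int (lam i) (lam j) dvd 1" by (metis dvd_triv_right)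
  then show ?thesis by (simp add: zdvd1_eq abs_if split: if_splits)
qed

text \<open>Exchanging the listing negates both determinants and rescaling normals by positive
  factors keeps their sign, so the value described in \<open>vertex_sign\<close> is unique and
  equals this symmetric product.\<close>

lemma vertex_sign_eq:
  assumes ij: "{i, j} \<in> V"
  shows "vertex_sign M {i, j} = orient M * (ori i j * det_int (lam i) (lam j))"
proof -
  have det: "det (\<chi> a. f a) = f 1 $ 1 * f 2 $ 2 - f 1 $ 2 * f 2 $ 1" for f :: "2 \<Rightarrow> 'a::comm_ring_1^2"
    by (simp add: det_2)
  have m: "i < m" "j < m" using vertex_pair_less[OF ij] by auto
  have ne: "i \<noteq> j" using vertex_pair_neq[OF ij] .
  have sgn: "0 < det2 a b \<longleftrightarrow> 0 < det2 (normal k) (normal l)"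
    if kl: "inward_normal P (facet M k) a" "inward_normal P (facet M l) b" "k < m" "l < m" for k l a b
  proof -
    obtain c where "0 < c" "a = c *\<^sub>R normal k"
      using normal_unique[OF kl(3,1) inward_normal_normal[OF kl(3)]] by metis
    moreover obtain d where "0 < d" "b = d *\<^sub>R normal l"
      using normal_unique[OF kl(4,2) inward_normal_normal[OF kl(4)]] by metis
    ultimately have "det2 a b = c * d * det2 (normal k) (normal l)" "0 < c * d"
      by (simp_all add: det2_def algebra_simps)
    then show ?thesis by (metis mult_pos_pos zero_less_mult_pos)
  qed
  have "(THE d. \<exists>(f :: 2 \<Rightarrow> nat) \<nu>. bij_betw f UNIV {i, j} \<and>
     (\<forall>k\<in>{i, j}. inward_normal P (facet M k) (\<nu> k)) \<and>
     det (\<chi> a. \<nu> (f a)) > 0 \<and> d = det (\<chi> a. lam (f a))) = ori i j * det_int (lam i) (lam j)" (is "(THE d. ?Q d) = _")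
  proof (rule the_equality)
    define f :: "2 \<Rightarrow> nat" where "f a = (if ori i j = 1 then (if a = 1 then i else j) else (if a = 1 then j else i))" for a
    have "bij_betw f UNIV {i, j}" using ne unfolding bij_betw_def inj_on_def
      by (auto simp: f_def UNIV_2 forall_2)
    moreover have "\<forall>k\<in>{i, j}. inward_normal P (facet M k) (normal k)"
      using inward_normal_normal m by auto
    moreover have "det (\<chi> a. normal (f a)) > 0"
      using ori_vertex[OF ij] unfolding det f_def by (auto simp: ori_def det2_def algebra_simps split: if_splits)
    moreover have "ori i j * det_int (lam i) (lam j) = det (\<chi> a. lam (f a))"
      using ori_vertex[OF ij] unfolding det f_def by (auto simp: det_int_def)
    ultimately show "?Q (ori i j * det_int (lam i) (lam j))" by blast
  next
    fix d assume "?Q d"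
    then obtain f :: "2 \<Rightarrow> nat" and \<nu> where f: "bij_betw f UNIV {i, j}"
      and \<nu>: "\<forall>k\<in>{i, j}. inward_normal P (facet M k) (\<nu> k)"
      and d: "det (\<chi> a. \<nu> (f a)) > 0" "d = det (\<chi> a. lam (f a))" by blast
    have "(1::2) \<noteq> 2" by simp
    then have "f 1 \<noteq> f 2" using f by (auto simp: bij_betw_def dest: injD)
    moreover have "f 1 \<in> {i, j}" "f 2 \<in> {i, j}" using f by (auto simp: bij_betw_def)
    ultimately consider "f 1 = i" "f 2 = j" | "f 1 = j" "f 2 = i" by auto
    then show "d = ori i j * det_int (lam i) (lam j)"
    proof cases
      case 1
      have "0 < det2 (\<nu> i) (\<nu> j)" using d(1) unfolding det 1 by (simp add: det2_def)
      then have "0 < det2 (normal i) (normal j)" using sgn[of i "\<nu> i" j "\<nu> j"] \<nu> m by auto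
      then have "ori i j = 1" by (simp add: ori_def)
      then show ?thesis unfolding d(2) det 1 by (simp add: det_int_def)
    next
      case 2
      have "0 < det2 (\<nu> j) (\<nu> i)" using d(1) unfolding det 2 by (simp add: det2_def)
      then have "0 < det2 (normal j) (normal i)" using sgn[of j "\<nu> j" i "\<nu> i"] \<nu> m by auto
      then have "ori j i = 1" by (simp add: ori_def)
      then have "ori i j = -1" using ori_swap[of i j] by simp
      then show ?thesis unfolding d(2) det 2 by (simp add: det_int_def)
    qed
  qed
  then show ?thesis by (simp add: vertex_sign_def)
qed

end

section \<open>Orientation of the connected sum\<close>

lemma equivariant_connected_sumD:
  assumes "equivariant_connected_sum M1 x1 M2 x2 M a1 a2"
  shows "characteristic_pair M1" "characteristic_pair M2" "characteristic_pair M"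
    and "x1 \<in> fixed_points M1" "x2 \<in> fixed_points M2"
    and "inj_on a1 {..<nfacets M1}" "inj_on a2 {..<nfacets M2}"
    and "a1 ` {..<nfacets M1} \<union> a2 ` {..<nfacets M2} = {..<nfacets M}"
    and "a1 ` {..<nfacets M1} \<inter> a2 ` {..<nfacets M2} = a1 ` facets_at M1 x1"
    and "a1 ` facets_at M1 x1 = a2 ` facets_at M2 x2"
    and "vertex_sets M = (\<lambda>J. a1 ` J) ` (vertex_sets M1 - {facets_at M1 x1})
                     \<union> (\<lambda>J. a2 ` J) ` (vertex_sets M2 - {facets_at M2 x2})"
    and "\<exists>g1 g2. invertible g1 \<and> invertible g2 \<and>
        (\<forall>i<nfacets M1. charvec M (a1 i) = g1 *v charvec M1 i) \<and>
        (\<forall>i<nfacets M2. charvec M (a2 i) = g2 *v charvec M2 i) \<and>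
        (\<lambda>i. charvec M (a1 i)) ` facets_at M1 x1 = range (\<lambda>a. axis a 1)"
  by (insert assms[unfolded equivariant_connected_sum_def], elim conjE, assumption)+

text \<open>Lets results about the first summand be read for the second; the standard basis
  condition moves over because the merged facets coincide.\<close>

lemma equivariant_connected_sum_swap:
  assumes "equivariant_connected_sum M1 x1 M2 x2 M a1 a2"
  shows "equivariant_connected_sum M2 x2 M1 x1 M a2 a1"
proof -
  let ?f1 = "facets_at M1 x1" and ?f2 = "facets_at M2 x2"
  note s = equivariant_connected_sumD[OF assms]
  obtain g1 g2 where g: "invertible g1" "invertible g2"
     "\<forall>i<nfacets M1. charvec M (a1 i) = g1 *v charvec M1 i"
     "\<forall>i<nfacets M2. charvec M (a2 i) = g2 *v charvec M2 i"
     "(\<lambda>i. charvec M (a1 i)) ` ?f1 = range (\<lambda>a. axis a 1)"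
    using s(12) by (elim exE conjE)
  have "(\<lambda>i. charvec M (a2 i)) ` ?f2 = charvec M ` (a2 ` ?f2)" by (simp add: image_image)
  also have "\<dots> = (\<lambda>i. charvec M (a1 i)) ` ?f1" by (simp add: s(10)[symmetric] image_image)
  finally have ax: "(\<lambda>i. charvec M (a2 i)) ` ?f2 = range (\<lambda>a. axis a 1)" using g by simp
  show ?thesis unfolding equivariant_connected_sum_def
    by (intro conjI exI[of _ g2] exI[of _ g1] s(1-7) g(1-4) ax s(10)[symmetric])
      (use s(8-11) in \<open>simp_all add: Int_commute Un_commute\<close>)
qed

lemma det_int_mult:
  "det_int (g *v x) (g *v y) = det g * det_int x y" for g :: "int^2^2"
  by (simp add: det_int_def matrix_vector_mult_def det_2 sum_2 algebra_simps)

lemma det_int_invertible: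
  assumes "invertible (g :: int^2^2)" shows "det g = 1 \<or> det g = -1"
proof -
  obtain h where "g ** h = mat 1" using assms by (auto simp: invertible_def)
  then have "det g * det h = 1" by (metis det_I det_mul)
  then have "det g dvd 1" by (metis dvd_triv_left)
  then show ?thesis by (simp add: zdvd1_eq abs_if split: if_splits)
qed

section \<open>The polygon of the sum compared with its summands\<close>

locale polygon_sum =
  fixes M1 M2 M :: "2 quasitoric" and x1 x2 a1 a2
  assumes sum: "equivariant_connected_sum M1 x1 M2 x2 M a1 a2"
begin

sublocale M1: polygon_pair M1 using equivariant_connected_sumD[OF sum] by (simp add: polygon_pair_def char_pair_def)
sublocale M2: polygon_pair M2 using equivariant_connected_sumD[OF sum] by (simp add: polygon_pair_def char_pair_def)
sublocale M: polygon_pair M using equivariant_connected_sumD[OF sum] by (simp add: polygon_pair_def char_pair_def)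

abbreviation "X1 \<equiv> facets_at M1 x1"
abbreviation "X2 \<equiv> facets_at M2 x2"

lemmas sumD = equivariant_connected_sumD[OF sum]

lemma X_vertex: "X1 \<in> M1.V" "X2 \<in> M2.V"
  using sumD(4,5) M1.fixed_point_vertex_set M2.fixed_point_vertex_set by simp_all

lemma inj_a: "inj_on a1 {..<M1.m}" "inj_on a2 {..<M2.m}"
  and range_a: "a1 ` {..<M1.m} \<union> a2 ` {..<M2.m} = {..<M.m}"
  and range_a_Int: "a1 ` {..<M1.m} \<inter> a2 ` {..<M2.m} = a1 ` X1"
  and merged: "a1 ` X1 = a2 ` X2"
  and V_sum: "M.V = (\<lambda>J. a1 ` J) ` (M1.V - {X1}) \<union> (\<lambda>J. a2 ` J) ` (M2.V - {X2})"
  by (fact sumD)+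

lemma image_a1_V: "J \<in> M1.V \<Longrightarrow> J \<noteq> X1 \<Longrightarrow> a1 ` J \<in> M.V"
  using V_sum by blast

text \<open>The ratio of the two orientations stays the same along an edge, as both change sign
  between its ends by \<open>ori_adjacent\<close>; connectedness of the boundary without the vertex
  \<open>X1\<close> makes it one constant.\<close>

lemma ori_image_const:
  obtains e where "e = 1 \<or> e = -1"
    "\<And>i j. {i, j} \<in> M1.V - {X1} \<Longrightarrow> M.ori (a1 i) (a1 j) = e * M1.ori i j"
proof (cases "M1.V - {X1} = {}")
  case True
  then show thesis by (intro that[of 1]) (auto simp del: Diff_eq_empty_iff)
next
  case False
  define r where "r i j = M.ori (a1 i) (a1 j) * M1.ori i j" for i j
  have r_swap: "r i j = r j i" for i j
    unfolding r_def using M.ori_swap[of "a1 i" "a1 j"] M1.ori_swap[of i j] by simp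
  have r_unit: "r i j = 1 \<or> r i j = -1" if "{i, j} \<in> M1.V - {X1}" for i j
  proof -
    have "{a1 i, a1 j} \<in> M.V" using image_a1_V[of "{i, j}"] that by simp
    then show ?thesis unfolding r_def using M.ori_vertex M1.ori_vertex[of i j] that by fastforce
  qed
  have r_adj: "r i j = r i k" if ij: "{i, j} \<in> M1.V - {X1}" "{i, k} \<in> M1.V - {X1}" for i j k
  proof (cases "j = k")
    case False
    have "{a1 i, a1 j} \<in> M.V" "{a1 i, a1 k} \<in> M.V" using image_a1_V[of "{i, j}"] image_a1_V[of "{i, k}"] ij by simp_all
    moreover have "j < M1.m" "k < M1.m" using M1.vertex_pair_less ij by blast+
    then have "a1 j \<noteq> a1 k" using inj_a(1) False by (auto dest: inj_onD)
    ultimately have "M.ori (a1 i) (a1 k) = - M.ori (a1 i) (a1 j)" by (rule M.ori_adjacent)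
    moreover have "M1.ori i k = - M1.ori i j" using M1.ori_adjacent[of i j k] ij False by blast
    ultimately show ?thesis by (simp add: r_def)
  qed simp
  have card2: "\<exists>i j. J = {i, j}" if "J \<in> M1.V" for J
    using M1.vertex_set_card[OF that] by (auto simp: card_2_iff)
  obtain J0 where J0: "J0 \<in> M1.V - {X1}" using False by blast
  then obtain i0 j0 where ij0: "J0 = {i0, j0}" using card2 by blast
  define S where "S = {J \<in> M1.V - {X1}. \<exists>i j. J = {i, j} \<and> r i j = r i0 j0}"
  have S_all: "S = M1.V - {X1}"
  proof (rule M1.vertex_sets_connected[OF X_vertex(1)])
    show "S \<subseteq> M1.V - {X1}" "S \<noteq> {}" using J0 ij0 by (auto simp: S_def)
    fix J K assume J: "J \<in> S" and K: "K \<in> M1.V - {X1}" "J \<inter> K \<noteq> {}"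
    obtain i j where ij: "J = {i, j}" "r i j = r i0 j0" "J \<in> M1.V - {X1}" using J by (auto simp: S_def)
    obtain l where l: "l \<in> J" "l \<in> K" using K by blast
    obtain k where k: "K = {l, k}" using M1.vertex_set_pair[OF _ l(2)] K by blast
    have "\<exists>j'. J = {l, j'} \<and> r l j' = r i0 j0"
      using l(1) ij r_swap by (metis insert_commute insertE singletonD)
    then have "r l k = r i0 j0" using r_adj[of l _ k] ij(3) K(1) k by metis
    then show "K \<in> S" using K k by (auto simp: S_def)
  qed
  have all: "r i j = r i0 j0" if "{i, j} \<in> M1.V - {X1}" for i j
  proof -
    have "{i, j} \<in> S" using that S_all by simp
    then obtain i' j' where "{i, j} = {i', j'}" "r i' j' = r i0 j0" by (auto simp: S_def)
    then show ?thesis using r_swap by (metis doubleton_eq_iff)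
  qed
  show thesis
  proof (rule that[of "r i0 j0"])
    show "r i0 j0 = 1 \<or> r i0 j0 = -1" using r_unit J0 ij0 by blast
    fix i j assume ij: "{i, j} \<in> M1.V - {X1}"
    then have "M1.ori i j * M1.ori i j = 1" using M1.ori_vertex[of i j] by auto
    then show "M.ori (a1 i) (a1 j) = r i0 j0 * M1.ori i j"
      using all[OF ij] unfolding r_def by (metis mult.assoc mult.right_neutral)
  qed
qed

end

text \<open>Going around \<open>P\<^sub>1 # P\<^sub>2\<close> traverses one of the two polygons against its orientation relative to the
  merged vertex, so opposite signs at the two removed points are what makes the orientations fit.\<close>

lemma compatible_orientation_exists:
  fixes M1 M2 M :: "2 quasitoric"
  assumes sum: "equivariant_connected_sum M1 x1 M2 x2 M a1 a2"
    and o1: "orient M1 = 1 \<or> orient M1 = -1" and o2: "orient M2 = 1 \<or> orient M2 = -1"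
    and sg: "fp_sign M1 x1 = - fp_sign M2 x2"
  shows "\<exists>s\<in>{1, -1}. compatible_orientation M1 x1 M2 x2 (M\<lparr>orient := s\<rparr>) a1 a2"
proof -
  interpret A: polygon_sum M1 M2 M x1 x2 a1 a2 by (rule polygon_sum.intro[OF sum])
  interpret B: polygon_sum M2 M1 M x2 x1 a2 a1
    by (rule polygon_sum.intro[OF equivariant_connected_sum_swap[OF sum]])
  obtain e1 where e1: "e1 = 1 \<or> e1 = -1"
      "\<And>i j. {i, j} \<in> A.M1.V - {A.X1} \<Longrightarrow> A.M.ori (a1 i) (a1 j) = e1 * A.M1.ori i j"
    using A.ori_image_const by blast
  obtain e2 where e2: "e2 = 1 \<or> e2 = -1"
      "\<And>i j. {i, j} \<in> A.M2.V - {A.X2} \<Longrightarrow> A.M.ori (a2 i) (a2 j) = e2 * A.M2.ori i j"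
    using B.ori_image_const by blast
  obtain g1 g2 where g: "invertible g1" "invertible g2"
     "\<And>i. i < A.M1.m \<Longrightarrow> charvec M (a1 i) = g1 *v charvec M1 i"
     "\<And>i. i < A.M2.m \<Longrightarrow> charvec M (a2 i) = g2 *v charvec M2 i"
    using A.sumD(12) by blast
  note dg = det_int_invertible[OF g(1)] det_int_invertible[OF g(2)]
  obtain p q where pq: "A.X1 = {p, q}" "p \<noteq> q"
    using A.M1.vertex_set_card[OF A.X_vertex(1)] by (auto simp: card_2_iff)
  then have pqV: "{p, q} \<in> A.M1.V" using A.X_vertex by simp
  have pqm: "p < A.M1.m" "q < A.M1.m" using A.M1.vertex_pair_less[OF pqV] by simp_all
  have "a1 p \<in> a2 ` A.X2" "a1 q \<in> a2 ` A.X2" using A.merged pq by auto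
  then obtain p' q' where p'q': "p' \<in> A.X2" "q' \<in> A.X2" "a2 p' = a1 p" "a2 q' = a1 q" by (metis imageE)
  have "a1 p \<noteq> a1 q" using A.inj_a(1) pqm pq(2) by (auto dest: inj_onD)
  then have "p' \<noteq> q'" using p'q' by auto
  moreover obtain r where "A.X2 = {p', r}" using A.M2.vertex_set_pair[OF A.X_vertex(2) p'q'(1)] .
  ultimately have X2: "A.X2 = {p', q'}" using p'q'(2) by auto
  then have p'q'V: "{p', q'} \<in> A.M2.V" using A.X_vertex by simp
  have p'q'm: "p' < A.M2.m" "q' < A.M2.m" using A.M2.vertex_pair_less[OF p'q'V] by simp_all
  \<comment> \<open>\<open>k\<close> and \<open>k'\<close> sit at the far ends of the edges
    \<open>p\<close> and \<open>p'\<close>. In the sum they are the two neighbours of the merged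
    edge \<open>a1 p\<close>, and this edge is where \<open>e1\<close> and \<open>e2\<close> can be
    compared.\<close>
  obtain k where k: "{p, k} \<in> A.M1.V" "k \<noteq> q" using A.M1.two_vertices[OF pqm(1)] by metis
  obtain k' where k': "{p', k'} \<in> A.M2.V" "k' \<noteq> q'" using A.M2.two_vertices[OF p'q'm(1)] by metis
  have kX: "{p, k} \<noteq> A.X1" "{p', k'} \<noteq> A.X2" using k k' pq X2 by (auto simp: doubleton_eq_iff)
  have km: "k < A.M1.m" "k \<noteq> p" "k' < A.M2.m"
    using A.M1.vertex_pair_less[OF k(1)] A.M2.vertex_pair_less[OF k'(1)] A.M1.vertex_pair_neq[OF k(1)] by simp_all
  have "a1 k \<noteq> a2 k'"
  proof
    assume "a1 k = a2 k'"
    then have "a1 k \<in> a2 ` {..<A.M2.m}" using km by simp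
    then have "a1 k \<in> a1 ` {..<A.M1.m} \<inter> a2 ` {..<A.M2.m}" using km by simp
    then have "a1 k \<in> a1 ` A.X1" by (simp only: A.range_a_Int)
    then have "a1 k = a1 p \<or> a1 k = a1 q" using pq by auto
    then show False using A.inj_a(1) km pqm k(2) by (auto dest: inj_onD)
  qed
  moreover have "{a1 p, a1 k} \<in> A.M.V" "{a1 p, a2 k'} \<in> A.M.V"
    using A.image_a1_V[OF k(1) kX(1)] B.image_a1_V[OF k'(1) kX(2)] p'q'(3) by simp_all
  ultimately have "A.M.ori (a1 p) (a2 k') = - A.M.ori (a1 p) (a1 k)" by (intro A.M.ori_adjacent)
  moreover have "A.M.ori (a1 p) (a1 k) = e1 * A.M1.ori p k" "A.M.ori (a1 p) (a2 k') = e2 * A.M2.ori p' k'"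
    using e1(2)[of p k] e2(2)[of p' k'] k k' kX p'q'(3) by simp_all
  moreover have "A.M1.ori p k = - A.M1.ori p q" "A.M2.ori p' k' = - A.M2.ori p' q'"
    using A.M1.ori_adjacent[OF pqV k(1)] A.M2.ori_adjacent[OF p'q'V k'(1)] k k' by simp_all
  ultimately have e12: "e2 * A.M2.ori p' q' = - (e1 * A.M1.ori p q)" by simp
  have det: "det g1 * det_int (charvec M1 p) (charvec M1 q) = det g2 * det_int (charvec M2 p') (charvec M2 q')"
    using g(3)[OF pqm(1)] g(3)[OF pqm(2)] g(4)[OF p'q'm(1)] g(4)[OF p'q'm(2)] p'q'(3,4)
    by (simp add: det_int_mult[symmetric])
  have sg': "orient M1 * (A.M1.ori p q * det_int (charvec M1 p) (charvec M1 q))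
      = - (orient M2 * (A.M2.ori p' q' * det_int (charvec M2 p') (charvec M2 q')))"
    using sg A.M1.vertex_sign_eq[OF pqV] A.M2.vertex_sign_eq[OF p'q'V] pq(1) X2 by (simp add: fp_sign_def)
  \<comment> \<open>The value forced by the first summand; \<open>s2\<close> shows that it fits the
    second as well, using \<open>e12\<close>, \<open>det\<close> and the opposite signs in
    \<open>sg'\<close>.\<close>
  define s where "s = orient M1 * (e1 * det g1)"
  have s1: "s * (e1 * det g1) = orient M1" using e1(1) dg by (auto simp: s_def)
  have units: "A.M1.ori p q = 1 \<or> A.M1.ori p q = -1" "A.M2.ori p' q' = 1 \<or> A.M2.ori p' q' = -1"
    "det_int (charvec M1 p) (charvec M1 q) = 1 \<or> det_int (charvec M1 p) (charvec M1 q) = -1"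
    "det_int (charvec M2 p') (charvec M2 q') = 1 \<or> det_int (charvec M2 p') (charvec M2 q') = -1"
    using A.M1.ori_vertex[OF pqV] A.M2.ori_vertex[OF p'q'V] A.M1.det_int_vertex[OF pqV] A.M2.det_int_vertex[OF p'q'V]
    by blast+
  have s2: "s * (e2 * det g2) = orient M2"
    using units dg e1(1) e2(1) o1 o2 e12 det sg' unfolding s_def
    by (elim disjE) simp_all
  interpret N: polygon_pair "M\<lparr>orient := s\<rparr>"
    using A.M.cp unfolding polygon_pair_def char_pair_def characteristic_pair_def by simp
  have V: "vertex_sets (M\<lparr>orient := s\<rparr>) = A.M.V" by (simp add: vertex_sets_def)
  have ori: "N.ori = A.M.ori"
    by (intro ext) (simp add: N.ori_def A.M.ori_def N.normal_def A.M.normal_def)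
  have vs: "vertex_sign (M\<lparr>orient := s\<rparr>) {i, j} = s * (A.M.ori i j * det_int (charvec M i) (charvec M j))"
    if "{i, j} \<in> A.M.V" for i j
    using N.vertex_sign_eq[of i j] that V ori by simp
  have "vertex_sign (M\<lparr>orient := s\<rparr>) (a1 ` J) = vertex_sign M1 J" if J: "J \<in> A.M1.V - {A.X1}" for J
  proof -
    obtain i j where ij: "J = {i, j}" using A.M1.vertex_set_card[of J] J by (auto simp: card_2_iff)
    have m: "i < A.M1.m" "j < A.M1.m" using A.M1.vertex_pair_less[of i j] J ij by simp_all
    have "{a1 i, a1 j} \<in> A.M.V" using A.image_a1_V[of J] J ij by simp
    then have "vertex_sign (M\<lparr>orient := s\<rparr>) (a1 ` J)
        = s * ((e1 * A.M1.ori i j) * (det g1 * det_int (charvec M1 i) (charvec M1 j)))"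
      using vs e1(2)[of i j] J ij g(3) m by (simp add: det_int_mult)
    also have "\<dots> = s * (e1 * det g1) * (A.M1.ori i j * det_int (charvec M1 i) (charvec M1 j))" by simp
    also have "\<dots> = vertex_sign M1 J" using A.M1.vertex_sign_eq[of i j] J ij s1 by simp
    finally show ?thesis .
  qed
  moreover have "vertex_sign (M\<lparr>orient := s\<rparr>) (a2 ` J) = vertex_sign M2 J" if J: "J \<in> A.M2.V - {A.X2}" for J
  proof -
    obtain i j where ij: "J = {i, j}" using A.M2.vertex_set_card[of J] J by (auto simp: card_2_iff)
    have m: "i < A.M2.m" "j < A.M2.m" using A.M2.vertex_pair_less[of i j] J ij by simp_all
    have "{a2 i, a2 j} \<in> A.M.V" using B.image_a1_V[of J] J ij by simp
    then have "vertex_sign (M\<lparr>orient := s\<rparr>) (a2 ` J)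
        = s * ((e2 * A.M2.ori i j) * (det g2 * det_int (charvec M2 i) (charvec M2 j)))"
      using vs e2(2)[of i j] J ij g(4) m by (simp add: det_int_mult)
    also have "\<dots> = s * (e2 * det g2) * (A.M2.ori i j * det_int (charvec M2 i) (charvec M2 j))" by simp
    also have "\<dots> = vertex_sign M2 J" using A.M2.vertex_sign_eq[of i j] J ij s2 by simp
    finally show ?thesis .
  qed
  moreover have "s \<in> {1, -1}" using o1 e1(1) dg by (auto simp: s_def)
  ultimately show ?thesis unfolding compatible_orientation_def by (intro bexI[of _ s]) auto
qed

section \<open>The combinatorics of the sum\<close>

text \<open>The polygon of \<open>B\<^sup>4\<close> is a quadrilateral \<open>p, c, q, c'\<close>.\<close>

definition B4_facets :: "2 quasitoric \<Rightarrow> nat \<Rightarrow> nat \<Rightarrow> nat \<Rightarrow> nat \<Rightarrow> bool" where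
  "B4_facets B p q c c' \<longleftrightarrow> distinct [p, q, c, c'] \<and> {..<nfacets B} = {p, q, c, c'} \<and>
     vertex_sets B = {{p, c}, {q, c}, {p, c'}, {q, c'}} \<and>
     charvec B p + charvec B q + charvec B c = 0 \<and> charvec B p + charvec B q + charvec B c' = 0"

text \<open>Each facet has two neighbours and there are only two other facets, so all pairs are
  adjacent.\<close>

lemma (in polygon_pair) triangle:
  assumes three: "m = 3" and X: "X \<in> V"
  obtains i j l where "X = {i, j}" "{..<m} = {i, j, l}" "distinct [i, j, l]" "V = {{i, j}, {i, l}, {j, l}}"
proof -
  obtain i j where ij: "X = {i, j}" "i \<noteq> j" using vertex_set_card[OF X] by (auto simp: card_2_iff)
  have m: "i < m" "j < m" using vertex_pair_less X ij by blast+
  have "card ({..<m} - {i, j}) = 1" using three m ij by simp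
  then obtain l where l: "{..<m} - {i, j} = {l}" by (metis card_1_singletonE)
  then have all: "{..<m} = {i, j, l}" "l \<noteq> i" "l \<noteq> j" using m by blast+
  have other: "{x, z} \<in> V" if "{x, y, z} = {i, j, l}" "x \<noteq> y" "y \<noteq> z" "x \<noteq> z" "{x, y} \<in> V" for x y z
  proof -
    have "x < m" using that(1) all(1) by blast
    then obtain u w where uw: "{x, u} \<in> V" "{x, w} \<in> V" "u \<noteq> w" using two_vertices by metis
    have xyz: "{..<m} = {x, y, z}" using all(1) that(1) by simp
    have "t = y \<or> t = z" if t: "{x, t} \<in> V" for t
    proof -
      have "t \<in> {..<m}" "t \<noteq> x" using vertex_pair_less[OF t] vertex_pair_neq[OF t] by simp_all
      then show ?thesis unfolding xyz by simp
    qed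
    from this[OF uw(1)] this[OF uw(2)] show ?thesis using uw by auto
  qed
  have "{i, l} \<in> V" by (rule other[of i j l]) (use X ij all in simp_all)
  moreover have "{j, l} \<in> V" by (rule other[of j i l]) (use X ij all in \<open>simp_all add: insert_commute\<close>)
  moreover have "J \<in> {{i, j}, {i, l}, {j, l}}" if JV: "J \<in> V" for J
  proof -
    obtain u w where "J = {u, w}" "u \<noteq> w" using vertex_set_card[OF JV] by (auto simp: card_2_iff)
    moreover have "u \<in> {i, j, l}" "w \<in> {i, j, l}" using vertex_set_subset[OF JV] calculation unfolding all(1) by simp_all
    ultimately show ?thesis by auto
  qed
  ultimately have "V = {{i, j}, {i, l}, {j, l}}" using X ij(1) by blast
  then show thesis using ij all by (intro that[of i j l]) simp_all
qed

lemma is_B4_facets: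
  assumes "is_B4 B" obtains p q c c' where "B4_facets B p q c c'"
proof -
  obtain x1 x2 a1 a2 where sum: "equivariant_connected_sum CP2 x1 CP2_bar x2 B a1 a2"
    using assms by (auto simp: is_B4_def)
  interpret A: polygon_sum CP2 CP2_bar B x1 x2 a1 a2 by (rule polygon_sum.intro[OF sum])
  have three: "nfacets CP2 = 3" "nfacets CP2_bar = 3" by (simp_all add: CP2_bar_def CP2_def Let_def)
  obtain i j l where 1: "A.X1 = {i, j}" "{..<nfacets CP2} = {i, j, l}" "distinct [i, j, l]"
      "vertex_sets CP2 = {{i, j}, {i, l}, {j, l}}"
    using A.M1.triangle[OF three(1) A.X_vertex(1)] by metis
  obtain i' j' l' where 2: "A.X2 = {i', j'}" "{..<nfacets CP2_bar} = {i', j', l'}" "distinct [i', j', l']"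
      "vertex_sets CP2_bar = {{i', j'}, {i', l'}, {j', l'}}"
    using A.M2.triangle[OF three(2) A.X_vertex(2)] by metis
  obtain g1 g2 where g:
     "\<And>i. i < nfacets CP2 \<Longrightarrow> charvec B (a1 i) = g1 *v charvec CP2 i"
     "\<And>i. i < nfacets CP2_bar \<Longrightarrow> charvec B (a2 i) = g2 *v charvec CP2_bar i"
    using A.sumD(12) by blast
  \<comment> \<open>The three vectors of either triangle add up to zero, a relation that survives
    the changes of basis. Hence both unmerged facets of the sum carry minus the sum of the two
    merged vectors.\<close>
  have z: "(\<Sum>k\<in>{..<3::nat}. charvec CP2 k) = 0" "(\<Sum>k\<in>{..<3::nat}. charvec CP2_bar k) = 0"
    by (simp_all add: eval_nat_numeral CP2_bar_def CP2_def Let_def vec_eq_iff forall_2 axis_def)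
  have "charvec CP2 i + charvec CP2 j + charvec CP2 l = (\<Sum>k\<in>{..<3::nat}. charvec CP2 k)"
    using 1(2,3) three by (simp add: add.assoc)
  then have s1: "charvec B (a1 i) + charvec B (a1 j) + charvec B (a1 l) = 0"
    using g(1) 1(2) z by (simp add: matrix_vector_right_distrib[symmetric] set_eq_iff)
  have "charvec CP2_bar i' + charvec CP2_bar j' + charvec CP2_bar l' = (\<Sum>k\<in>{..<3::nat}. charvec CP2_bar k)"
    using 2(2,3) three by (simp add: add.assoc)
  then have s2: "charvec B (a2 i') + charvec B (a2 j') + charvec B (a2 l') = 0"
    using g(2) 2(2) z by (simp add: matrix_vector_right_distrib[symmetric] set_eq_iff)
  have mg: "{a1 i, a1 j} = {a2 i', a2 j'}" using A.merged 1 2 by simp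
  have d1: "distinct [a1 i, a1 j, a1 l]" using A.inj_a(1) 1(2,3) by (auto simp: inj_on_def)
  have d2: "distinct [a2 i', a2 j', a2 l']" using A.inj_a(2) 2(2,3) by (auto simp: inj_on_def)
  have rI: "{a1 i, a1 j, a1 l} \<inter> {a2 i', a2 j', a2 l'} = {a1 i, a1 j}"
    and rU: "{a1 i, a1 j, a1 l} \<union> {a2 i', a2 j', a2 l'} = {..<nfacets B}"
    using A.range_a_Int A.range_a 1 2 by simp_all
  have V1: "(\<lambda>J. a1 ` J) ` (vertex_sets CP2 - {A.X1}) = {{a1 i, a1 l}, {a1 j, a1 l}}"
    using 1 by (auto simp: insert_Diff_if doubleton_eq_iff)
  have V2: "(\<lambda>J. a2 ` J) ` (vertex_sets CP2_bar - {A.X2}) = {{a2 i', a2 l'}, {a2 j', a2 l'}}"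
    using 2 by (auto simp: insert_Diff_if doubleton_eq_iff)
  have "a1 l \<notin> {a1 i, a1 j}" using d1 by auto
  then have "a1 l \<notin> {a1 i, a1 j, a1 l} \<inter> {a2 i', a2 j', a2 l'}" unfolding rI .
  then have ne: "a1 l \<noteq> a2 l'" by auto
  \<comment> \<open>The two facets may be merged in either order; what follows is symmetric in
    them.\<close>
  consider "a2 i' = a1 i" "a2 j' = a1 j" | "a2 i' = a1 j" "a2 j' = a1 i"
    using mg by (auto simp: doubleton_eq_iff)
  then have V2': "(\<lambda>J. a2 ` J) ` (vertex_sets CP2_bar - {A.X2}) = {{a1 i, a2 l'}, {a1 j, a2 l'}}"
    and s2': "charvec B (a1 i) + charvec B (a1 j) + charvec B (a2 l') = 0"
    and d2': "distinct [a1 i, a1 j, a2 l']"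
    and U2: "{a1 i, a1 j, a1 l} \<union> {a2 i', a2 j', a2 l'} = {a1 i, a1 j, a1 l, a2 l'}"
    using V2 s2 d2 by (cases; simp add: insert_commute add.commute)+
  have "vertex_sets B = {{a1 i, a1 l}, {a1 j, a1 l}, {a1 i, a2 l'}, {a1 j, a2 l'}}"
    unfolding A.V_sum V1 V2' by blast
  moreover have "{..<nfacets B} = {a1 i, a1 j, a1 l, a2 l'}" using rU U2 by simp
  ultimately have "B4_facets B (a1 i) (a1 j) (a1 l) (a2 l')"
    using d1 d2' ne s1 s2' unfolding B4_facets_def by simp
  then show thesis using that by blast
qed

text \<open>Exchanging \<open>p\<close>, \<open>q\<close> and exchanging \<open>c\<close>,
  \<open>c'\<close> are symmetries of the quadrilateral that act transitively on its vertices, so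
  any vertex can be named \<open>{p, c}\<close>.\<close>

lemma B4_facets_vertex:
  assumes "B4_facets B p q c c'" "X \<in> vertex_sets B"
  obtains p q c c' where "B4_facets B p q c c'" "X = {p, c}"
proof -
  have "B4_facets B q p c c'" "B4_facets B p q c' c" "B4_facets B q p c' c"
    using assms(1) unfolding B4_facets_def by (auto simp: insert_commute add.commute)
  moreover have "X = {p, c} \<or> X = {q, c} \<or> X = {p, c'} \<or> X = {q, c'}"
    using assms by (auto simp: B4_facets_def)
  ultimately show thesis using assms(1) that by blast
qed

text \<open>Two consecutive facets \<open>C\<close>, \<open>Q\<close> between \<open>F\<close> and \<open>D\<close> with the self-intersection numbers \<open>\<plusminus>1\<close> and \<open>0\<close>.\<close>

definition handle_facets :: "2 quasitoric \<Rightarrow> nat \<Rightarrow> nat \<Rightarrow> nat \<Rightarrow> nat \<Rightarrow> bool" where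
  "handle_facets M F C Q D \<longleftrightarrow> distinct [F, C, Q, D] \<and> {F, C, Q, D} \<subseteq> {..<nfacets M} \<and>
     {F, C} \<in> vertex_sets M \<and> {C, Q} \<in> vertex_sets M \<and> {Q, D} \<in> vertex_sets M \<and>
     charvec M F + charvec M Q + charvec M C = 0 \<and> charvec M F + charvec M Q + charvec M D = 0"

text \<open>Removing the vertex \<open>{p, c}\<close> opens the quadrilateral to the path
  \<open>p, c', q, c\<close>, whose three vertices survive in the sum; \<open>F\<close> and
  \<open>D\<close> are the merged facets.\<close>

lemma sum_handle_facets:
  assumes B: "is_B4 B" and sum: "equivariant_connected_sum M x B y N a1 a2"
  obtains F C Q D where "handle_facets N F C Q D"
proof -
  interpret A: polygon_sum M B N x y a1 a2 by (rule polygon_sum.intro[OF sum])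
  obtain p q c c' where b: "B4_facets B p q c c'" "A.X2 = {p, c}"
    using is_B4_facets[OF B] B4_facets_vertex[OF _ A.X_vertex(2)] by metis
  note b' = b(1)[unfolded B4_facets_def]
  obtain g2 where g: "\<And>i. i < nfacets B \<Longrightarrow> charvec N (a2 i) = g2 *v charvec B i"
    using A.sumD(12) by blast
  have eq: "{..<nfacets B} = {p, q, c, c'}" using b' by (elim conjE)
  have "{p, q, c, c'} \<subseteq> {..<nfacets B}" by (simp only: eq)
  then have m: "p < nfacets B" "q < nfacets B" "c < nfacets B" "c' < nfacets B" by simp_all
  have dist: "p \<noteq> q" "p \<noteq> c" "p \<noteq> c'" "q \<noteq> c" "q \<noteq> c'" "c \<noteq> c'" using b' by simp_all
  have V: "A.M2.V = {{p, c}, {q, c}, {p, c'}, {q, c'}}" using b' by (elim conjE)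
  have "a2 ` J \<in> A.M.V" if "J \<in> {{q, c}, {p, c'}, {q, c'}}" for J
  proof -
    have "J \<in> A.M2.V - {A.X2}" using that dist unfolding V b(2) by (auto simp: doubleton_eq_iff)
    then show ?thesis using A.V_sum by blast
  qed
  from this[of "{q, c}"] this[of "{p, c'}"] this[of "{q, c'}"]
  have "{a2 p, a2 c'} \<in> A.M.V" "{a2 c', a2 q} \<in> A.M.V" "{a2 q, a2 c} \<in> A.M.V"
    by (simp_all add: insert_commute)
  moreover have "distinct [a2 p, a2 c', a2 q, a2 c]" using A.inj_a(2) dist m by (simp add: inj_on_eq_iff)
  moreover have "{a2 p, a2 c', a2 q, a2 c} \<subseteq> {..<nfacets N}" using m unfolding A.range_a[symmetric] by simp
  moreover have "charvec N (a2 p) + charvec N (a2 q) + charvec N (a2 c') = 0"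
     "charvec N (a2 p) + charvec N (a2 q) + charvec N (a2 c) = 0"
    using b' m by (simp_all add: g matrix_vector_right_distrib[symmetric])
  ultimately have "handle_facets N (a2 p) (a2 c') (a2 q) (a2 c)"
    unfolding handle_facets_def by (simp add: insert_commute)
  then show thesis using that by blast
qed

section \<open>Equivariant functions and isomorphisms of sums of line bundles\<close>

text \<open>A weight \<open>w\<close> is a character of \<open>T\<^sup>m\<close> and hence of \<open>K = ker \<Lambda>\<close>; it determines the line bundle
  \<open>Z \<times>\<^sub>K \<complex>\<^sub>w\<close>. Functions on \<open>Z\<close> that are equivariant of weight \<open>b - a\<close> are the homomorphisms
  from the line bundle of \<open>a\<close> to that of \<open>b\<close>.\<close>

type_synonym weight = "nat \<Rightarrow>\<^sub>0 int"

context char_pair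
begin

text \<open>Indices from \<open>m\<close> on are ignored, so that \<open>weight\<close> can be one
  type for all \<open>M\<close>; the generators beyond \<open>m\<close> give trivial bundles
  (\<open>null_outside\<close>).\<close>

definition pairing :: "weight \<Rightarrow> (nat \<Rightarrow> real) \<Rightarrow> real" where
  "pairing w s = (\<Sum>i<m. of_int (Poly_Mapping.lookup w i) * s i)"

lemma pairing_0 [simp]: "pairing 0 s = 0"
  by (simp add: pairing_def)

lemma pairing_add: "pairing (v + w) s = pairing v s + pairing w s"
  by (simp add: pairing_def lookup_add algebra_simps sum.distrib)

lemma pairing_uminus: "pairing (- w) s = - pairing w s"
  by (simp add: pairing_def sum_negf)

lemma pairing_diff: "pairing (v - w) s = pairing v s - pairing w s"
  by (simp add: pairing_def lookup_minus algebra_simps sum_subtractf)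

lemma pairing_add_right: "pairing w (\<lambda>i. s i + s' i) = pairing w s + pairing w s'"
  by (simp add: pairing_def algebra_simps sum.distrib)

lemma pairing_diff_right: "pairing w (\<lambda>i. s i - s' i) = pairing w s - pairing w s'"
  by (simp add: pairing_def algebra_simps sum_subtractf)

lemma pairing_cong: "(\<And>i. i < m \<Longrightarrow> s i = s' i) \<Longrightarrow> pairing w s = pairing w s'"
  by (simp add: pairing_def)

lemma pairing_int: "(\<And>i. i < m \<Longrightarrow> s i \<in> \<int>) \<Longrightarrow> pairing w s \<in> \<int>"
  by (auto simp: pairing_def intro!: Ints_sum)

lemma pairing_single: "k < m \<Longrightarrow> pairing (Poly_Mapping.single k n) s = of_int n * s k"
proof -
  assume "k < m"
  have "pairing (Poly_Mapping.single k n) s = (\<Sum>i<m. if i = k then of_int n * s k else 0)"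
    unfolding pairing_def by (rule sum.cong) (auto simp: lookup_single when_def)
  then show ?thesis using \<open>k < m\<close> by simp
qed

lemma pairing_single_outside: "\<not> k < m \<Longrightarrow> pairing (Poly_Mapping.single k n) s = 0"
  unfolding pairing_def by (intro sum.neutral ballI) (auto simp: lookup_single when_def)

lemma cis_pairing_int: "pairing w s \<in> \<int> \<Longrightarrow> cis (2 * pi * pairing w s) = 1"
  by (auto simp: cis_multiple_2pi elim: Ints_cases)

text \<open>A character of \<open>T^n\<close> pulled back along \<open>torus_map M\<close>, i.e. an
  integer combination of the rows of \<open>\<Lambda>\<close>. It is trivial on the kernel, so its
  line bundle is trivial.\<close>

definition relation :: "int^'n \<Rightarrow> weight" where
  "relation z = (\<Sum>i<m. Poly_Mapping.single i (int_dot z (lam i)))"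

lemma lookup_relation: "Poly_Mapping.lookup (relation z) i = (if i < m then int_dot z (lam i) else 0)"
  by (simp add: relation_def lookup_sum lookup_single when_def)

lemma pairing_relation:
  assumes "torus_map M \<kappa> \<in> range real_vec" shows "pairing (relation z) \<kappa> \<in> \<int>"
proof -
  have "pairing (relation z) \<kappa> = real_vec z \<bullet> torus_map M \<kappa>"
    by (simp add: pairing_def lookup_relation torus_map_def inner_sum_right real_vec_inner mult.commute)
  then show ?thesis using assms by (auto simp: real_vec_inner)
qed

text \<open>Continuity is imposed only along the lifts \<open>lift J\<close>, the form in which it
  is later used over the charts. The second clause joins invariance in the collapsed coordinates
  \<open>c\<close> with the character of the kernel element \<open>\<kappa>\<close>.\<close>

definition equi :: "weight \<Rightarrow> ((real^'n) \<times> (nat \<Rightarrow> real) \<Rightarrow> complex) \<Rightarrow> bool" where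
  "equi w f \<longleftrightarrow>
     (\<forall>J\<in>V. continuous_on (P \<times> UNIV) (\<lambda>x. f (fst x, lift J (snd x)))) \<and>
     (\<forall>p\<in>P. \<forall>s \<kappa> c. torus_map M \<kappa> \<in> range real_vec \<longrightarrow> (\<forall>i<m. p \<notin> facet M i \<longrightarrow> c i = 0) \<longrightarrow>
        f (p, \<lambda>i. s i + \<kappa> i + c i) = cis (2 * pi * pairing w \<kappa>) * f (p, s))"

lemma equi_continuous: "equi w f \<Longrightarrow> J \<in> V \<Longrightarrow> continuous_on (P \<times> UNIV) (\<lambda>x. f (fst x, lift J (snd x)))"
  by (simp add: equi_def)

text \<open>\<open>c'\<close> is taken as the full difference because the assumptions say nothing
  about indices from \<open>m\<close> on, where \<open>equi\<close> lets \<open>c\<close> be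
  arbitrary.\<close>

lemma equi_shift:
  assumes "equi w f" "p \<in> P" "torus_map M \<kappa> \<in> range real_vec" "\<And>i. i < m \<Longrightarrow> p \<notin> facet M i \<Longrightarrow> c i = 0"
    and "\<And>i. i < m \<Longrightarrow> s' i = s i + \<kappa> i + c i"
  shows "f (p, s') = cis (2 * pi * pairing w \<kappa>) * f (p, s)"
proof -
  define c' where "c' i = s' i - s i - \<kappa> i" for i
  have "\<forall>i<m. p \<notin> facet M i \<longrightarrow> c' i = 0" using assms by (simp add: c'_def)
  then have "f (p, \<lambda>i. s i + \<kappa> i + c' i) = cis (2 * pi * pairing w \<kappa>) * f (p, s)"
    using assms unfolding equi_def by blast
  then show ?thesis by (simp add: c'_def)
qed

lemma equi_trivial_weight:
  assumes "\<And>\<kappa>. torus_map M \<kappa> \<in> range real_vec \<Longrightarrow> pairing w \<kappa> \<in> \<int>" shows "equi w (\<lambda>_. z)"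
  using assms by (simp add: equi_def cis_pairing_int)

lemma equi_const: "equi 0 (\<lambda>_. z)"
  by (rule equi_trivial_weight) simp

lemma equi_zero: "equi w (\<lambda>_. 0)"
  by (simp add: equi_def)

lemma equi_add: "equi w f \<Longrightarrow> equi w g \<Longrightarrow> equi w (\<lambda>x. f x + g x)"
  by (auto simp: equi_def distrib_left intro!: continuous_intros)

lemma equi_minus: "equi w f \<Longrightarrow> equi w (\<lambda>x. - f x)"
  by (auto simp: equi_def intro!: continuous_intros)

lemma equi_diff: "equi w f \<Longrightarrow> equi w g \<Longrightarrow> equi w (\<lambda>x. f x - g x)"
  by (auto simp: equi_def right_diff_distrib intro!: continuous_intros)

lemma equi_mult: "equi v f \<Longrightarrow> equi w g \<Longrightarrow> equi (v + w) (\<lambda>x. f x * g x)"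
  by (auto simp: equi_def pairing_add distrib_left cis_mult[symmetric] intro!: continuous_intros)

lemma equi_cnj: "equi w f \<Longrightarrow> equi (- w) (\<lambda>x. cnj (f x))"
  by (auto simp: equi_def pairing_uminus cis_cnj intro!: continuous_intros)

lemma equi_sum: "(\<And>k. k \<in> A \<Longrightarrow> equi w (f k)) \<Longrightarrow> equi w (\<lambda>x. \<Sum>k\<in>A. f k x)"
  by (induction A rule: infinite_finite_induct) (auto intro: equi_zero equi_add)


lemma equi_inverse:
  assumes "equi 0 f" "\<And>p s. p \<in> P \<Longrightarrow> f (p, s) \<noteq> 0" shows "equi 0 (\<lambda>x. inverse (f x))"
  using assms by (auto simp: equi_def intro!: continuous_intros)

lemma continuous_on_lift: "k < m \<Longrightarrow> continuous_on A (\<lambda>x. lift J (g x) k)" if "continuous_on A g"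
  using that by (cases "k \<in> J") (auto simp: lift_def intro!: continuous_intros)

text \<open>The tautological section of \<open>theta M k\<close>: the distance to the facet stands
  in for the modulus of the \<open>k\<close>-th coordinate of \<open>Z\<close>, which gives
  continuity and the right zero set.\<close>

definition coord_section :: "nat \<Rightarrow> (real^'n) \<times> (nat \<Rightarrow> real) \<Rightarrow> complex" where
  "coord_section k x = of_real (infdist (fst x) (facet M k)) * cis (2 * pi * snd x k)"

lemma infdist_facet:
  assumes "k < m" shows "infdist p (facet M k) = 0 \<longleftrightarrow> p \<in> facet M k"
proof -
  have "facet M k \<noteq> {}" using facet_facet_of[OF assms] by (simp add: facet_of_def)
  then show ?thesis using in_closed_iff_infdist_zero closed_facet assms by blast
qed

lemma equi_coord_section:
  assumes k: "k < m" shows "equi (frag_of k) (coord_section k)"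
  unfolding equi_def
proof (intro conjI ballI allI impI)
  fix J assume "J \<in> V"
  show "continuous_on (P \<times> UNIV) (\<lambda>x. coord_section k (fst x, lift J (snd x)))"
    using k by (auto simp: coord_section_def intro!: continuous_intros continuous_on_lift)
next
  fix p s and \<kappa> c :: "nat \<Rightarrow> real" assume c: "\<forall>i<m. p \<notin> facet M i \<longrightarrow> c i = 0"
  have "pairing (frag_of k) \<kappa> = \<kappa> k" using k by (simp add: pairing_single)
  \<comment> \<open>On the facet both sides vanish; off it \<open>c k = 0\<close>.\<close>
  then show "coord_section k (p, \<lambda>i. s i + \<kappa> i + c i)
      = cis (2 * pi * pairing (frag_of k) \<kappa>) * coord_section k (p, s)"
    using c k infdist_facet[OF k, of p]
    by (cases "p \<in> facet M k") (auto simp: coord_section_def distrib_left cis_mult[symmetric])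
qed

lemma coord_section_eq_0: "k < m \<Longrightarrow> coord_section k (p, s) = 0 \<longleftrightarrow> p \<in> facet M k"
  by (simp add: coord_section_def infdist_facet)

lemma section_single:
  assumes k: "k < m"
  shows "\<exists>f. equi (Poly_Mapping.single k n) f \<and> (\<forall>p s. p \<notin> facet M k \<longrightarrow> f (p, s) \<noteq> 0)"
proof (induction n rule: int_induct[where k = 0])
  case base
  show ?case by (rule exI[of _ "\<lambda>_. 1"]) (simp add: equi_const)
next
  case (step1 n)
  then obtain f where "equi (Poly_Mapping.single k n) f" "\<forall>p s. p \<notin> facet M k \<longrightarrow> f (p, s) \<noteq> 0" by blast
  then show ?case
    using equi_mult[OF _ equi_coord_section[OF k], of "Poly_Mapping.single k n" f] coord_section_eq_0[OF k]
    by (intro exI[of _ "\<lambda>x. f x * coord_section k x"]) (simp add: single_add)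
next
  case (step2 n)
  then obtain f where "equi (Poly_Mapping.single k n) f" "\<forall>p s. p \<notin> facet M k \<longrightarrow> f (p, s) \<noteq> 0" by blast
  then show ?case
    using equi_mult[OF _ equi_cnj[OF equi_coord_section[OF k]], of "Poly_Mapping.single k n" f] coord_section_eq_0[OF k]
    by (intro exI[of _ "\<lambda>x. f x * cnj (coord_section k x)"]) (simp add: single_diff)
qed

text \<open>Over the chart at \<open>J\<close> every weight bundle is trivial: since
  \<open>J\<close> carries a basis, some relation agrees with \<open>w\<close> on \<open>J\<close>.
  Subtracting it leaves a weight on facets off \<open>J\<close>, whose coordinate sections have no
  zeros over the chart.\<close>

lemma section_chart:
  assumes J: "J \<in> V"
  shows "\<exists>f. equi w f \<and> (\<forall>p s. facets_through M p \<subseteq> J \<longrightarrow> f (p, s) \<noteq> 0)"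
proof -
  define z where "z = (\<Sum>j\<in>J. Poly_Mapping.lookup w j *s dualvec J j)"
  have dz: "int_dot z (lam i) = Poly_Mapping.lookup w i" if "i \<in> J" for i
  proof -
    have "int_dot z (lam i) = (\<Sum>j\<in>J. Poly_Mapping.lookup w j * int_dot (dualvec J j) (lam i))"
      unfolding z_def int_dot_def by (simp add: sum_distrib_left sum_distrib_right mult.assoc) (rule sum.swap)
    also have "\<dots> = (\<Sum>j\<in>J. if j = i then Poly_Mapping.lookup w j else 0)"
      by (rule sum.cong) (use dualvec(1)[OF J] that in auto)
    finally show ?thesis using that vertex_set_finite[OF J] by simp
  qed
  define v where "v = w - relation z"
  have v0: "Poly_Mapping.lookup v i = 0" if "i \<in> J" for i
    using that dz vertex_set_subset[OF J] by (auto simp: v_def lookup_minus lookup_relation)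
  have "\<forall>k. \<exists>f. k < m \<longrightarrow> equi (Poly_Mapping.single k (Poly_Mapping.lookup v k)) f \<and> (\<forall>p s. p \<notin> facet M k \<longrightarrow> f (p, s) \<noteq> 0)"
    using section_single by blast
  from choice[OF this] obtain f where f: "\<And>k. k < m \<Longrightarrow> equi (Poly_Mapping.single k (Poly_Mapping.lookup v k)) (f k)"
    "\<And>k p s. k < m \<Longrightarrow> p \<notin> facet M k \<Longrightarrow> f k (p, s) \<noteq> 0" by blast
  \<comment> \<open>On \<open>J\<close> the remaining weight is 0 and the constant section is taken,
    so that no factor vanishes on the chart.\<close>
  define g where "g k = (if k \<in> J then \<lambda>_. 1 else f k)" for k
  have "equi (\<Sum>k\<in>A. Poly_Mapping.single k (Poly_Mapping.lookup v k)) (\<lambda>x. \<Prod>k\<in>A. g k x)" if "A \<subseteq> {..<m}" "finite A" for A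
    using that(2,1)
  proof (induction A rule: finite_induct)
    case empty then show ?case by (simp add: equi_const)
  next
    case (insert k A)
    then have "equi (Poly_Mapping.single k (Poly_Mapping.lookup v k)) (g k)"
      using f(1)[of k] v0[of k] by (auto simp: g_def equi_const)
    then show ?case using insert by (simp add: equi_mult)
  qed
  from this[of "{..<m}"] have e: "equi (\<Sum>k<m. Poly_Mapping.single k (Poly_Mapping.lookup v k)) (\<lambda>x. \<Prod>k<m. g k x)"
    by simp
  \<comment> \<open>The sum drops the part of \<open>v\<close> beyond \<open>m\<close>, to which the
    pairing is blind.\<close>
  have pw: "pairing (\<Sum>k<m. Poly_Mapping.single k (Poly_Mapping.lookup v k)) \<kappa> = pairing v \<kappa>" for \<kappa>
    by (simp add: pairing_def lookup_sum lookup_single when_def)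
  have "equi w (\<lambda>x. \<Prod>k<m. g k x)"
  proof -
    have "cis (2 * pi * pairing v \<kappa>) = cis (2 * pi * pairing w \<kappa>)" if "torus_map M \<kappa> \<in> range real_vec" for \<kappa>
    proof -
      have "cis (2 * pi * pairing w \<kappa>) = cis (2 * pi * pairing v \<kappa>) * cis (2 * pi * pairing (relation z) \<kappa>)"
        by (simp add: v_def pairing_diff right_diff_distrib cis_mult)
      then show ?thesis using cis_pairing_int[OF pairing_relation[OF that]] by simp
    qed
    then show ?thesis using e unfolding equi_def pw by auto
  qed
  moreover have "(\<Prod>k<m. g k (p, s)) \<noteq> 0" if "facets_through M p \<subseteq> J" for p s
    using f(2) that by (auto simp: g_def facets_through_def)
  ultimately show ?thesis by blast
qed

section \<open>Invertible matrices of equivariant functions\<close>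

definition app :: "(nat \<Rightarrow> nat \<Rightarrow> 'x \<Rightarrow> complex) \<Rightarrow> 'x \<Rightarrow> nat \<Rightarrow> (nat \<Rightarrow> complex) \<Rightarrow> nat \<Rightarrow> complex" where
  "app F x n u i = (\<Sum>j<n. F i j x * u j)"

definition equi_mat :: "weight list \<Rightarrow> weight list \<Rightarrow> (nat \<Rightarrow> nat \<Rightarrow> (real^'n) \<times> (nat \<Rightarrow> real) \<Rightarrow> complex) \<Rightarrow> bool" where
  "equi_mat as bs F \<longleftrightarrow> (\<forall>i<length bs. \<forall>j<length as. equi (bs ! i - as ! j) (F i j))"

definition inverse_on :: "nat \<Rightarrow> nat \<Rightarrow> (nat \<Rightarrow> nat \<Rightarrow> (real^'n) \<times> (nat \<Rightarrow> real) \<Rightarrow> complex)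
    \<Rightarrow> (nat \<Rightarrow> nat \<Rightarrow> (real^'n) \<times> (nat \<Rightarrow> real) \<Rightarrow> complex) \<Rightarrow> bool" where
  "inverse_on k n F G \<longleftrightarrow> (\<forall>p\<in>P. \<forall>s u. \<forall>i<n. app F (p, s) k (app G (p, s) n u) i = u i)"

definition line_iso :: "weight list \<Rightarrow> weight list \<Rightarrow> bool" where
  "line_iso as bs \<longleftrightarrow> (\<exists>F G. equi_mat as bs F \<and> equi_mat bs as G \<and>
     inverse_on (length as) (length bs) F G \<and> inverse_on (length bs) (length as) G F)"

lemma app_cong: "(\<And>j. j < n \<Longrightarrow> u j = v j) \<Longrightarrow> app F x n u i = app F x n v i"
  by (simp add: app_def)

lemma line_iso_sym: "line_iso as bs \<Longrightarrow> line_iso bs as"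
  unfolding line_iso_def by blast

lemma app_comp:
  "app (\<lambda>i j x. \<Sum>k<l. H i k x * F k j x) x n u i = app H x l (app F x n u) i"
proof -
  have "app (\<lambda>i j x. \<Sum>k<l. H i k x * F k j x) x n u i = (\<Sum>j<n. \<Sum>k<l. H i k x * (F k j x * u j))"
    by (simp add: app_def sum_distrib_right mult.assoc)
  also have "\<dots> = (\<Sum>k<l. \<Sum>j<n. H i k x * (F k j x * u j))" by (rule sum.swap)
  finally show ?thesis by (simp add: app_def sum_distrib_left)
qed

lemma equi_mat_comp:
  assumes F: "equi_mat as bs F" and H: "equi_mat bs cs H"
  shows "equi_mat as cs (\<lambda>i j x. \<Sum>k<length bs. H i k x * F k j x)"
  unfolding equi_mat_def
proof (intro allI impI equi_sum)
  fix i j k assume "i < length cs" "j < length as" "k \<in> {..<length bs}"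
  then have "equi (cs ! i - bs ! k) (H i k)" "equi (bs ! k - as ! j) (F k j)"
    using F H by (auto simp: equi_mat_def)
  from equi_mult[OF this] show "equi (cs ! i - as ! j) (\<lambda>x. H i k x * F k j x)" by simp
qed

lemma inverse_on_comp:
  assumes "inverse_on l n H K" "inverse_on k l F G"
  shows "inverse_on k n (\<lambda>i j x. \<Sum>q<l. H i q x * F q j x) (\<lambda>i j x. \<Sum>q<l. G i q x * K q j x)"
  unfolding inverse_on_def
proof (intro ballI allI impI)
  fix p s u i assume p: "p \<in> P" and i: "i < n"
  have "app F (p, s) k (app G (p, s) l (app K (p, s) n u)) j = app K (p, s) n u j" if "j < l" for j
    using assms(2) p that by (simp add: inverse_on_def)
  moreover have "app (\<lambda>i j x. \<Sum>q<l. G i q x * K q j x) (p, s) n u = app G (p, s) l (app K (p, s) n u)"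
    by (rule ext) (rule app_comp)
  ultimately have "app H (p, s) l (app F (p, s) k (app (\<lambda>i j x. \<Sum>q<l. G i q x * K q j x) (p, s) n u)) i
     = app H (p, s) l (app K (p, s) n u) i" by (intro app_cong) simp
  then show "app (\<lambda>i j x. \<Sum>q<l. H i q x * F q j x) (p, s) k
      (app (\<lambda>i j x. \<Sum>q<l. G i q x * K q j x) (p, s) n u) i = u i"
    using assms(1) p i by (simp add: inverse_on_def app_comp[where H = H])
qed

lemma line_iso_trans:
  assumes "line_iso as bs" "line_iso bs cs" shows "line_iso as cs"
proof -
  obtain F G where F: "equi_mat as bs F" "equi_mat bs as G"
    "inverse_on (length as) (length bs) F G" "inverse_on (length bs) (length as) G F"
    using assms(1) unfolding line_iso_def by blast
  obtain H K where H: "equi_mat bs cs H" "equi_mat cs bs K"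
    "inverse_on (length bs) (length cs) H K" "inverse_on (length cs) (length bs) K H"
    using assms(2) unfolding line_iso_def by blast
  show ?thesis unfolding line_iso_def
    by (intro exI conjI, rule equi_mat_comp[OF F(1) H(1)], rule equi_mat_comp[OF H(2) F(2)],
        rule inverse_on_comp[OF H(3) F(3)], rule inverse_on_comp[OF F(4) H(4)])
qed

lemma line_iso_mset:
  assumes "mset as = mset bs" shows "line_iso as bs"
proof -
  obtain f where f: "bij_betw f {..<length as} {..<length bs}" "\<And>i. i < length as \<Longrightarrow> as ! i = bs ! f i"
    using permutation_Ex_bij[OF assms] by blast
  let ?F = "\<lambda>i j x. if i = f j then 1 else 0 :: complex" and ?G = "\<lambda>j i x. if i = f j then 1 else 0 :: complex"
  have fm: "f j < length bs" if "j < length as" for j using f(1) that by (auto simp: bij_betw_def)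
  have inj: "f j = f k \<longleftrightarrow> j = k" if "j < length as" "k < length as" for j k
    using f(1) that by (auto simp: bij_betw_def inj_on_eq_iff)
  have aG: "app ?G x (length bs) u j = u (f j)" if "j < length as" for x u j
    using fm[OF that] by (simp add: app_def if_distrib[of "\<lambda>z. z * _"] cong: if_cong)
  have aF: "app ?F x (length as) u (f j) = u j" if "j < length as" for x u j
  proof -
    have "app ?F x (length as) u (f j) = (\<Sum>k<length as. if k = j then u k else 0)"
      unfolding app_def by (rule sum.cong) (use inj that in auto)
    then show ?thesis using that by simp
  qed
  have "equi_mat as bs ?F" "equi_mat bs as ?G"
    unfolding equi_mat_def using f(2) by (auto simp: equi_const equi_zero)
  moreover have "inverse_on (length bs) (length as) ?G ?F"
    unfolding inverse_on_def by (simp add: aG aF)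
  moreover have "inverse_on (length as) (length bs) ?F ?G"
    unfolding inverse_on_def
  proof (intro ballI allI impI)
    fix p s u i assume "i < length bs"
    then have "i \<in> f ` {..<length as}" using f(1) by (simp add: bij_betw_def)
    then obtain j where "j < length as" "i = f j" by auto
    then show "app ?F (p, s) (length as) (app ?G (p, s) (length bs) u) i = u i" by (simp add: aF aG)
  qed
  ultimately show ?thesis unfolding line_iso_def by blast
qed

lemma line_iso_refl: "line_iso as as"
  by (rule line_iso_mset) simp

lemma sum_lessThan_add: "(\<Sum>j<k+n. g j) = (\<Sum>j<k. g j) + (\<Sum>j<n. g (k + j))" for g :: "nat \<Rightarrow> complex"
  by (induction n) (simp_all add: add.assoc)

lemma line_iso_append:
  assumes "line_iso as bs" "line_iso cs ds" shows "line_iso (as @ cs) (bs @ ds)"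
proof -
  \<comment> \<open>Block diagonal matrix whose first block has \<open>k\<close> rows and
    \<open>n\<close> columns.\<close>
  define bl where "bl F H k n = (\<lambda>i j x. if i < k \<and> j < n then F i j x
     else if k \<le> i \<and> n \<le> j then H (i - k) (j - n) x else 0)"
    for F H :: "nat \<Rightarrow> nat \<Rightarrow> (real^'n) \<times> (nat \<Rightarrow> real) \<Rightarrow> complex" and k n :: nat
  have em: "equi_mat (as @ cs) (bs @ ds) (bl F H (length bs) (length as))"
    if "equi_mat as bs F" "equi_mat cs ds H" for as bs cs ds F H
    unfolding equi_mat_def
  proof (intro allI impI)
    fix i j assume ij: "i < length (bs @ ds)" "j < length (as @ cs)"
    consider "i < length bs" "j < length as" | "length bs \<le> i" "length as \<le> j" | "\<not> (i < length bs \<longleftrightarrow> j < length as)"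
      by linarith
    then show "equi ((bs @ ds) ! i - (as @ cs) ! j) (bl F H (length bs) (length as) i j)"
    proof cases
      case 1 then show ?thesis using that(1) by (simp add: equi_mat_def bl_def nth_append)
    next
      case 2 then show ?thesis using that(2) ij by (simp add: equi_mat_def bl_def nth_append)
    next
      case 3
      then have "bl F H (length bs) (length as) i j = (\<lambda>_. 0)" by (auto simp: bl_def)
      then show ?thesis by (simp add: equi_zero)
    qed
  qed
  have ap: "app (bl F H k n) x (n + n') u i = (if i < k then app F x n u i else app H x n' (\<lambda>j. u (n + j)) (i - k))"
    for F H k n n' x u i
    unfolding app_def sum_lessThan_add by (auto simp: bl_def)
  have inv: "inverse_on (k + k') (n + n') (bl F H n k) (bl G K k n)"
    if "inverse_on k n F G" "inverse_on k' n' H K" for k k' n n' F G H K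
    unfolding inverse_on_def
  proof (intro ballI allI impI)
    fix p s u i assume p: "p \<in> P" and i: "i < n + n'"
    show "app (bl F H n k) (p, s) (k + k') (app (bl G K k n) (p, s) (n + n') u) i = u i"
    proof (cases "i < n")
      case True
      then have "app (bl F H n k) (p, s) (k + k') (app (bl G K k n) (p, s) (n + n') u) i
        = app F (p, s) k (app G (p, s) n u) i"
        unfolding ap[where n = k] by (simp add: ap cong: app_cong)
      then show ?thesis using that(1) p True by (simp add: inverse_on_def)
    next
      case False
      then have "app (bl F H n k) (p, s) (k + k') (app (bl G K k n) (p, s) (n + n') u) i
        = app H (p, s) k' (app K (p, s) n' (\<lambda>j. u (n + j))) (i - n)"
        unfolding ap[where n = k] by (simp add: ap)
      then show ?thesis using that(2) p False i by (simp add: inverse_on_def)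
    qed
  qed
  obtain F G where F: "equi_mat as bs F" "equi_mat bs as G"
    "inverse_on (length as) (length bs) F G" "inverse_on (length bs) (length as) G F"
    using assms(1) unfolding line_iso_def by blast
  obtain H K where H: "equi_mat cs ds H" "equi_mat ds cs K"
    "inverse_on (length cs) (length ds) H K" "inverse_on (length ds) (length cs) K H"
    using assms(2) unfolding line_iso_def by blast
  show ?thesis unfolding line_iso_def length_append
    by (intro exI conjI, rule em[OF F(1) H(1)], rule em[OF F(2) H(2)],
        rule inv[OF F(3) H(3)], rule inv[OF F(4) H(4)])
qed

lemma line_iso_shift:
  assumes "line_iso as bs" shows "line_iso (map ((+) a) as) (map ((+) a) bs)"
proof -
  have "equi_mat (map ((+) a) as) (map ((+) a) bs) F \<longleftrightarrow> equi_mat as bs F" for as bs F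
    by (simp add: equi_mat_def)
  then show ?thesis using assms by (simp add: line_iso_def)
qed

lemma line_iso_trivial:
  assumes "\<And>\<kappa>. torus_map M \<kappa> \<in> range real_vec \<Longrightarrow> pairing w \<kappa> \<in> \<int>" shows "line_iso [a + w] [a]"
proof -
  have "equi w (\<lambda>_. 1)" "equi (- w) (\<lambda>_. 1)"
    using assms by (auto intro!: equi_trivial_weight simp: pairing_uminus)
  then show ?thesis unfolding line_iso_def
    by (intro exI[of _ "\<lambda>_ _ _. 1"]) (simp add: equi_mat_def inverse_on_def app_def)
qed

text \<open>The Koszul complex of two sections without common zeros.\<close>

lemma line_iso_koszul:
  assumes f: "equi b f" and g: "equi c g" and nz: "\<And>p s. p \<in> P \<Longrightarrow> f (p, s) \<noteq> 0 \<or> g (p, s) \<noteq> 0"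
  shows "line_iso [a, a + b + c] [a + b, a + c]"
proof -
  define d where "d x = inverse (f x * cnj (f x) + g x * cnj (g x))" for x
  have "equi 0 (\<lambda>x. f x * cnj (f x) + g x * cnj (g x))"
    using equi_add[OF equi_mult[OF f equi_cnj[OF f], simplified] equi_mult[OF g equi_cnj[OF g], simplified]] by simp
  moreover have nz': "f (p, s) * cnj (f (p, s)) + g (p, s) * cnj (g (p, s)) \<noteq> 0" if "p \<in> P" for p s
  proof -
    have "f (p, s) * cnj (f (p, s)) + g (p, s) * cnj (g (p, s))
        = of_real ((cmod (f (p, s)))\<^sup>2 + (cmod (g (p, s)))\<^sup>2)"
      by (simp add: complex_norm_square del: of_real_power)
    moreover have "(cmod (f (p, s)))\<^sup>2 + (cmod (g (p, s)))\<^sup>2 \<noteq> 0"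
      using nz[OF that, of s] by (simp add: sum_power2_eq_zero_iff)
    ultimately show ?thesis by (metis of_real_eq_0_iff)
  qed
  ultimately have d: "equi 0 d" unfolding d_def by (rule equi_inverse)
  have d1: "f (p, s) * cnj (f (p, s)) * d (p, s) + g (p, s) * cnj (g (p, s)) * d (p, s) = 1" if "p \<in> P" for p s
    using nz'[OF that, of s] by (simp add: d_def distrib_right[symmetric])
  have sum2: "(\<Sum>j<2. h j) = h 0 + h 1" for h :: "nat \<Rightarrow> complex"
    by (simp add: eval_nat_numeral)
  have alg: "A * (A' * D * U + B' * D * W) + - B' * (- B * D * U + A * D * W) = U"
    "B * (A' * D * U + B' * D * W) + A' * (- B * D * U + A * D * W) = W"
    "A' * D * (A * U + - B' * W) + B' * D * (B * U + A' * W) = U"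
    "- B * D * (A * U + - B' * W) + A * D * (B * U + A' * W) = W"
    if "A * A' * D + B * B' * D = 1" for A A' B B' D U W :: complex
    using that by algebra+
  \<comment> \<open>\<open>?F\<close> has the columns \<open>(f, g)\<close> and
    \<open>(- cnj g, cnj f)\<close>, and its determinant is the sum of the squared moduli;
    \<open>?G\<close> is its adjugate divided by that determinant.\<close>
  let ?F = "\<lambda>i j :: nat. if i = 0 then (if j = 0 then f else (\<lambda>x. - cnj (g x))) else (if j = 0 then g else (\<lambda>x. cnj (f x)))"
  let ?G = "\<lambda>i j :: nat. if i = 0 then (if j = 0 then (\<lambda>x. cnj (f x) * d x) else (\<lambda>x. cnj (g x) * d x))
     else (if j = 0 then (\<lambda>x. - g x * d x) else (\<lambda>x. f x * d x))"
  note e = equi_mult[OF equi_cnj[OF f] d] equi_mult[OF equi_cnj[OF g] d] equi_mult[OF equi_minus[OF g] d] equi_mult[OF f d]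
  have "equi_mat [a, a + b + c] [a + b, a + c] ?F"
    unfolding equi_mat_def using f g equi_cnj[OF f] equi_minus[OF equi_cnj[OF g]]
    by (auto simp: less_Suc_eq algebra_simps)
  moreover have "equi_mat [a + b, a + c] [a, a + b + c] ?G"
    unfolding equi_mat_def using e by (auto simp: less_Suc_eq algebra_simps)
  moreover have "inverse_on 2 2 ?F ?G"
    unfolding inverse_on_def app_def
  proof (intro ballI allI impI)
    fix p s u i assume p: "p \<in> P" and i: "i < (2::nat)"
    show "(\<Sum>j<2. ?F i j (p, s) * (\<Sum>k<2. ?G j k (p, s) * u k)) = u i"
      using i alg(1,2)[OF d1[OF p, of s]] unfolding sum2 by (auto simp: less_2_cases_iff)
  qed
  moreover have "inverse_on 2 2 ?G ?F"
    unfolding inverse_on_def app_def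
  proof (intro ballI allI impI)
    fix p s u i assume p: "p \<in> P" and i: "i < (2::nat)"
    show "(\<Sum>j<2. ?G i j (p, s) * (\<Sum>k<2. ?F j k (p, s) * u k)) = u i"
      using i alg(3,4)[OF d1[OF p, of s]] unfolding sum2 by (auto simp: less_2_cases_iff)
  qed
  ultimately show ?thesis unfolding line_iso_def by (intro exI[of _ ?F] exI[of _ ?G]) (simp add: eval_nat_numeral)
qed

text \<open>This embeds the line bundle in a trivial bundle as a direct summand: with sections \<open>\<psi>\<^sub>l\<close> without common zeros,
  \<open>\<iota> = (\<psi>\<^sub>l\<^sup>*)\<^sub>l\<close> has the left inverse \<open>\<pi> = (\<psi>\<^sub>l / \<Sum>\<bar>\<psi>\<^sub>k\<bar>\<^sup>2)\<^sub>l\<close>.\<close>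

lemma trivial_summand:
  "\<exists>(n::nat) \<iota> \<pi>. (\<forall>l<n. equi (- a) (\<iota> l)) \<and> (\<forall>l<n. equi a (\<pi> l)) \<and>
     (\<forall>p\<in>P. \<forall>s. (\<Sum>l<n. \<pi> l (p, s) * \<iota> l (p, s)) = 1)"
proof -
  \<comment> \<open>One section per vertex, without zeros over the chart of that vertex; the charts
    cover, so there is no common zero.\<close>
  obtain Vs where Vs: "set Vs = V" using finite_list[OF finite_V] by blast
  have "\<forall>J. \<exists>f. J \<in> V \<longrightarrow> equi a f \<and> (\<forall>p s. facets_through M p \<subseteq> J \<longrightarrow> f (p, s) \<noteq> 0)"
    using section_chart by blast
  from choice[OF this] obtain f where f: "\<And>J. J \<in> V \<Longrightarrow> equi a (f J)"
    "\<And>J p s. J \<in> V \<Longrightarrow> facets_through M p \<subseteq> J \<Longrightarrow> f J (p, s) \<noteq> 0" by blast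
  define \<psi> where "\<psi> l = f (Vs ! l)" for l
  let ?n = "length Vs"
  define d where "d x = inverse (\<Sum>l<?n. \<psi> l x * cnj (\<psi> l x))" for x
  have e\<psi>: "equi a (\<psi> l)" if "l < ?n" for l
    using that Vs f(1) by (metis \<psi>_def nth_mem)
  have "equi 0 (\<lambda>x. \<Sum>l<?n. \<psi> l x * cnj (\<psi> l x))"
  proof (rule equi_sum)
    fix l assume "l \<in> {..<?n}"
    then show "equi 0 (\<lambda>x. \<psi> l x * cnj (\<psi> l x))" using equi_mult[OF e\<psi> equi_cnj[OF e\<psi>], of l l] by simp
  qed
  moreover have nz: "(\<Sum>l<?n. \<psi> l (p, s) * cnj (\<psi> l (p, s))) \<noteq> 0" if p: "p \<in> P" for p s
  proof -
    obtain J where "J \<in> V" "facets_through M p \<subseteq> J" using exists_vertex_set[OF p] .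
    then obtain l where l: "l < ?n" "\<psi> l (p, s) \<noteq> 0" using f(2) Vs by (metis \<psi>_def in_set_conv_nth)
    have "(\<Sum>l<?n. (cmod (\<psi> l (p, s)))\<^sup>2) > 0"
      by (rule sum_pos2[of _ l]) (use l in auto)
    moreover have "(\<Sum>l<?n. \<psi> l (p, s) * cnj (\<psi> l (p, s))) = of_real (\<Sum>l<?n. (cmod (\<psi> l (p, s)))\<^sup>2)"
      by (simp add: complex_norm_square del: of_real_power)
    ultimately show ?thesis by (metis of_real_eq_0_iff less_irrefl)
  qed
  ultimately have d: "equi 0 d" unfolding d_def by (rule equi_inverse)
  have "equi (- a) (\<lambda>x. cnj (\<psi> l x))" "equi a (\<lambda>x. \<psi> l x * d x)" if "l < ?n" for l
    using equi_cnj[OF e\<psi>[OF that]] equi_mult[OF e\<psi>[OF that] d] by simp_all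
  moreover have "(\<Sum>l<?n. \<psi> l (p, s) * d (p, s) * cnj (\<psi> l (p, s))) = 1" if p: "p \<in> P" for p s
  proof -
    have "(\<Sum>l<?n. \<psi> l (p, s) * d (p, s) * cnj (\<psi> l (p, s))) = (\<Sum>l<?n. \<psi> l (p, s) * cnj (\<psi> l (p, s))) * d (p, s)"
      by (simp add: sum_distrib_left sum_distrib_right mult_ac)
    then show ?thesis using nz[OF p, of s] by (simp add: d_def)
  qed
  ultimately show ?thesis
    by (intro exI[of _ ?n] exI[of _ "\<lambda>l x. cnj (\<psi> l x)"] exI[of _ "\<lambda>l x. \<psi> l x * d x"]) simp
qed

text \<open>The trivial bundle of rank \<open>n\<close> is the line bundle of \<open>a\<close> plus
  a complement, which need not be a sum of line bundles and so has no list of weights. Extending the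
  isomorphism by the identity of the complement is therefore done with explicit matrices over the
  trivial bundle.\<close>

lemma line_iso_cancel1:
  assumes "line_iso (as @ [a]) (bs @ [a])"
  shows "\<exists>n. line_iso (as @ replicate n 0) (bs @ replicate n 0)"
proof -
  obtain n :: nat and \<iota> \<pi> where \<iota>: "\<And>l. l < n \<Longrightarrow> equi (- a) (\<iota> l)" and \<pi>: "\<And>l. l < n \<Longrightarrow> equi a (\<pi> l)"
    and \<pi>\<iota>: "\<And>p s. p \<in> P \<Longrightarrow> (\<Sum>l<n. \<pi> l (p, s) * \<iota> l (p, s)) = 1" using trivial_summand[of a] by blast
  \<comment> \<open>\<open>F\<close> on the sum with the line bundle of \<open>a\<close> and the
    identity on the kernel of \<open>\<pi>\<close>: the corner block is
    \<open>\<iota> F \<pi> + (1 - \<iota> \<pi>)\<close>.\<close>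
  define bl where "bl F nb na = (\<lambda>i j x.
      if i < nb then (if j < na then F i j x else F i na x * \<pi> (j - na) x)
      else \<iota> (i - nb) x * (if j < na then F nb j x else F nb na x * \<pi> (j - na) x) +
        (if j < na then 0 else (if i - nb = j - na then 1 else 0) - \<iota> (i - nb) x * \<pi> (j - na) x))"
    for F :: "nat \<Rightarrow> nat \<Rightarrow> (real^'n) \<times> (nat \<Rightarrow> real) \<Rightarrow> complex" and nb na :: nat
  \<comment> \<open>Projects the trivial part of \<open>u\<close> to the line bundle of
    \<open>a\<close>, which becomes the last coordinate.\<close>
  define ctr where "ctr na x u = (\<lambda>j. if j < na then u j else \<Sum>l<n. \<pi> l x * u (na + l))"
    for na x and u :: "nat \<Rightarrow> complex"
  have em: "equi_mat (as @ replicate n 0) (bs @ replicate n 0) (bl F (length bs) (length as))"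
    if F: "equi_mat (as @ [a]) (bs @ [a]) F" for as bs F
    unfolding equi_mat_def
  proof (intro allI impI)
    fix i j assume ij: "i < length (bs @ replicate n 0)" "j < length (as @ replicate n 0)"
    let ?nb = "length bs" and ?na = "length as"
    have Fe: "equi ((bs @ [a]) ! i - (as @ [a]) ! j) (F i j)" if "i \<le> ?nb" "j \<le> ?na" for i j
      using F that by (simp add: equi_mat_def)
    have F1: "equi (bs ! i - as ! j) (F i j)" if "i < ?nb" "j < ?na" for i j
      using Fe[of i j] that by (simp add: nth_append)
    have F2: "equi (bs ! i - a) (F i ?na)" if "i < ?nb" for i
      using Fe[of i ?na] that by (simp add: nth_append)
    have F3: "equi (a - as ! j) (F ?nb j)" if "j < ?na" for j
      using Fe[of ?nb j] that by (simp add: nth_append)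
    have F4: "equi 0 (F ?nb ?na)"
      using Fe[of ?nb ?na] by (simp add: nth_append)
    consider (1) "i < ?nb" "j < ?na" | (2) "i < ?nb" "\<not> j < ?na" | (3) "\<not> i < ?nb" "j < ?na" | (4) "\<not> i < ?nb" "\<not> j < ?na"
      by blast
    then show "equi ((bs @ replicate n 0) ! i - (as @ replicate n 0) ! j) (bl F ?nb ?na i j)"
    proof cases
      case 1 then show ?thesis using F1 by (simp add: bl_def nth_append)
    next
      case 2
      then have "j - ?na < n" using ij by auto
      then show ?thesis using equi_mult[OF F2[OF 2(1)] \<pi>[of "j - ?na"]] 2 ij by (simp add: bl_def nth_append)
    next
      case 3
      then have "i - ?nb < n" using ij by auto
      then show ?thesis using equi_mult[OF \<iota>[of "i - ?nb"] F3[OF 3(2)]] 3 ij by (simp add: bl_def nth_append)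
    next
      case 4
      then have l: "j - ?na < n" "i - ?nb < n" using ij by auto
      have "equi 0 (\<lambda>x. \<iota> (i - ?nb) x * (F ?nb ?na x * \<pi> (j - ?na) x) +
          ((if i - ?nb = j - ?na then 1 else 0) - \<iota> (i - ?nb) x * \<pi> (j - ?na) x))"
        using equi_mult[OF \<iota>[OF l(2)] equi_mult[OF F4 \<pi>[OF l(1)]]] equi_mult[OF \<iota>[OF l(2)] \<pi>[OF l(1)]]
        by (intro equi_add equi_diff equi_const) simp_all
      then show ?thesis using 4 ij by (simp add: bl_def nth_append)
    qed
  qed
  \<comment> \<open>On the trivial part \<open>bl\<close> applies \<open>F\<close> to the projected
    vector, embeds its last coordinate by \<open>\<iota>\<close>, and adds the component
    \<open>u - \<iota> \<pi> u\<close> unchanged.\<close>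
  have apb: "app (bl F nb na) x (na + n) u i = (let w = app F x (na + 1) (ctr na x u) in
     if i < nb then w i else \<iota> (i - nb) x * w nb + u (na + (i - nb)) - \<iota> (i - nb) x * ctr na x u na)"
    if i: "i < nb + n" for F nb na x u i
  proof -
    have w: "app F x (na + 1) (ctr na x u) k = (\<Sum>j<na. F k j x * u j) + (\<Sum>l<n. F k na x * \<pi> l x * u (na + l))" for k
      by (simp add: app_def ctr_def sum_distrib_left mult.assoc)
    show ?thesis
    proof (cases "i < nb")
      case True
      then show ?thesis unfolding Let_def w unfolding app_def sum_lessThan_add by (simp add: bl_def)
    next
      case False
      then have i': "i - nb < n" using i by simp
      have "app (bl F nb na) x (na + n) u i = (\<Sum>j<na. \<iota> (i - nb) x * F nb j x * u j) +
        (\<Sum>l<n. \<iota> (i - nb) x * (F nb na x * \<pi> l x * u (na + l)) + (if i - nb = l then u (na + l) else 0) - \<iota> (i - nb) x * (\<pi> l x * u (na + l)))"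
        using False unfolding app_def sum_lessThan_add
        by (intro arg_cong2[where f = "(+)"] sum.cong) (auto simp: bl_def algebra_simps)
      also have "\<dots> = \<iota> (i - nb) x * ((\<Sum>j<na. F nb j x * u j) + (\<Sum>l<n. F nb na x * \<pi> l x * u (na + l)))
         + u (na + (i - nb)) - \<iota> (i - nb) x * (\<Sum>l<n. \<pi> l x * u (na + l))"
        using i' by (simp add: sum.distrib sum_subtractf sum_distrib_left distrib_left mult.assoc)
      finally show ?thesis using False unfolding Let_def w by (simp add: ctr_def)
    qed
  qed
  have inv: "inverse_on (nb + n) (na + n) (bl G na nb) (bl F nb na)"
    if GF: "inverse_on (nb + 1) (na + 1) G F" for nb na F G
    unfolding inverse_on_def
  proof (intro ballI allI impI)
    fix p and s :: "nat \<Rightarrow> real" and u :: "nat \<Rightarrow> complex" and i assume p: "p \<in> P" and i: "i < na + n"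
    let ?x = "(p, s)"
    let ?w = "app F ?x (na + 1) (ctr na ?x u)" and ?v = "app (bl F nb na) ?x (na + n) u"
    let ?u = "ctr na ?x u na"
    have v: "?v k = (if k < nb then ?w k else \<iota> (k - nb) ?x * ?w nb + u (na + (k - nb)) - \<iota> (k - nb) ?x * ?u)"
      if "k < nb + n" for k using apb[OF that] unfolding Let_def .
    have cv: "ctr nb ?x ?v k = ?w k" if "k < nb + 1" for k
    proof (cases "k < nb")
      case True
      then show ?thesis using v[of k] by (simp add: ctr_def)
    next
      case False
      then have "k = nb" using that by simp
      have "ctr nb ?x ?v nb = (\<Sum>l<n. \<pi> l ?x * (\<iota> l ?x * ?w nb + u (na + l) - \<iota> l ?x * ?u))"
        unfolding ctr_def[of nb] using v by (simp cong: sum.cong_simp)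
      also have "\<dots> = (\<Sum>l<n. \<pi> l ?x * \<iota> l ?x * ?w nb + \<pi> l ?x * u (na + l) - \<pi> l ?x * \<iota> l ?x * ?u)"
        by (intro sum.cong) (simp_all add: algebra_simps)
      also have "\<dots> = (\<Sum>l<n. \<pi> l ?x * \<iota> l ?x) * ?w nb + (\<Sum>l<n. \<pi> l ?x * u (na + l)) - (\<Sum>l<n. \<pi> l ?x * \<iota> l ?x) * ?u"
        by (simp only: sum.distrib sum_subtractf sum_distrib_right)
      also have "\<dots> = ?w nb" using \<pi>\<iota>[OF p, of s] by (simp add: ctr_def)
      finally show ?thesis using \<open>k = nb\<close> by simp
    qed
    have aG: "app G ?x (nb + 1) (ctr nb ?x ?v) k = ctr na ?x u k" if "k < na + 1" for k
    proof -
      have "app G ?x (nb + 1) (ctr nb ?x ?v) k = app G ?x (nb + 1) ?w k"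
        by (rule app_cong) (rule cv)
      then show ?thesis using GF p that by (simp add: inverse_on_def)
    qed
    show "app (bl G na nb) ?x (nb + n) ?v i = u i"
    proof (cases "i < na")
      case True
      have "app (bl G na nb) ?x (nb + n) ?v i = app G ?x (nb + 1) (ctr nb ?x ?v) i"
        using apb[OF i] True unfolding Let_def by simp
      also have "\<dots> = u i" using aG[of i] True by (simp add: ctr_def)
      finally show ?thesis .
    next
      case False
      have "app (bl G na nb) ?x (nb + n) ?v i = \<iota> (i - na) ?x * app G ?x (nb + 1) (ctr nb ?x ?v) na
          + ?v (nb + (i - na)) - \<iota> (i - na) ?x * ctr nb ?x ?v nb"
        using apb[OF i] False unfolding Let_def by simp
      also have "\<dots> = \<iota> (i - na) ?x * ?u + ?v (nb + (i - na)) - \<iota> (i - na) ?x * ?w nb"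
        using aG[of na] cv[of nb] by simp
      also have "\<dots> = u i"
      proof -
        obtain r where r: "i = na + r" using False by (metis le_Suc_ex not_less)
        then show ?thesis using v[of "nb + r"] i by simp
      qed
      finally show ?thesis .
    qed
  qed
  obtain F G where F: "equi_mat (as @ [a]) (bs @ [a]) F" "equi_mat (bs @ [a]) (as @ [a]) G"
    "inverse_on (length as + 1) (length bs + 1) F G" "inverse_on (length bs + 1) (length as + 1) G F"
    using assms unfolding line_iso_def by auto
  have "line_iso (as @ replicate n 0) (bs @ replicate n 0)"
    unfolding line_iso_def length_append length_replicate
    by (intro exI conjI, rule em[OF F(1)], rule em[OF F(2)], rule inv[OF F(3)], rule inv[OF F(4)])
  then show ?thesis by blast
qed

lemma line_iso_cancel:
  assumes "line_iso (as @ cs) (bs @ cs)"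
  shows "\<exists>n. line_iso (as @ replicate n 0) (bs @ replicate n 0)"
  using assms
proof (induction cs arbitrary: as bs)
  case Nil
  then show ?case by (intro exI[of _ 0]) simp
next
  case (Cons c cs)
  have "line_iso ((as @ [c]) @ cs) ((bs @ [c]) @ cs)" using Cons.prems by simp
  from Cons.IH[OF this] obtain n where n: "line_iso ((as @ [c]) @ replicate n 0) ((bs @ [c]) @ replicate n 0)"
    by blast
  have "line_iso ((as @ replicate n 0) @ [c]) ((as @ [c]) @ replicate n 0)" by (rule line_iso_mset) simp
  moreover have "line_iso ((bs @ [c]) @ replicate n 0) ((bs @ replicate n 0) @ [c])" by (rule line_iso_mset) simp
  ultimately have "line_iso ((as @ replicate n 0) @ [c]) ((bs @ replicate n 0) @ [c])"
    using n line_iso_trans by blast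
  from line_iso_cancel1[OF this] obtain k where
    "line_iso ((as @ replicate n 0) @ replicate k 0) ((bs @ replicate n 0) @ replicate k 0)" by blast
  then have "line_iso (as @ replicate (n + k) 0) (bs @ replicate (n + k) 0)"
    by (simp add: replicate_add)
  then show ?case by blast
qed

end

section \<open>The ring of virtual sums of line bundles\<close>

type_synonym group_ring = "weight \<Rightarrow>\<^sub>0 int"

text \<open>\<open>frag_of\<close> occurs at two levels: inside \<open>weight\<close> it is a
  generator of the character group, here it is the basis element of the ring belonging to a group
  element.\<close>

definition mon :: "weight \<Rightarrow> group_ring" where
  "mon w = frag_of w"

definition list_class :: "weight list \<Rightarrow> group_ring" where
  "list_class as = (\<Sum>a\<leftarrow>as. mon a)"

definition mon1 :: "nat \<Rightarrow> group_ring" where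
  "mon1 i = mon (frag_of i) - 1"

lemma mon_0 [simp]: "mon 0 = 1"
  by (simp add: mon_def)

lemma mon_add: "mon (a + b) = mon a * mon b"
  by (simp add: mon_def mult_single)

lemma mon_uminus_mult [simp]: "mon (- a) * mon a = 1" "mon a * mon (- a) = 1"
  by (simp_all add: mon_add[symmetric])

lemma mon_diff: "mon (a - b) = mon a * mon (- b)"
  by (simp add: mon_add[symmetric])

lemma list_class_simps [simp]:
  "list_class [] = 0" "list_class (a # as) = mon a + list_class as"
  "list_class (as @ bs) = list_class as + list_class bs"
  by (simp_all add: list_class_def)

lemma list_class_replicate: "list_class (replicate n a) = of_nat n * mon a"
  by (induction n) (simp_all add: algebra_simps)

lemma list_class_map_add: "list_class (map ((+) a) as) = mon a * list_class as"
  by (induction as) (simp_all add: mon_add algebra_simps)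

lemma lookup_list_class: "Poly_Mapping.lookup (list_class as) a = int (count (mset as) a)"
  by (induction as) (simp_all add: mon_def lookup_add lookup_single when_def)

text \<open>The ring is free on the weights, so an equality in it says no more than a permutation of
  summands; bundle isomorphisms enter through \<open>null\<close> alone.\<close>

lemma list_class_eq_iff: "list_class as = list_class bs \<longleftrightarrow> mset as = mset bs"
proof
  assume "list_class as = list_class bs"
  then have "int (count (mset as) a) = int (count (mset bs) a)" for a
    by (metis lookup_list_class)
  then show "mset as = mset bs" by (simp add: multiset_eq_iff)
next
  assume "mset as = mset bs"
  then show "list_class as = list_class bs" by (intro poly_mapping_eqI) (simp add: lookup_list_class)
qed

lemma group_ring_induct [case_names zero mon diff]:
  assumes "Q 0" "\<And>w. Q (mon w)" "\<And>a b. Q a \<Longrightarrow> Q b \<Longrightarrow> Q (a - b)" shows "Q (x :: group_ring)"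
  by (rule frag_induction[of x UNIV Q]) (use assms in \<open>auto simp: mon_def\<close>)

definition ring_ideal :: "(group_ring \<Rightarrow> bool) \<Rightarrow> bool" where
  "ring_ideal S \<longleftrightarrow> S 0 \<and> (\<forall>x y. S x \<longrightarrow> S y \<longrightarrow> S (x - y)) \<and> (\<forall>x y. S y \<longrightarrow> S (x * y))"

lemma ring_idealD:
  assumes "ring_ideal S"
  shows "S 0" "S x \<Longrightarrow> S y \<Longrightarrow> S (x - y)" "S y \<Longrightarrow> S (x * y)" "S y \<Longrightarrow> S (y * x)" "S x \<Longrightarrow> S y \<Longrightarrow> S (x + y)"
proof -
  show 1: "S 0" "S x \<Longrightarrow> S y \<Longrightarrow> S (x - y)" "S y \<Longrightarrow> S (x * y)" for x y
    using assms by (auto simp: ring_ideal_def)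
  show "S y \<Longrightarrow> S (y * x)" using 1(3)[of y x] by (simp add: mult.commute)
  show "S x \<Longrightarrow> S y \<Longrightarrow> S (x + y)" using 1(2)[of x "0 - y"] 1(2)[of 0 y] 1(1) by simp
qed

text \<open>The weights \<open>w\<close> with \<open>S (y * (mon w - 1))\<close> form a subgroup of
  the character group, so the generators occurring in \<open>w\<close> decide.\<close>

lemma ring_ideal_mon:
  assumes S: "ring_ideal S" and w: "\<And>i. i \<in> Poly_Mapping.keys w \<Longrightarrow> S (y * mon1 i)"
  shows "S (y * (mon w - 1))"
proof (rule frag_induction[of w "Poly_Mapping.keys w" "\<lambda>w. S (y * (mon w - 1))"])
  show "S (y * (mon 0 - 1))" using ring_idealD(1)[OF S] by simp
  show "S (y * (mon (frag_of i) - 1))" if "i \<in> Poly_Mapping.keys w" for i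
    using w[OF that] by (simp add: mon1_def)
  fix a b assume "S (y * (mon a - 1))" "S (y * (mon b - 1))"
  then have "S (mon (- b) * (y * (mon a - 1) - y * (mon b - 1)))" using ring_idealD(2,3)[OF S] by blast
  moreover have "mon (- b) * (y * (mon a - 1) - y * (mon b - 1)) = y * (mon (a - b) - 1)"
  proof -
    have "mon (- b) * (y * (mon a - 1) - y * (mon b - 1)) = y * (mon a * mon (- b)) - y * (mon (- b) * mon b)"
      by (simp add: algebra_simps del: mon_uminus_mult)
    then show ?thesis by (simp add: mon_diff algebra_simps)
  qed
  ultimately show "S (y * (mon (a - b) - 1))" by simp
qed simp

lemma ring_ideal_mon_split:
  assumes S: "ring_ideal S" and "S (y * (mon (a + b) - 1))" "S (y * (mon b - 1))"
  shows "S (y * (mon a - 1))"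
proof -
  have "S (y * (mon (a + b) - 1) - mon a * (y * (mon b - 1)))" using ring_idealD(2,3)[OF S] assms by blast
  moreover have "y * (mon (a + b) - 1) - mon a * (y * (mon b - 1)) = y * (mon a - 1)"
    by (simp add: mon_add algebra_simps)
  ultimately show ?thesis by simp
qed

section \<open>The ideal of stably vanishing classes\<close>

context char_pair
begin

text \<open>The kernel of the passage to stable classes. It is an ideal because isomorphisms can be
  added and tensored with a line bundle (\<open>line_iso_append\<close>,
  \<open>line_iso_shift\<close>).\<close>

definition null :: "group_ring \<Rightarrow> bool" where
  "null x \<longleftrightarrow> (\<exists>as bs. line_iso as bs \<and> x = list_class as - list_class bs)"

lemma ring_ideal_null: "ring_ideal null"
proof -
  have 0: "null 0" unfolding null_def by (rule exI[of _ "[]"], rule exI[of _ "[]"]) (simp add: line_iso_refl)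
  have minus: "null (x - y)" if xy: "null x" "null y" for x y
  proof -
    obtain as bs where 1: "line_iso as bs" "x = list_class as - list_class bs" using xy(1) by (auto simp: null_def)
    obtain cs ds where 2: "line_iso cs ds" "y = list_class cs - list_class ds" using xy(2) by (auto simp: null_def)
    have "line_iso (as @ ds) (bs @ cs)" using line_iso_append[OF 1(1) line_iso_sym[OF 2(1)]] .
    moreover have "x - y = list_class (as @ ds) - list_class (bs @ cs)" using 1 2 by simp
    ultimately show ?thesis unfolding null_def by blast
  qed
  have mon: "null (mon w * y)" if y: "null y" for w y
  proof -
    obtain as bs where 1: "line_iso as bs" "y = list_class as - list_class bs" using y by (auto simp: null_def)
    have "mon w * y = list_class (map ((+) w) as) - list_class (map ((+) w) bs)"
      by (simp add: 1(2) list_class_map_add right_diff_distrib)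
    then show ?thesis using line_iso_shift[OF 1(1)] unfolding null_def by blast
  qed
  have "null (x * y)" if "null y" for x y
  proof (induction x rule: group_ring_induct)
    case (diff a b)
    then show ?case using minus by (simp add: left_diff_distrib)
  qed (use 0 mon that in auto)
  then show ?thesis unfolding ring_ideal_def using 0 minus by blast
qed

lemmas null_ideal = ring_idealD[OF ring_ideal_null]

text \<open>Freeness of the ring turns the equation of classes into a permutation of
  \<open>as @ ds\<close> and \<open>bs @ cs\<close>. With the isomorphism of \<open>cs\<close> and
  \<open>ds\<close> this makes \<open>cs\<close> a common summand, and cancellation trades it for
  trivial bundles.\<close>

lemma null_list_classD:
  assumes "null (list_class as - list_class bs)"
  shows "\<exists>n. line_iso (as @ replicate n 0) (bs @ replicate n 0)"
proof -
  obtain cs ds where cd: "line_iso cs ds" "list_class as - list_class bs = list_class cs - list_class ds"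
    using assms by (auto simp: null_def)
  then have "list_class (as @ ds) = list_class (bs @ cs)" by (simp add: algebra_simps)
  then have 1: "line_iso (as @ ds) (bs @ cs)" unfolding list_class_eq_iff by (rule line_iso_mset)
  have "line_iso (as @ cs) (as @ ds)" using line_iso_append[OF line_iso_refl cd(1)] .
  then have "line_iso (as @ cs) (bs @ cs)" using 1 line_iso_trans by blast
  then show ?thesis by (rule line_iso_cancel)
qed

lemma null_trivial:
  assumes "\<And>\<kappa>. torus_map M \<kappa> \<in> range real_vec \<Longrightarrow> pairing w \<kappa> \<in> \<int>" shows "null (mon w - 1)"
proof -
  have "line_iso [w] [0]" using line_iso_trivial[of w 0, OF assms] by simp
  then show ?thesis unfolding null_def by (intro exI[of _ "[w]"] exI[of _ "[0]"]) simp
qed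

lemma null_relation: "null (mon (relation z) - 1)"
  by (rule null_trivial) (rule pairing_relation)

lemma null_outside: "\<not> i < m \<Longrightarrow> null (mon1 i)"
  unfolding mon1_def by (rule null_trivial) (simp add: pairing_single_outside)

end

context polygon_pair
begin

text \<open>Expanded, the product is the difference of the two sides of the Koszul isomorphism for
  the two coordinate sections, which have no common zero.\<close>

lemma null_disjoint:
  assumes "i < m" "j < m" "i \<noteq> j" "{i, j} \<notin> V" shows "null (mon1 i * mon1 j)"
proof -
  let ?i = "frag_of i :: weight" and ?j = "frag_of j :: weight"
  have "line_iso [0, 0 + ?i + ?j] [0 + ?i, 0 + ?j]"
    using disjoint_facets[OF assms] coord_section_eq_0[OF assms(1)] coord_section_eq_0[OF assms(2)]
    by (intro line_iso_koszul[OF equi_coord_section[OF assms(1)] equi_coord_section[OF assms(2)]]) blast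
  moreover have "mon1 i * mon1 j = list_class [0, 0 + ?i + ?j] - list_class [0 + ?i, 0 + ?j]"
    by (simp add: mon1_def mon_add algebra_simps)
  ultimately show ?thesis unfolding null_def by blast
qed

text \<open>The line bundles of the facets away from a vertex generate, so the ideal of the \<open>mon1 i\<close> is already
  generated by these.\<close>

lemma ideal_vertex:
  assumes S: "ring_ideal S" "\<And>x. null x \<Longrightarrow> S x" and kj: "{k, j} \<in> V"
    and y: "\<And>i. i < m \<Longrightarrow> i \<noteq> k \<Longrightarrow> i \<noteq> j \<Longrightarrow> S (y * mon1 i)"
  shows "S (y * mon1 k)"
proof -
  define r where "r = relation (dualvec {k, j} k)"
  \<comment> \<open>\<open>dualvec {k, j} k\<close> pairs to 1 with \<open>lam k\<close> and to 0
    with \<open>lam j\<close>. Its relation thus says that \<open>\<theta>\<^sub>k\<close> times a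
    monomial \<open>o'\<close> in the facets off the vertex is trivial.\<close>
  define o' where "o' = r - frag_of k"
  have km: "k < m" "j < m" "k \<noteq> j" using vertex_pair_less[OF kj] vertex_pair_neq[OF kj] by auto
  have o'kj: "Poly_Mapping.lookup o' k = 0" "Poly_Mapping.lookup o' j = 0"
    using dualvec(1)[OF kj, of k k] dualvec(1)[OF kj, of k j] km
    by (simp_all add: o'_def r_def lookup_minus lookup_relation lookup_single)
  have o': "Poly_Mapping.lookup o' i = 0" if "\<not> i < m \<or> i = k \<or> i = j" for i
    using that o'kj km by (auto simp: o'_def r_def lookup_minus lookup_relation lookup_single when_def)
  have "S (y * mon1 i)" if "i \<in> Poly_Mapping.keys o'" for i
  proof -
    have "Poly_Mapping.lookup o' i \<noteq> 0" using that by (simp add: in_keys_iff)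
    then have "i < m" "i \<noteq> k" "i \<noteq> j" using o' by auto
    then show ?thesis by (rule y)
  qed
  then have s1: "S (y * (mon o' - 1))" by (rule ring_ideal_mon[OF S(1)])
  have s2: "S (y * (mon (frag_of k + o') - 1))"
    using ring_idealD(3)[OF S(1) S(2)[OF null_relation]] by (simp add: o'_def r_def)
  show ?thesis unfolding mon1_def by (rule ring_ideal_mon_split[OF S(1) s2 s1])
qed

text \<open>Makes a line bundle plus its dual a unit multiple of a square, so that only products of
  two classes have to be known.\<close>

lemma mon_self_dual: "mon w + mon (- w) - 2 = mon (- w) * ((mon w - 1) * (mon w - 1))"
proof -
  have "mon (- w) * ((mon w - 1) * (mon w - 1)) = (mon (- w) * mon w) * mon w - 2 * (mon (- w) * mon w) + mon (- w)"
    by (simp add: algebra_simps del: mon_uminus_mult)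
  then show ?thesis by simp
qed

end

section \<open>Products of the classes \<open>mon1\<close> in the presence of the handle\<close>

locale handle_pair = polygon_pair M for M +
  fixes F C Q D
  assumes handle: "handle_facets M F C Q D"
begin

lemma dist: "F \<noteq> C" "F \<noteq> Q" "F \<noteq> D" "C \<noteq> Q" "C \<noteq> D" "Q \<noteq> D"
  and less: "F < m" "C < m" "Q < m" "D < m"
  and vertices: "{F, C} \<in> V" "{C, Q} \<in> V" "{Q, D} \<in> V"
  using handle by (auto simp: handle_facets_def)

lemma lam_F: "lam F = - lam Q - lam C" and lam_D: "lam D = lam C"
proof -
  have 0: "lam F + lam Q + lam C = 0" "lam F + lam Q + lam D = 0" using handle by (simp_all add: handle_facets_def)
  have "lam F = (lam F + lam Q + lam C) - lam Q - lam C" by simp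
  then show "lam F = - lam Q - lam C" unfolding 0 by simp
  have "lam D = (lam F + lam Q + lam D) - (lam F + lam Q + lam C) + lam C" by simp
  then show "lam D = lam C" unfolding 0 by simp
qed

lemma nbr:
  assumes "{i, j} \<in> V" "{i, k} \<in> V" "j \<noteq> k" "{i, l} \<in> V" shows "l = j \<or> l = k"
proof -
  have "i < m" using vertex_pair_less assms(1) by blast
  then obtain j' k' where "\<And>l. {i, l} \<in> V \<Longrightarrow> l = j' \<or> l = k'" using two_vertices by metis
  then show ?thesis using assms by metis
qed

lemma nbr_C: "{C, l} \<in> V \<Longrightarrow> l = F \<or> l = Q"
  using nbr[of C F Q l] vertices dist by (simp add: insert_commute)

lemma nbr_Q: "{Q, l} \<in> V \<Longrightarrow> l = C \<or> l = D"
  using nbr[of Q C D l] vertices dist by (simp add: insert_commute)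

lemma null_C: "i < m \<Longrightarrow> i \<noteq> C \<Longrightarrow> i \<noteq> F \<Longrightarrow> i \<noteq> Q \<Longrightarrow> null (mon1 C * mon1 i)"
  using null_disjoint[of C i] nbr_C less by blast

lemma null_Q: "i < m \<Longrightarrow> i \<noteq> Q \<Longrightarrow> i \<noteq> C \<Longrightarrow> i \<noteq> D \<Longrightarrow> null (mon1 Q * mon1 i)"
  using null_disjoint[of Q i] nbr_Q less by blast

text \<open>Named after the fixed point over the vertex \<open>{C, Q}\<close>, the common zero locus
  of the coordinate sections of \<open>C\<close> and \<open>Q\<close>.\<close>

definition pt :: group_ring where
  "pt = mon1 C * mon1 Q"

text \<open>\<open>F\<close> is disjoint from \<open>Q\<close>, and every facet other than
  \<open>C\<close>, \<open>Q\<close>, \<open>F\<close> is disjoint from \<open>C\<close>, so one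
  factor of \<open>pt\<close> kills it. The cases \<open>C\<close> and \<open>Q\<close> follow from
  these by \<open>ideal_vertex\<close>.\<close>

lemma null_pt: "null (pt * mon1 i)"
proof -
  have *: "null (pt * mon1 i)" if "i < m" "i \<noteq> C" "i \<noteq> Q" for i
  proof (cases "i = F")
    case True
    then have "null (mon1 Q * mon1 i)" using null_Q that dist by simp
    from null_ideal(3)[OF this, of "mon1 C"] show ?thesis by (simp add: pt_def mult_ac)
  next
    case False
    then have "null (mon1 C * mon1 i)" using null_C that by simp
    from null_ideal(3)[OF this, of "mon1 Q"] show ?thesis by (simp add: pt_def mult_ac)
  qed
  have "null (pt * mon1 C)" by (rule ideal_vertex[OF ring_ideal_null _ vertices(2)]) (use * in auto)
  moreover have QC: "{Q, C} \<in> V" using vertices(2) by (simp add: insert_commute)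
  have "null (pt * mon1 Q)" by (rule ideal_vertex[OF ring_ideal_null _ QC]) (use * in auto)
  moreover have "null (pt * mon1 i)" if "\<not> i < m" using null_ideal(3)[OF null_outside[OF that]] .
  ultimately show ?thesis using * by blast
qed

lemma null_pt_mon: "null (pt * (mon w - 1))"
  by (rule ring_ideal_mon[OF ring_ideal_null]) (rule null_pt)

definition pt_span :: "group_ring \<Rightarrow> bool" where
  "pt_span x \<longleftrightarrow> (\<exists>n::int. null (x - of_int n * pt))"

text \<open>By \<open>null_pt_mon\<close> every line bundle acts on \<open>pt\<close> as the
  identity, so a ring multiple of \<open>pt\<close> is an integer multiple modulo
  \<open>null\<close>. This is what makes \<open>pt_span\<close> an ideal.\<close>

lemma pt_span_mult_pt: "pt_span (x * pt)"
proof (induction x rule: group_ring_induct)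
  case zero
  show ?case unfolding pt_span_def by (rule exI[of _ 0]) (simp add: null_ideal(1))
next
  case (mon w)
  show ?case unfolding pt_span_def using null_pt_mon[of w]
    by (intro exI[of _ 1]) (simp add: algebra_simps)
next
  case (diff a b)
  then obtain k n :: int where "null (a * pt - of_int k * pt)" "null (b * pt - of_int n * pt)"
    by (auto simp: pt_span_def)
  from null_ideal(2)[OF this] show ?case unfolding pt_span_def
    by (intro exI[of _ "k - n"]) (simp add: algebra_simps)
qed

lemma ring_ideal_pt_span: "ring_ideal pt_span"
  unfolding ring_ideal_def
proof (intro conjI allI impI)
  show "pt_span 0" unfolding pt_span_def by (rule exI[of _ 0]) (simp add: null_ideal(1))
  fix x y assume "pt_span x" "pt_span y"
  then obtain k n :: int where "null (x - of_int k * pt)" "null (y - of_int n * pt)"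
    by (auto simp: pt_span_def)
  from null_ideal(2)[OF this] show "pt_span (x - y)" unfolding pt_span_def
    by (intro exI[of _ "k - n"]) (simp add: algebra_simps)
next
  fix x y assume "pt_span y"
  then obtain n :: int where n: "null (y - of_int n * pt)" by (auto simp: pt_span_def)
  obtain k :: int where "null (x * of_int n * pt - of_int k * pt)"
    using pt_span_mult_pt[of "x * of_int n"] by (auto simp: pt_span_def)
  from null_ideal(5)[OF null_ideal(3)[OF n, of x] this] show "pt_span (x * y)"
    unfolding pt_span_def by (intro exI[of _ k]) (simp add: algebra_simps)
qed

lemma null_pt_span: "null x \<Longrightarrow> pt_span x"
  unfolding pt_span_def by (rule exI[of _ 0]) simp

text \<open>Facet \<open>k\<close> meets only its neighbours \<open>l\<close> and \<open>j\<close>.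
  All products except those with \<open>k\<close> and \<open>j\<close> are thus known, and
  \<open>ideal_vertex\<close> at \<open>{k, j}\<close> supplies these two.\<close>

lemma pt_span_edge:
  assumes lk: "{k, l} \<in> V" and s: "pt_span (mon1 k * mon1 l)" and i: "i < m"
  shows "pt_span (mon1 k * mon1 i)"
proof -
  have k: "k < m" using vertex_pair_less[OF lk] by simp
  obtain j where j: "{k, j} \<in> V" "j \<noteq> l" "\<And>i. {k, i} \<in> V \<Longrightarrow> i = l \<or> i = j"
    using two_vertices[OF k] lk by metis
  have *: "pt_span (mon1 k * mon1 i)" if "i < m" "i \<noteq> k" "i \<noteq> j" for i
  proof (cases "i = l")
    case False
    then have "{k, i} \<notin> V" using j that by blast
    then show ?thesis using null_disjoint[OF k] that null_pt_span by simp
  qed (use s in simp)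
  have "pt_span (mon1 k * mon1 k)"
    by (rule ideal_vertex[OF ring_ideal_pt_span null_pt_span j(1)]) (use * in auto)
  moreover have jk: "{j, k} \<in> V" using j(1) by (simp add: insert_commute)
  have "pt_span (mon1 k * mon1 j)"
    by (rule ideal_vertex[OF ring_ideal_pt_span null_pt_span jk]) (use * in auto)
  ultimately show ?thesis using * i by blast
qed

definition tame :: "nat \<Rightarrow> bool" where
  "tame k \<longleftrightarrow> (\<forall>i<m. pt_span (mon1 k * mon1 i))"

lemma tame_edge:
  assumes "tame k" "{k, l} \<in> V" shows "tame l"
proof -
  have "{l, k} \<in> V" using assms(2) by (simp add: insert_commute)
  moreover have "pt_span (mon1 k * mon1 l)" using assms vertex_pair_less[OF assms(2)] by (simp add: tame_def)
  then have "pt_span (mon1 l * mon1 k)" by (simp only: mult.commute)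
  ultimately show ?thesis unfolding tame_def using pt_span_edge by blast
qed

lemma tame_C: "tame C"
  unfolding tame_def
  using pt_span_edge[OF vertices(2)] pt_span_mult_pt[of 1] by (simp add: pt_def)

text \<open>Starting from \<open>{F, C}\<close>, the property passes between vertices sharing a
  facet by \<open>tame_edge\<close>. Leaving out the vertex \<open>{C, Q}\<close> loses no facet,
  since each facet has two vertices.\<close>

lemma tame: assumes k: "k < m" shows "tame k"
proof -
  let ?X = "{C, Q}"
  define S where "S = {J \<in> V - {?X}. \<forall>k\<in>J. tame k}"
  have FC: "{F, C} \<noteq> ?X" using dist by (simp add: doubleton_eq_iff)
  have "tame F" using tame_edge[OF tame_C] vertices(1) by (simp add: insert_commute)
  then have FS: "{F, C} \<in> S" using tame_C vertices(1) FC by (simp add: S_def)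
  have "S = V - {?X}"
  proof (rule vertex_sets_connected[OF vertices(2)])
    show "S \<subseteq> V - {?X}" by (auto simp: S_def)
    show "S \<noteq> {}" using FS by blast
    fix J K assume J: "J \<in> S" and K: "K \<in> V - {?X}" "J \<inter> K \<noteq> {}"
    then obtain l where l: "l \<in> J" "l \<in> K" by blast
    have KV: "K \<in> V" using K by simp
    obtain k where k: "K = {l, k}" using vertex_set_pair[OF KV l(2)] by blast
    have "tame l" using J l by (simp add: S_def)
    moreover have "tame k" using tame_edge[OF \<open>tame l\<close>] KV k by simp
    ultimately show "K \<in> S" using K k by (simp add: S_def)
  qed
  moreover obtain i j where ij: "{k, i} \<in> V" "{k, j} \<in> V" "i \<noteq> j" using two_vertices[OF k] by metis
  then have "{k, i} \<noteq> ?X \<or> {k, j} \<noteq> ?X" by (auto simp: doubleton_eq_iff)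
  ultimately have "{k, i} \<in> S \<or> {k, j} \<in> S" using ij by blast
  then show ?thesis by (auto simp: S_def)
qed

text \<open>Since \<open>lam F = - lam Q - lam C\<close>, a functional with value 1 on
  \<open>lam Q\<close> and -1 on \<open>lam C\<close> vanishes on \<open>lam F\<close>. Its relation
  identifies \<open>\<theta>\<^sub>Q\<close> with \<open>\<theta>\<^sub>C\<close> up to bundles of
  facets disjoint from \<open>C\<close>, which are invisible after multiplying by
  \<open>mon1 C\<close>.\<close>

lemma null_CC: "null (mon1 C * mon1 C - pt)"
proof -
  let ?d = "dualvec {C, Q}"
  define z where "z = ?d Q - ?d C"
  note d = dualvec(1)[OF vertices(2)]
  have dot: "int_dot z x = int_dot (?d Q) x - int_dot (?d C) x" for x
    by (simp add: z_def int_dot_def left_diff_distrib sum_subtractf)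
  have neg: "int_dot y (- u - v) = - int_dot y u - int_dot y v" for y u v :: "int^2"
    by (simp add: int_dot_def right_diff_distrib sum_subtractf sum_negf)
  have zv: "int_dot z (lam Q) = 1" "int_dot z (lam C) = -1" "int_dot z (lam F) = 0"
    using d dist by (simp_all add: dot lam_F neg)
  let ?a = "frag_of Q - frag_of C :: weight"
  define o' where "o' = relation z - ?a"
  have o': "Poly_Mapping.lookup o' i = (if i < m \<and> i \<notin> {C, Q, F} then int_dot z (lam i) else 0)" for i
    using zv less dist by (auto simp: o'_def lookup_minus lookup_relation lookup_single when_def)
  have "null (mon1 C * mon1 i)" if "i \<in> Poly_Mapping.keys o'" for i
    using that null_C[of i] by (auto simp: in_keys_iff o' split: if_splits)
  then have s1: "null (mon1 C * (mon o' - 1))" by (rule ring_ideal_mon[OF ring_ideal_null])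
  have s2: "null (mon1 C * (mon (?a + o') - 1))"
    using null_ideal(3)[OF null_relation] by (simp add: o'_def)
  have "null (mon1 C * (mon ?a - 1))" by (rule ring_ideal_mon_split[OF ring_ideal_null s2 s1])
  \<comment> \<open>Clears the inverse of \<open>\<theta>\<^sub>C\<close> and fixes the
    sign.\<close>
  from null_ideal(3)[OF this, of "- mon (frag_of C)"]
  have "null (- (mon1 C * (mon (frag_of Q) * (mon (frag_of C) * mon (- frag_of C))
      - mon (frag_of C))))"
    by (simp add: mon_diff algebra_simps del: mon_uminus_mult)
  then have "null (- (mon1 C * (mon (frag_of Q) - mon (frag_of C))))"
    by simp
  moreover have "- (mon1 C * (mon (frag_of Q) - mon (frag_of C))) = mon1 C * mon1 C - pt"
    by (simp add: pt_def mon1_def algebra_simps)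
  ultimately show ?thesis by simp
qed

text \<open>As \<open>lam D = lam C\<close>, the dual vector of \<open>Q\<close> vanishes on both
  neighbours of \<open>Q\<close>; its relation makes \<open>\<theta>\<^sub>Q\<close> trivial up to
  bundles of facets disjoint from \<open>Q\<close>.\<close>

lemma null_QQ: "null (mon1 Q * mon1 Q)"
proof -
  define z where "z = dualvec {C, Q} Q"
  note d = dualvec(1)[OF vertices(2)]
  have zv: "int_dot z (lam Q) = 1" "int_dot z (lam C) = 0" "int_dot z (lam D) = 0"
    using d dist by (simp_all add: z_def lam_D)
  let ?a = "frag_of Q :: weight"
  define o' where "o' = relation z - ?a"
  have o': "Poly_Mapping.lookup o' i = (if i < m \<and> i \<notin> {C, Q, D} then int_dot z (lam i) else 0)" for i
    using zv less dist by (auto simp: o'_def lookup_minus lookup_relation lookup_single when_def)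
  have "null (mon1 Q * mon1 i)" if "i \<in> Poly_Mapping.keys o'" for i
    using that null_Q[of i] by (auto simp: in_keys_iff o' split: if_splits)
  then have s1: "null (mon1 Q * (mon o' - 1))" by (rule ring_ideal_mon[OF ring_ideal_null])
  have s2: "null (mon1 Q * (mon (?a + o') - 1))"
    using null_ideal(3)[OF null_relation] by (simp add: o'_def)
  have "null (mon1 Q * (mon ?a - 1))" by (rule ring_ideal_mon_split[OF ring_ideal_null s2 s1])
  then show ?thesis by (simp add: mon1_def)
qed

lemma null_mon_mult:
  assumes "null (x - y * pt)" shows "null (mon w * x - y * pt)"
proof -
  have "null (mon w * (x - y * pt) + y * (pt * (mon w - 1)))"
    using null_ideal(5)[OF null_ideal(3)[OF assms] null_ideal(3)[OF null_pt_mon]] .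
  then show ?thesis by (simp add: algebra_simps)
qed

lemma plus_pt:
  defines "u \<equiv> frag_of C :: weight"
  shows "null (mon u + mon (- u) - 2 - pt)"
  using null_mon_mult[of "mon1 C * mon1 C" 1 "- u"] null_CC unfolding mon_self_dual by (simp add: mon1_def u_def)

text \<open>Up to a unit, \<open>mon v - 1\<close> is \<open>mon1 C - mon1 Q\<close>. Its square is
  \<open>pt - 2 * pt + 0\<close> modulo \<open>null\<close>: the cross term outweighs the
  self-intersection of \<open>C\<close> and turns the sign.\<close>

lemma minus_pt:
  defines "v \<equiv> frag_of C - frag_of Q :: weight"
  shows "null (mon v + mon (- v) - 2 + pt)"
proof -
  let ?q = "frag_of Q :: weight"
  have eq: "mon v - 1 = mon (- ?q) * (mon1 C - mon1 Q)"
  proof -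
    have "mon (- ?q) * (mon1 C - mon1 Q) = mon (frag_of C) * mon (- ?q) - mon (- ?q) * mon ?q"
      by (simp add: mon1_def algebra_simps del: mon_uminus_mult)
    then show ?thesis by (simp add: v_def mon_diff)
  qed
  have "null ((mon1 C * mon1 C - pt) + mon1 Q * mon1 Q)"
    using null_ideal(5)[OF null_CC null_QQ] .
  moreover have "(mon1 C * mon1 C - pt) + mon1 Q * mon1 Q = (mon1 C - mon1 Q) * (mon1 C - mon1 Q) - (- 1) * pt"
    by (simp add: pt_def algebra_simps)
  ultimately have "null ((mon1 C - mon1 Q) * (mon1 C - mon1 Q) - (- 1) * pt)" by simp
  from null_mon_mult[OF this, of "- v + (- ?q + - ?q)"]
  have N: "null (mon (- v) * (mon (- ?q) * mon (- ?q)) * ((mon1 C - mon1 Q) * (mon1 C - mon1 Q)) - (- 1) * pt)"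
    by (simp only: mon_add)
  have "mon v + mon (- v) - 2 = mon (- v) * (mon (- ?q) * mon (- ?q)) * ((mon1 C - mon1 Q) * (mon1 C - mon1 Q))"
    unfolding mon_self_dual eq by (simp only: mult_ac)
  then show ?thesis using N by (simp only: mult_minus_left mult_1_left diff_minus_eq_add)
qed

lemma stably_trivial:
  "\<exists>bs N. line_iso (map (\<lambda>k. frag_of k) [0..<m] @ bs) (replicate N 0)"
proof -
  let ?e = "\<lambda>k. frag_of k :: weight"
  have "\<forall>k. \<exists>n::int. k < m \<longrightarrow> null (mon (?e k) + mon (- ?e k) - 2 - of_int n * pt)"
  proof
    fix k
    show "\<exists>n::int. k < m \<longrightarrow> null (mon (?e k) + mon (- ?e k) - 2 - of_int n * pt)"
    proof (cases "k < m")
      case True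
      then have "pt_span (mon1 k * mon1 k)" using tame tame_def by blast
      then obtain n :: int where "null (mon1 k * mon1 k - of_int n * pt)" by (auto simp: pt_span_def)
      from null_mon_mult[OF this, of "- ?e k"] show ?thesis unfolding mon_self_dual by (auto simp: mon1_def)
    qed simp
  qed
  from choice[OF this] obtain n :: "nat \<Rightarrow> int" where
    n: "\<And>k. k < m \<Longrightarrow> null (mon (?e k) + mon (- ?e k) - 2 - of_int (n k) * pt)" by blast
  let ?as = "\<lambda>l. map ?e [0..<l] @ map (\<lambda>k. - ?e k) [0..<l]"
  have total: "null (list_class (?as l) - 2 * of_nat l - of_int (\<Sum>k<l. n k) * pt)" if "l \<le> m" for l
    using that
  proof (induction l)
    case 0 show ?case by (simp add: null_ideal(1))
  next
    case (Suc l)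
    then have "null (list_class (?as l) - 2 * of_nat l - of_int (\<Sum>k<l. n k) * pt)" by simp
    from null_ideal(5)[OF this n[of l]] show ?case using Suc.prems by (simp add: algebra_simps)
  qed
  define t where "t = (\<Sum>k<m. n k)"
  \<comment> \<open>The sign of \<open>t\<close> selects the correction: \<open>minus_pt\<close>
    against a positive total, \<open>plus_pt\<close> against a negative one. For
    \<open>t = 0\<close> no copy is added.\<close>
  define u where "u = (if t \<ge> 0 then ?e C - ?e Q else ?e C)"
  have u: "null (mon u + mon (- u) - 2 + of_int (sgn t) * pt)" if "t \<noteq> 0"
    using that plus_pt minus_pt by (auto simp: u_def sgn_if)
  obtain h where h: "int h = \<bar>t\<bar>" by (metis zero_le_imp_eq_int abs_ge_zero)
  have tpt: "of_nat h * (of_int (sgn t) * pt) = of_int t * pt"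
  proof -
    have "of_nat h * (of_int (sgn t) * pt) = of_int (int h * sgn t) * pt" by (simp add: mult.assoc)
    then show ?thesis by (simp add: h abs_mult_sgn)
  qed
  have "null (of_nat h * (mon u + mon (- u) - 2 + of_int (sgn t) * pt))"
    using u null_ideal(1,3) h by (cases "t = 0") auto
  from null_ideal(5)[OF total[of m] this]
  have "null (list_class (?as m) - 2 * of_nat m - of_int t * pt + of_nat h * (mon u + mon (- u) - 2 + of_int (sgn t) * pt))"
    by (simp only: t_def)
  moreover have "of_nat h * (mon u + mon (- u) - 2 + of_int (sgn t) * pt)
      = of_nat h * mon u + of_nat h * mon (- u) - of_nat h * 2 + of_int t * pt"
    by (simp only: distrib_left right_diff_distrib tpt)
  moreover have "list_class (replicate h u @ replicate h (- u)) = of_nat h * mon u + of_nat h * mon (- u)"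
    by (simp add: list_class_replicate)
  moreover have "list_class (replicate (2 * m + 2 * h) 0) = 2 * of_nat m + of_nat h * 2"
    by (simp add: list_class_replicate)
  ultimately have "null (list_class (?as m @ replicate h u @ replicate h (- u)) - list_class (replicate (2 * m + 2 * h) 0))"
    by (simp only: list_class_simps(3)) (simp add: algebra_simps)
  from null_list_classD[OF this] obtain k where
    k: "line_iso ((?as m @ replicate h u @ replicate h (- u)) @ replicate k 0) (replicate (2 * m + 2 * h) 0 @ replicate k 0)"
    by blast
  show ?thesis
    \<comment> \<open>The added line bundles: the duals of the \<open>theta\<close>,
      \<open>h\<close> copies of \<open>u\<close> and of its inverse, and the trivial summands left
      by cancellation.\<close>
    by (rule exI[of _ "map (\<lambda>k. - ?e k) [0..<m] @ replicate h u @ replicate h (- u) @ replicate k 0"],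
        rule exI[of _ "2 * m + 2 * h + k"])
       (use k in \<open>simp add: replicate_add\<close>)
qed

end

section \<open>Bundles with linear charts\<close>

lemma continuous_map_times:
  fixes f g :: "'a \<Rightarrow> 'b::real_normed_algebra"
  shows "continuous_map X euclidean f \<Longrightarrow> continuous_map X euclidean g \<Longrightarrow> continuous_map X euclidean (\<lambda>x. f x * g x)"
  by (simp add: continuous_map_atin tendsto_mult)

lemma continuous_map_scaleR:
  fixes g :: "'a \<Rightarrow> 'b::real_normed_vector"
  shows "continuous_map X euclidean f \<Longrightarrow> continuous_map X euclidean g \<Longrightarrow> continuous_map X euclidean (\<lambda>x. f x *\<^sub>R g x)"
  by (simp add: continuous_map_atin tendsto_scaleR)

lemma continuous_map_restrictI:
  "(\<And>i. i \<in> I \<Longrightarrow> continuous_map X (Y i) (\<lambda>x. f x i)) \<Longrightarrow>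
    continuous_map X (product_topology Y I) (\<lambda>x. restrict (f x) I)"
  by (auto simp: continuous_map_componentwise)

lemma continuous_map_compose_fun:
  "continuous_map X Y f \<Longrightarrow> continuous_map Y Z g \<Longrightarrow> continuous_map X Z (\<lambda>x. g (f x))"
  using continuous_map_compose[of X Y f Z g] by (simp add: o_def)

section \<open>Charts of the manifold and transition functions\<close>

context char_pair
begin

abbreviation "X \<equiv> qt_space M"

definition chart_base :: "nat set \<Rightarrow> (real^'n) set" where
  "chart_base J = {p \<in> P. facets_through M p \<subseteq> J}"

definition chart :: "nat set \<Rightarrow> 'n point_class set" where
  "chart J = qt_point M ` (chart_base J \<times> UNIV)"

lemma openin_chart_base: "openin (top_of_set P) (chart_base J)"
proof -
  have "closed (\<Union>i\<in>{..<m} - J. facet M i)" using closed_facet by (intro closed_UN) auto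
  moreover have "chart_base J = P \<inter> - (\<Union>i\<in>{..<m} - J. facet M i)"
    by (auto simp: chart_base_def facets_through_def)
  ultimately show ?thesis by (auto simp: openin_open open_Compl)
qed

lemma qt_point_in_chart: "p \<in> P \<Longrightarrow> qt_point M (p, t) \<in> chart J \<longleftrightarrow> p \<in> chart_base J"
  by (auto simp: chart_def qt_point_eq_iff)

lemma chart_subset: "chart J \<subseteq> topspace X"
  by (auto simp: chart_def topspace_qt chart_base_def)

lemma chart_preimage: "{x \<in> P \<times> UNIV. qt_point M x \<in> chart J} = chart_base J \<times> UNIV"
  by (auto simp: qt_point_in_chart chart_base_def)

lemma openin_chart: "openin X (chart J)"
proof -
  have "openin (top_of_set (P \<times> UNIV)) (chart_base J \<times> (UNIV :: (real^'n) set))"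
    using openin_chart_base openin_Times[of P "chart_base J" UNIV UNIV] by simp
  moreover have "{x \<in> topspace (top_of_set (P \<times> UNIV)). qt_point M x \<in> chart J} = chart_base J \<times> UNIV"
    unfolding topspace_euclidean_subtopology by (rule chart_preimage)
  moreover have "chart J \<subseteq> qt_point M ` topspace (top_of_set (P \<times> UNIV))"
    using chart_subset[of J] by (simp only: topspace_qt topspace_euclidean_subtopology)
  ultimately show ?thesis unfolding qt_space_def openin_quotient_of by simp
qed

lemma chart_cover: "x \<in> topspace X \<Longrightarrow> \<exists>J\<in>V. x \<in> chart J"
proof -
  assume "x \<in> topspace X"
  then obtain p t where p: "p \<in> P" "x = qt_point M (p, t)" by (auto simp: topspace_qt)
  obtain J where "J \<in> V" "facets_through M p \<subseteq> J" using exists_vertex_set[OF p(1)] .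
  then show ?thesis using p by (intro bexI[of _ J]) (simp_all add: qt_point_in_chart chart_base_def)
qed

text \<open>A quotient map restricts to the preimage of an open set. Continuity over a chart can
  therefore be tested on \<open>chart_base J \<times> UNIV\<close>.\<close>

lemma quotient_map_chart:
  "quotient_map (top_of_set (chart_base J \<times> UNIV)) (subtopology X (chart J)) (qt_point M)"
proof -
  have "quotient_map (subtopology (top_of_set (P \<times> UNIV)) (chart_base J \<times> UNIV)) (subtopology X (chart J)) (qt_point M)"
    unfolding qt_space_def
    by (rule quotient_map_restriction[OF quotient_map_quotient_of])
      (use chart_preimage[of J] openin_chart[of J] in \<open>simp_all only: qt_space_def topspace_euclidean_subtopology simp_thms\<close>)
  moreover have "chart_base J \<times> UNIV \<subseteq> P \<times> (UNIV :: (real^'n) set)" by (auto simp: chart_base_def)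
  ultimately show ?thesis by (simp add: subtopology_subtopology inf.absorb2)
qed

text \<open>An arbitrary choice without any continuity. Formulas built on it are first shown not to
  depend on the choice, and only then seen to be continuous through
  \<open>quotient_map_chart\<close>.\<close>

definition rep :: "'n point_class \<Rightarrow> (real^'n) \<times> (real^'n)" where
  "rep x = (SOME y. y \<in> P \<times> UNIV \<and> qt_point M y = x)"

lemma rep:
  assumes "x \<in> chart J" obtains p t where "rep x = (p, t)" "p \<in> chart_base J" "qt_point M (p, t) = x"
proof -
  have "x \<in> topspace X" using chart_subset assms by (rule subsetD)
  then obtain p0 t0 where "p0 \<in> P" "x = qt_point M (p0, t0)" by (auto simp: topspace_qt)
  then have "\<exists>y. y \<in> P \<times> UNIV \<and> qt_point M y = x" by (intro exI[of _ "(p0, t0)"]) simp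
  from someI_ex[OF this, folded rep_def] have r: "rep x \<in> P \<times> UNIV" "qt_point M (rep x) = x" by simp_all
  obtain p t where pt: "rep x = (p, t)" by (cases "rep x")
  then have "p \<in> P" "qt_point M (p, t) = x" using r by simp_all
  then have "p \<in> chart_base J" using assms qt_point_in_chart[of p t J] by simp
  then show thesis using pt \<open>qt_point M (p, t) = x\<close> by (intro that)
qed

definition loc :: "((real^'n) \<times> (nat \<Rightarrow> real) \<Rightarrow> complex) \<Rightarrow> nat set \<Rightarrow> 'n point_class \<Rightarrow> complex" where
  "loc f J x = f (fst (rep x), lift J (snd (rep x)))"

text \<open>The lifts belonging to two vertices differ by an element of the kernel of
  \<open>torus_map M\<close>; its phase under the character \<open>w\<close> is the transition
  function.\<close>

definition trans :: "weight \<Rightarrow> nat set \<Rightarrow> nat set \<Rightarrow> 'n point_class \<Rightarrow> complex" where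
  "trans w J J' x = cis (2 * pi * pairing w (\<lambda>i. lift J' (snd (rep x)) i - lift J (snd (rep x)) i))"

lemma trans_uminus: "trans (- w) J J' x * trans w J J' x = 1"
  by (simp add: trans_def pairing_uminus cis_mult)

text \<open>Independence of the representative: by \<open>lift_stabilizer\<close> the lifts differ
  by collapsed coordinates, which \<open>f\<close> ignores, and by integers, whose phase is
  1.\<close>

lemma loc_qt_point:
  assumes f: "equi w f" and J: "J \<in> V" and p: "p \<in> chart_base J"
  shows "loc f J (qt_point M (p, t)) = f (p, lift J t)"
proof -
  have pP: "p \<in> P" "facets_through M p \<subseteq> J" using p by (auto simp: chart_base_def)
  have "qt_point M (p, t) \<in> chart J" using p pP qt_point_in_chart by blast
  then obtain p' t' where r: "rep (qt_point M (p, t)) = (p', t')" "qt_point M (p', t') = qt_point M (p, t)"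
    by (rule rep)
  then have p': "p' = p" "t' - t \<in> stabilizer_lift M p" by (auto simp: qt_point_eq_iff)
  obtain \<kappa> c where \<kappa>: "\<And>i. i < m \<Longrightarrow> \<kappa> i \<in> \<int>" "\<And>i. i < m \<Longrightarrow> p \<notin> facet M i \<Longrightarrow> c i = 0"
      "\<And>i. i < m \<Longrightarrow> lift J (t' - t) i = \<kappa> i + c i" by (rule lift_stabilizer[OF J pP(2) p'(2)]) blast
  have "f (p, lift J t') = cis (2 * pi * pairing w \<kappa>) * f (p, lift J t)"
  proof (rule equi_shift[OF f pP(1) torus_map_int[OF \<kappa>(1)] \<kappa>(2)])
    show "lift J t' i = lift J t i + \<kappa> i + c i" if "i < m" for i
      using \<kappa>(3)[OF that] lift_diff[OF that, of J t' t] by simp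
  qed
  then show ?thesis using cis_pairing_int[OF pairing_int[OF \<kappa>(1)]] by (simp add: loc_def r p')
qed

lemma continuous_loc:
  assumes f: "equi w f" and J: "J \<in> V" shows "continuous_map (subtopology X (chart J)) euclidean (loc f J)"
proof (rule continuous_compose_quotient_map[OF quotient_map_chart])
  have "continuous_on (chart_base J \<times> UNIV) (\<lambda>x. f (fst x, lift J (snd x)))"
    by (rule continuous_on_subset[OF equi_continuous[OF f J]]) (auto simp: chart_base_def)
  then have "continuous_map (top_of_set (chart_base J \<times> UNIV)) euclidean (\<lambda>x. f (fst x, lift J (snd x)))"
    by simp
  then show "continuous_map (top_of_set (chart_base J \<times> UNIV)) euclidean (loc f J \<circ> qt_point M)"
    by (rule continuous_map_eq) (use loc_qt_point[OF f J] in auto)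
qed

lemma equi_change_chart:
  assumes "equi w f" "J \<in> V" "J' \<in> V" "p \<in> P"
  shows "f (p, lift J' t) = cis (2 * pi * pairing w (\<lambda>i. lift J' t i - lift J t i)) * f (p, lift J t)"
proof (rule equi_shift[OF assms(1,4), where c = "\<lambda>_. 0"])
  have "torus_map M (\<lambda>i. lift J' t i - lift J t i) = real_vec 0"
    using assms by (simp add: torus_map_diff torus_map_lift)
  then show "torus_map M (\<lambda>i. lift J' t i - lift J t i) \<in> range real_vec" by blast
qed simp_all

lemma loc_trans:
  assumes "equi w f" "J \<in> V" "J' \<in> V" "x \<in> chart J"
  shows "loc f J' x = trans w J J' x * loc f J x"
proof -
  obtain p t where "rep x = (p, t)" "p \<in> chart_base J" using rep assms(4) by metis
  then show ?thesis using equi_change_chart[OF assms(1-3)] by (simp add: loc_def trans_def chart_base_def)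
qed

text \<open>Obtained by dividing by a section of weight \<open>w\<close> without zeros over the
  chart: its local expressions in both charts are already known to be independent of
  \<open>rep\<close>.\<close>

lemma trans_qt_point:
  assumes J: "J \<in> V" "J' \<in> V" and p: "p \<in> chart_base J" "p \<in> chart_base J'"
  shows "trans w J J' (qt_point M (p, t)) = cis (2 * pi * pairing w (\<lambda>i. lift J' t i - lift J t i))"
proof -
  obtain f where f: "equi w f" "\<And>p s. facets_through M p \<subseteq> J \<Longrightarrow> f (p, s) \<noteq> 0"
    using section_chart[OF J(1)] by blast
  let ?x = "qt_point M (p, t)"
  have pP: "p \<in> P" "facets_through M p \<subseteq> J" using p by (auto simp: chart_base_def)
  have "?x \<in> chart J" using qt_point_in_chart p pP by blast
  then have "loc f J' ?x = trans w J J' ?x * loc f J ?x" by (rule loc_trans[OF f(1) J])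
  then have "f (p, lift J' t) = trans w J J' ?x * f (p, lift J t)"
    using loc_qt_point[OF f(1) J(1) p(1)] loc_qt_point[OF f(1) J(2) p(2)] by simp
  then show ?thesis using equi_change_chart[OF f(1) J pP(1), of t] f(2)[OF pP(2)] by simp
qed

definition pick :: "'n point_class \<Rightarrow> nat set" where
  "pick x = (SOME J. J \<in> V \<and> x \<in> chart J)"

lemma pick: "x \<in> topspace X \<Longrightarrow> pick x \<in> V" "x \<in> topspace X \<Longrightarrow> x \<in> chart (pick x)"
proof -
  assume "x \<in> topspace X"
  then have "\<exists>J. J \<in> V \<and> x \<in> chart J" using chart_cover by blast
  from someI_ex[OF this, folded pick_def] show "pick x \<in> V" "x \<in> chart (pick x)" by blast+
qed

lemma continuous_map_charts:
  assumes p: "continuous_map T X p"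
    and c: "\<And>J. J \<in> V \<Longrightarrow> continuous_map (subtopology T {e. p e \<in> chart J}) Y (f J)"
    and eq: "\<And>J e. J \<in> V \<Longrightarrow> e \<in> topspace T \<Longrightarrow> p e \<in> chart J \<Longrightarrow> f J e = g e"
  shows "continuous_map T Y g"
proof (rule pasting_lemma[where I = V and T = "\<lambda>J. {e \<in> topspace T. p e \<in> chart J}" and f = f])
  show "openin T {e \<in> topspace T. p e \<in> chart J}" for J
    by (rule openin_continuous_map_preimage[OF p openin_chart])
  show "continuous_map (subtopology T {e \<in> topspace T. p e \<in> chart J}) Y (f J)" if "J \<in> V" for J
  proof -
    have "{e \<in> topspace T. p e \<in> chart J} = topspace T \<inter> {e. p e \<in> chart J}" by blast
    then show ?thesis using c[OF that] by (simp only: subtopology_restrict)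
  qed
  show "f i x = f j x" if "i \<in> V" "j \<in> V"
    "x \<in> topspace T \<inter> {e \<in> topspace T. p e \<in> chart i} \<inter> {e \<in> topspace T. p e \<in> chart j}" for i j x
    using that eq[of i x] eq[of j x] by simp
  show "\<exists>j. j \<in> V \<and> x \<in> {e \<in> topspace T. p e \<in> chart j} \<and> g x = f j x" if "x \<in> topspace T" for x
  proof -
    have "p x \<in> topspace X" using p that by (meson continuous_map_image_subset_topspace image_subset_iff)
    then obtain J where "J \<in> V" "p x \<in> chart J" using chart_cover by blast
    then show ?thesis using eq[of J x] that by auto
  qed
qed

end

text \<open>A bundle with linear trivialisations \<open>\<tau> J\<close> over the charts, with inverses \<open>E J\<close>, whose transition
  functions are those of the sum of the line bundles with weights \<open>ws\<close>.\<close>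

locale chart_bundle = char_pair M for M :: "'n::finite quasitoric" +
  fixes ws :: "weight list" and \<xi> :: "('n point_class, 'e) cbundle"
    and \<tau> :: "nat set \<Rightarrow> 'e \<Rightarrow> nat \<Rightarrow> complex"
    and E :: "nat set \<Rightarrow> 'n point_class \<Rightarrow> (nat \<Rightarrow> complex) \<Rightarrow> 'e"
  assumes proj_cont: "continuous_map (total \<xi>) (qt_space M) (proj \<xi>)"
    and scale_in: "e \<in> topspace (total \<xi>) \<Longrightarrow> vscale \<xi> c e \<in> topspace (total \<xi>) \<and> proj \<xi> (vscale \<xi> c e) = proj \<xi> e"
    and add_in: "e \<in> topspace (total \<xi>) \<Longrightarrow> e' \<in> topspace (total \<xi>) \<Longrightarrow> proj \<xi> e' = proj \<xi> e \<Longrightarrow>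
       vadd \<xi> e e' \<in> topspace (total \<xi>) \<and> proj \<xi> (vadd \<xi> e e') = proj \<xi> e"
    and tau_cont: "J \<in> vertex_sets M \<Longrightarrow> i < length ws \<Longrightarrow>
       continuous_map (subtopology (total \<xi>) {e. proj \<xi> e \<in> chart J}) euclidean (\<lambda>e. \<tau> J e i)"
    and E_cont: "J \<in> vertex_sets M \<Longrightarrow>
       continuous_map (prod_topology (subtopology (qt_space M) (chart J)) (product_topology (\<lambda>_. euclidean) {..<length ws}))
         (total \<xi>) (\<lambda>y. E J (fst y) (snd y))"
    and proj_E: "J \<in> vertex_sets M \<Longrightarrow> x \<in> chart J \<Longrightarrow> z \<in> extensional {..<length ws} \<Longrightarrow> proj \<xi> (E J x z) = x"
    and tau_E: "J \<in> vertex_sets M \<Longrightarrow> x \<in> chart J \<Longrightarrow> z \<in> extensional {..<length ws} \<Longrightarrow> i < length ws \<Longrightarrow>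
       \<tau> J (E J x z) i = z i"
    and E_tau: "J \<in> vertex_sets M \<Longrightarrow> e \<in> topspace (total \<xi>) \<Longrightarrow> proj \<xi> e \<in> chart J \<Longrightarrow>
       E J (proj \<xi> e) (restrict (\<tau> J e) {..<length ws}) = e"
    and tau_scale: "J \<in> vertex_sets M \<Longrightarrow> e \<in> topspace (total \<xi>) \<Longrightarrow> proj \<xi> e \<in> chart J \<Longrightarrow> i < length ws \<Longrightarrow>
       \<tau> J (vscale \<xi> c e) i = c * \<tau> J e i"
    and tau_add: "J \<in> vertex_sets M \<Longrightarrow> e \<in> topspace (total \<xi>) \<Longrightarrow> e' \<in> topspace (total \<xi>) \<Longrightarrow>
       proj \<xi> e \<in> chart J \<Longrightarrow> proj \<xi> e' = proj \<xi> e \<Longrightarrow> i < length ws \<Longrightarrow>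
       \<tau> J (vadd \<xi> e e') i = \<tau> J e i + \<tau> J e' i"
    and tau_trans: "J \<in> vertex_sets M \<Longrightarrow> J' \<in> vertex_sets M \<Longrightarrow> e \<in> topspace (total \<xi>) \<Longrightarrow>
       proj \<xi> e \<in> chart J \<Longrightarrow> proj \<xi> e \<in> chart J' \<Longrightarrow> i < length ws \<Longrightarrow>
       \<tau> J' e i = trans (ws ! i) J J' (proj \<xi> e) * \<tau> J e i"
begin

abbreviation "r \<equiv> length ws"

lemma proj_in: "e \<in> topspace (total \<xi>) \<Longrightarrow> proj \<xi> e \<in> topspace X"
  using proj_cont by (meson continuous_map_image_subset_topspace image_subset_iff)

lemma E_in:
  assumes "J \<in> V" "x \<in> chart J" "z \<in> extensional {..<r}" shows "E J x z \<in> topspace (total \<xi>)"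
proof -
  have xz: "(x, z) \<in> topspace (prod_topology (subtopology X (chart J)) (product_topology (\<lambda>_. euclidean) {..<r}))"
    using assms chart_subset[of J] by (auto simp: PiE_iff)
  show ?thesis
    using subsetD[OF continuous_map_image_subset_topspace[OF E_cont[OF assms(1)]] imageI[OF xz]] by simp
qed

lemma topspace_chart_product:
  "y \<in> topspace (prod_topology (subtopology X (chart J)) (product_topology (\<lambda>_. euclidean :: complex topology) {..<n}))
    \<longleftrightarrow> fst y \<in> chart J \<and> snd y \<in> extensional {..<n}"
  using chart_subset[of J] by (cases y) (auto simp: PiE_iff)

lemma chart_iso:
  assumes J: "J \<in> V"
  shows "bundle_iso (restrict_bundle \<xi> (chart J)) (trivial_bundle (subtopology X (chart J)) r)"
proof -
  let ?T = "subtopology (total \<xi>) {e. proj \<xi> e \<in> chart J}"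
  let ?B = "prod_topology (subtopology X (chart J)) (product_topology (\<lambda>_. euclidean :: complex topology) {..<r})"
  let ?h = "\<lambda>e. (proj \<xi> e, restrict (\<tau> J e) {..<r})"
  have "homeomorphic_maps ?T ?B ?h (\<lambda>y. E J (fst y) (snd y))"
    unfolding homeomorphic_maps_def
  proof (intro conjI ballI)
    show "continuous_map ?T ?B ?h"
      by (intro continuous_map_pairedI continuous_map_into_subtopology continuous_map_from_subtopology
          proj_cont continuous_map_restrictI tau_cont J) auto
    show "continuous_map ?B ?T (\<lambda>y. E J (fst y) (snd y))"
    proof (rule continuous_map_into_subtopology[OF E_cont[OF J]], rule funcsetI)
      fix y assume "y \<in> topspace ?B"
      then have "fst y \<in> chart J" "snd y \<in> extensional {..<r}" unfolding topspace_chart_product by simp_all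
      then show "E J (fst y) (snd y) \<in> {e. proj \<xi> e \<in> chart J}" using proj_E[OF J] by simp
    qed
    show "E J (fst (?h e)) (snd (?h e)) = e" if "e \<in> topspace ?T" for e
      using that E_tau[OF J] by simp
    show "?h (E J (fst y) (snd y)) = y" if "y \<in> topspace ?B" for y
    proof -
      obtain x z where y: "y = (x, z)" by (cases y)
      have "x \<in> chart J" "z \<in> extensional {..<r}" using that unfolding topspace_chart_product y by simp_all
      note y = y this
      then have "restrict (\<tau> J (E J x z)) {..<r} = z" using tau_E[OF J] by (intro extensionalityI[of _ "{..<r}"]) auto
      then show ?thesis using y proj_E[OF J] by simp
    qed
  qed
  then have h: "homeomorphic_map ?T ?B ?h" by (auto simp: homeomorphic_map_maps)
  show ?thesis unfolding bundle_iso_def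
    by (rule exI[of _ ?h])
      (use h scale_in add_in tau_scale[OF J] tau_add[OF J] in
        \<open>auto simp: restrict_bundle_def trivial_bundle_def fun_eq_iff\<close>)
qed

lemma vector_bundle: "complex_vector_bundle X r \<xi>"
  unfolding complex_vector_bundle_def
  using proj_cont scale_in add_in chart_cover chart_iso openin_chart by meson

text \<open>The entries of \<open>F\<close> carry the weights inverse to those of the transition
  functions, so applying \<open>F\<close> to chart coordinates gives maps into
  \<open>\<complex>\<^sup>N\<close> that agree on overlaps; \<open>G\<close> glues to the inverse in
  the same way.\<close>

lemma trivialisation:
  assumes "line_iso ws (replicate N 0)"
  shows "bundle_iso \<xi> (trivial_bundle X N)"
proof -
  let ?B = "prod_topology X (product_topology (\<lambda>_. euclidean :: complex topology) {..<N})"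
  obtain F G where FG: "equi_mat ws (replicate N 0) F" "equi_mat (replicate N 0) ws G"
    "inverse_on r N F G" "inverse_on N r G F"
    using assms unfolding line_iso_def by auto
  have F: "equi (- (ws ! l)) (F i l)" if "i < N" "l < r" for i l
    using FG(1) that by (simp add: equi_mat_def)
  have G: "equi (ws ! l) (G l i)" if "i < N" "l < r" for i l
    using FG(2) that by (simp add: equi_mat_def)
  define hz where "hz J x t = (\<lambda>i\<in>{..<N}. \<Sum>l<r. loc (F i l) J x * t l)" for J x t
  define kz where "kz J x z = (\<lambda>l\<in>{..<r}. \<Sum>i<N. loc (G l i) J x * z i)" for J x z
  have hk: "hz J x (kz J x z) = z" if "J \<in> V" "x \<in> chart J" "z \<in> extensional {..<N}" for J x z
  proof (rule extensionalityI[of _ "{..<N}"])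
    obtain p t where pt: "p \<in> chart_base J" "x = qt_point M (p, t)" using rep[OF \<open>x \<in> chart J\<close>] by metis
    have pP: "p \<in> P" using pt by (simp add: chart_base_def)
    fix i assume i: "i \<in> {..<N}"
    have "hz J x (kz J x z) i = app F (p, lift J t) r (app G (p, lift J t) N z) i"
      using i F G unfolding app_def hz_def kz_def pt(2)
      by (simp add: loc_qt_point[OF F \<open>J \<in> V\<close> pt(1)] loc_qt_point[OF G \<open>J \<in> V\<close> pt(1)])
    then show "hz J x (kz J x z) i = z i" using FG(3) pP i by (simp add: inverse_on_def)
  qed (use that in \<open>auto simp: hz_def\<close>)
  have kh: "kz J x (hz J x t) = restrict t {..<r}" if "J \<in> V" "x \<in> chart J" for J x t
  proof (rule extensionalityI[of _ "{..<r}"])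
    obtain p u where pt: "p \<in> chart_base J" "x = qt_point M (p, u)" using rep[OF \<open>x \<in> chart J\<close>] by metis
    have pP: "p \<in> P" using pt by (simp add: chart_base_def)
    fix l assume l: "l \<in> {..<r}"
    have "kz J x (hz J x t) l = app G (p, lift J u) N (app F (p, lift J u) r t) l"
      using l F G unfolding app_def hz_def kz_def pt(2)
      by (simp add: loc_qt_point[OF F \<open>J \<in> V\<close> pt(1)] loc_qt_point[OF G \<open>J \<in> V\<close> pt(1)])
    then show "kz J x (hz J x t) l = restrict t {..<r} l" using FG(4) pP l by (simp add: inverse_on_def)
  qed (auto simp: kz_def)
  have h_indep: "hz J (proj \<xi> e) (\<tau> J e) = hz J' (proj \<xi> e) (\<tau> J' e)"
    if "J \<in> V" "J' \<in> V" "e \<in> topspace (total \<xi>)" "proj \<xi> e \<in> chart J" "proj \<xi> e \<in> chart J'" for J J' e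
  proof -
    let ?x = "proj \<xi> e"
    have "loc (F i l) J' ?x * \<tau> J' e l = loc (F i l) J ?x * \<tau> J e l" if "i < N" "l < r" for i l
    proof -
      have "loc (F i l) J' ?x * \<tau> J' e l
          = (trans (- (ws ! l)) J J' ?x * trans (ws ! l) J J' ?x) * (loc (F i l) J ?x * \<tau> J e l)"
        using loc_trans[OF F[OF that] \<open>J \<in> V\<close> \<open>J' \<in> V\<close> \<open>?x \<in> chart J\<close>]
          tau_trans[OF \<open>J \<in> V\<close> \<open>J' \<in> V\<close> \<open>e \<in> topspace (total \<xi>)\<close> \<open>?x \<in> chart J\<close> \<open>?x \<in> chart J'\<close> \<open>l < r\<close>]
        by (simp add: mult_ac)
      then show ?thesis by (simp add: trans_uminus)
    qed
    then show ?thesis unfolding hz_def by (intro restrict_ext sum.cong) auto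
  qed
  have k_indep: "E J x (kz J x z) = E J' x (kz J' x z)"
    if "J \<in> V" "J' \<in> V" "x \<in> chart J" "x \<in> chart J'" for J J' x z
  proof -
    let ?e = "E J x (kz J x z)"
    have kext: "kz J x z \<in> extensional {..<r}" by (simp add: kz_def)
    have e: "?e \<in> topspace (total \<xi>)" "proj \<xi> ?e = x" using E_in proj_E kext that by blast+
    have "restrict (\<tau> J' ?e) {..<r} = kz J' x z"
    proof (rule extensionalityI[of _ "{..<r}"])
      fix l assume l: "l \<in> {..<r}"
      have "\<tau> J' ?e l = trans (ws ! l) J J' x * \<tau> J ?e l"
        using tau_trans[of J J' ?e l] that e l by simp
      also have "\<dots> = trans (ws ! l) J J' x * kz J x z l" using tau_E[OF that(1,3) kext] l by simp
      also have "\<dots> = (\<Sum>i<N. trans (ws ! l) J J' x * loc (G l i) J x * z i)"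
        using l by (simp add: kz_def sum_distrib_left mult.assoc)
      also have "\<dots> = (\<Sum>i<N. loc (G l i) J' x * z i)"
        using l loc_trans[OF G that(1,2,3)] by (intro sum.cong) auto
      finally show "restrict (\<tau> J' ?e) {..<r} l = kz J' x z l" using l by (simp add: kz_def)
    qed (auto simp: kz_def)
    then show ?thesis using E_tau[of J' ?e] that e by simp
  qed
  \<comment> \<open>The chart is picked pointwise without continuity; \<open>h_indep\<close> and
    \<open>k_indep\<close> allow replacing it by a fixed one, and continuity then follows by
    pasting.\<close>
  define h where "h e = (proj \<xi> e, hz (pick (proj \<xi> e)) (proj \<xi> e) (\<tau> (pick (proj \<xi> e)) e))" for e
  define k where "k y = E (pick (fst y)) (fst y) (kz (pick (fst y)) (fst y) (snd y))" for y
  have h: "h e = (proj \<xi> e, hz J (proj \<xi> e) (\<tau> J e))"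
    if "J \<in> V" "e \<in> topspace (total \<xi>)" "proj \<xi> e \<in> chart J" for J e
    unfolding h_def using h_indep[OF pick(1) that(1,2) pick(2) that(3)] proj_in[OF that(2)] by simp
  have k: "k (x, z) = E J x (kz J x z)" if "J \<in> V" "x \<in> chart J" for J x z
  proof -
    have "x \<in> topspace X" using that chart_subset by blast
    then show ?thesis unfolding k_def using k_indep[OF pick(1) that(1) pick(2) that(2)] by simp
  qed
  have "homeomorphic_maps (total \<xi>) ?B h k"
    unfolding homeomorphic_maps_def
  proof (intro conjI ballI)
    show "continuous_map (total \<xi>) ?B h"
    proof (rule continuous_map_charts[OF proj_cont, where f = "\<lambda>J e. (proj \<xi> e, hz J (proj \<xi> e) (\<tau> J e))"])
      fix J assume J: "J \<in> V"
      have "continuous_map (subtopology (total \<xi>) {e. proj \<xi> e \<in> chart J}) (subtopology X (chart J)) (proj \<xi>)"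
        by (intro continuous_map_into_subtopology continuous_map_from_subtopology proj_cont) auto
      then show "continuous_map (subtopology (total \<xi>) {e. proj \<xi> e \<in> chart J}) ?B (\<lambda>e. (proj \<xi> e, hz J (proj \<xi> e) (\<tau> J e)))"
        unfolding hz_def
        by (intro continuous_map_pairedI continuous_map_from_subtopology[OF proj_cont] continuous_map_restrictI
            continuous_map_sum continuous_map_times tau_cont J continuous_map_compose_fun[OF _ continuous_loc[OF F J]]) auto
    qed (use h in auto)
    show "continuous_map ?B (total \<xi>) k"
    proof (rule continuous_map_charts[OF continuous_map_fst, where f = "\<lambda>J y. E J (fst y) (kz J (fst y) (snd y))"])
      fix J assume J: "J \<in> V"
      let ?S = "subtopology ?B {y. fst y \<in> chart J}"
      have f: "continuous_map ?S (subtopology X (chart J)) fst"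
        by (intro continuous_map_into_subtopology continuous_map_from_subtopology continuous_map_fst) auto
      have s: "continuous_map ?S euclidean (\<lambda>y. snd y i)" if "i < N" for i
        by (rule continuous_map_from_subtopology,
            rule continuous_map_compose_fun[OF continuous_map_snd continuous_map_product_projection]) (use that in simp)
      have "continuous_map ?S (prod_topology (subtopology X (chart J)) (product_topology (\<lambda>_. euclidean) {..<r}))
          (\<lambda>y. (fst y, kz J (fst y) (snd y)))"
        unfolding kz_def
        by (intro continuous_map_pairedI f continuous_map_restrictI continuous_map_sum continuous_map_times
            continuous_map_compose_fun[OF f continuous_loc[OF G J]] s) auto
      from continuous_map_compose_fun[OF this E_cont[OF J]]
      show "continuous_map ?S (total \<xi>) (\<lambda>y. E J (fst y) (kz J (fst y) (snd y)))" by simp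
    next
      fix J and y :: "'n point_class \<times> (nat \<Rightarrow> complex)"
      assume "J \<in> V" "fst y \<in> chart J"
      then show "E J (fst y) (kz J (fst y) (snd y)) = k y" using k[of J "fst y" "snd y"] by simp
    qed
    show "k (h e) = e" if e: "e \<in> topspace (total \<xi>)" for e
    proof -
      obtain J where J: "J \<in> V" "proj \<xi> e \<in> chart J" using chart_cover proj_in[OF e] by blast
      then show ?thesis using h[OF J(1) e J(2)] k[OF J] kh[OF J] E_tau[OF J(1) e J(2)] by simp
    qed
    show "h (k y) = y" if y: "y \<in> topspace ?B" for y
    proof -
      obtain x z where xz: "y = (x, z)" "x \<in> topspace X" "z \<in> extensional {..<N}" using y by (auto simp: PiE_iff)
      obtain J where J: "J \<in> V" "x \<in> chart J" using chart_cover xz by blast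
      let ?e = "E J x (kz J x z)"
      have kext: "kz J x z \<in> extensional {..<r}" by (simp add: kz_def)
      have e: "?e \<in> topspace (total \<xi>)" "proj \<xi> ?e = x" using E_in proj_E kext J by blast+
      have "hz J x (\<tau> J ?e) = hz J x (kz J x z)"
        unfolding hz_def using tau_E[OF J kext] by (intro restrict_ext sum.cong) auto
      then show ?thesis using h[of J ?e] J e k[OF J] hk[OF J xz(3)] xz by simp
    qed
  qed
  then have hm: "homeomorphic_map (total \<xi>) ?B h" by (auto simp: homeomorphic_map_maps)
  have hs: "h (vscale \<xi> c e) = (proj \<xi> e, \<lambda>i\<in>{..<N}. c * snd (h e) i)" if e: "e \<in> topspace (total \<xi>)" for e c
  proof -
    obtain J where J: "J \<in> V" "proj \<xi> e \<in> chart J" using chart_cover proj_in[OF e] by blast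
    have "hz J (proj \<xi> e) (\<tau> J (vscale \<xi> c e)) = (\<lambda>i\<in>{..<N}. c * hz J (proj \<xi> e) (\<tau> J e) i)"
      unfolding hz_def using tau_scale[OF J(1) e J(2)]
      by (intro restrict_ext) (simp add: sum_distrib_left mult_ac)
    then show ?thesis using h[of J e] h[of J "vscale \<xi> c e"] scale_in[OF e] J e by simp
  qed
  have ha: "h (vadd \<xi> e e') = (proj \<xi> e, \<lambda>i\<in>{..<N}. snd (h e) i + snd (h e') i)"
    if e: "e \<in> topspace (total \<xi>)" "e' \<in> topspace (total \<xi>)" "proj \<xi> e' = proj \<xi> e" for e e'
  proof -
    obtain J where J: "J \<in> V" "proj \<xi> e \<in> chart J" using chart_cover proj_in[OF e(1)] by blast
    have "hz J (proj \<xi> e) (\<tau> J (vadd \<xi> e e')) = (\<lambda>i\<in>{..<N}. hz J (proj \<xi> e) (\<tau> J e) i + hz J (proj \<xi> e) (\<tau> J e') i)"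
      unfolding hz_def using tau_add[OF J(1) e(1,2) J(2) e(3)]
      by (intro restrict_ext) (simp add: sum.distrib[symmetric] distrib_left)
    then show ?thesis using h[of J e] h[of J e'] h[of J "vadd \<xi> e e'"] add_in[OF e] J e by simp
  qed
  have fh: "fst (h e) = proj \<xi> e" for e by (simp add: h_def)
  show ?thesis unfolding bundle_iso_def
    by (rule exI[of _ h])
      (use hm hs ha fh in \<open>auto simp: trivial_bundle_def case_prod_beta\<close>)
qed

end

lemma (in chart_bundle) continuous_tau:
  assumes "J \<in> V" "i < r" "continuous_map Y (total \<xi>) g" "\<And>y. y \<in> topspace Y \<Longrightarrow> proj \<xi> (g y) \<in> chart J"
  shows "continuous_map Y euclidean (\<lambda>y. \<tau> J (g y) i)"
proof (rule continuous_map_compose_fun[OF _ tau_cont[OF assms(1,2)]])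
  show "continuous_map Y (subtopology (total \<xi>) {e. proj \<xi> e \<in> chart J}) g"
    using assms by (intro continuous_map_into_subtopology) auto
qed

lemma (in chart_bundle) continuous_E:
  assumes "J \<in> V" "continuous_map Y (subtopology X (chart J)) f" "\<And>i. i < r \<Longrightarrow> continuous_map Y euclidean (\<lambda>y. g y i)"
  shows "continuous_map Y (total \<xi>) (\<lambda>y. E J (f y) (restrict (g y) {..<r}))"
proof -
  have "continuous_map Y (prod_topology (subtopology X (chart J)) (product_topology (\<lambda>_. euclidean) {..<r}))
      (\<lambda>y. (f y, restrict (g y) {..<r}))"
    using assms by (intro continuous_map_pairedI continuous_map_restrictI) auto
  from continuous_map_compose_fun[OF this E_cont[OF assms(1)]] show ?thesis by simp
qed

section \<open>Whitney sums and relabelling of bundles with charts\<close>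

context char_pair
begin

lemma continuous_map_chart_coord:
  "i < n \<Longrightarrow> continuous_map (prod_topology (subtopology X (chart J)) (product_topology (\<lambda>_. euclidean :: complex topology) {..<n}))
     euclidean (\<lambda>y. snd y i)"
  by (rule continuous_map_compose_fun[OF continuous_map_snd continuous_map_product_projection]) simp

lemma chart_bundle_whitney_sum:
  assumes A: "chart_bundle M ws \<xi> \<tau> E" and B: "chart_bundle M vs \<eta> \<sigma> D"
  shows "chart_bundle M (ws @ vs) (whitney_sum \<xi> \<eta>)
    (\<lambda>J e i. if i < length ws then \<tau> J (fst e) i else \<sigma> J (snd e) (i - length ws))
    (\<lambda>J x z. (E J x (restrict z {..<length ws}), D J x (restrict (\<lambda>i. z (length ws + i)) {..<length vs})))"
proof -
  interpret A: chart_bundle M ws \<xi> \<tau> E by (rule A)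
  interpret B: chart_bundle M vs \<eta> \<sigma> D by (rule B)
  let ?S = "whitney_sum \<xi> \<eta>"
  have tot: "total ?S = subtopology (prod_topology (total \<xi>) (total \<eta>)) {(e, f). proj \<xi> e = proj \<eta> f}"
    by (simp add: whitney_sum_def)
  have top: "e \<in> topspace (total ?S) \<longleftrightarrow>
      fst e \<in> topspace (total \<xi>) \<and> snd e \<in> topspace (total \<eta>) \<and> proj \<xi> (fst e) = proj \<eta> (snd e)" for e
    by (cases e) (auto simp: tot)
  have pr: "proj ?S e = proj \<xi> (fst e)" for e
    by (simp add: whitney_sum_def case_prod_beta)
  have sc: "vscale ?S c e = (vscale \<xi> c (fst e), vscale \<eta> c (snd e))" for c e
    by (simp add: whitney_sum_def case_prod_beta)
  have ad: "vadd ?S e e' = (vadd \<xi> (fst e) (fst e'), vadd \<eta> (snd e) (snd e'))" for e e'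
    by (simp add: whitney_sum_def case_prod_beta)
  have c1: "continuous_map (total ?S) (total \<xi>) fst"
    unfolding tot by (intro continuous_map_from_subtopology continuous_map_fst)
  have c2: "continuous_map (total ?S) (total \<eta>) snd"
    unfolding tot by (intro continuous_map_from_subtopology continuous_map_snd)
  show ?thesis
  proof (unfold_locales, goal_cases)
    case 1
    show ?case unfolding pr by (rule continuous_map_compose_fun[OF c1 A.proj_cont])
  next
    case (2 e c)
    then show ?case using A.scale_in B.scale_in by (simp add: top pr sc)
  next
    case (3 e e')
    then show ?case using A.add_in B.add_in by (simp add: top pr ad)
  next
    case (4 J i)
    show ?case
    proof (cases "i < length ws")
      case True
      have "continuous_map (subtopology (total ?S) {e. proj ?S e \<in> chart J}) euclidean (\<lambda>e. \<tau> J (fst e) i)"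
        by (rule A.continuous_tau[OF 4(1) True continuous_map_from_subtopology[OF c1]]) (simp add: pr)
      then show ?thesis using True by simp
    next
      case False
      then have i: "i - length ws < length vs" using 4 by simp
      have "continuous_map (subtopology (total ?S) {e. proj ?S e \<in> chart J}) euclidean (\<lambda>e. \<sigma> J (snd e) (i - length ws))"
        by (rule B.continuous_tau[OF 4(1) i continuous_map_from_subtopology[OF c2]]) (auto simp: top pr)
      then show ?thesis using False by simp
    qed
  next
    case (5 J)
    let ?Y = "prod_topology (subtopology X (chart J)) (product_topology (\<lambda>_. euclidean :: complex topology) {..<length (ws @ vs)})"
    have "continuous_map ?Y (total \<xi>) (\<lambda>y. E J (fst y) (restrict (snd y) {..<length ws}))"
      by (intro A.continuous_E[OF 5] continuous_map_fst continuous_map_chart_coord) simp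
    moreover have "continuous_map ?Y (total \<eta>) (\<lambda>y. D J (fst y) (restrict (\<lambda>i. snd y (length ws + i)) {..<length vs}))"
      by (intro B.continuous_E[OF 5] continuous_map_fst continuous_map_chart_coord) simp
    moreover have "proj \<xi> (E J (fst y) (restrict (snd y) {..<length ws}))
        = proj \<eta> (D J (fst y) (restrict (\<lambda>i. snd y (length ws + i)) {..<length vs}))" if "y \<in> topspace ?Y" for y
      using that A.proj_E[OF 5] B.proj_E[OF 5] unfolding A.topspace_chart_product by simp
    ultimately show ?case unfolding tot
      by (intro continuous_map_into_subtopology continuous_map_pairedI funcsetI) (simp_all only: mem_Collect_eq case_prod_conv)
  next
    case (6 J x z)
    then show ?case using A.proj_E by (simp add: pr)
  next
    case (7 J x z i)
    then show ?case using A.tau_E[of J x "restrict z {..<length ws}" i]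
        B.tau_E[of J x "restrict (\<lambda>i. z (length ws + i)) {..<length vs}" "i - length ws"] by simp
  next
    case (8 J e)
    let ?t = "\<lambda>i. if i < length ws then \<tau> J (fst e) i else \<sigma> J (snd e) (i - length ws)"
    have "restrict (restrict ?t {..<length (ws @ vs)}) {..<length ws} = restrict (\<tau> J (fst e)) {..<length ws}"
      "restrict (\<lambda>i. restrict ?t {..<length (ws @ vs)} (length ws + i)) {..<length vs} = restrict (\<sigma> J (snd e)) {..<length vs}"
      by auto
    then show ?case using 8 A.E_tau[of J "fst e"] B.E_tau[of J "snd e"] by (simp only: top pr prod.collapse)
  next
    case (9 J e i c)
    then show ?case using A.tau_scale[of J "fst e" i c] B.tau_scale[of J "snd e" "i - length ws" c]
      by (simp add: top pr sc)
  next
    case (10 J e e' i)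
    then show ?case using A.tau_add[of J "fst e" "fst e'" i] B.tau_add[of J "snd e" "snd e'" "i - length ws"]
      by (simp add: top pr ad)
  next
    case (11 J J' e i)
    then show ?case using A.tau_trans[of J J' "fst e" i] B.tau_trans[of J J' "snd e" "i - length ws"]
      by (simp add: top pr nth_append)
  qed
qed

text \<open>Each summand is a line bundle whose fibre coordinate is a vector over
  \<open>{..<1}\<close>; the restricted constant function is how the number \<open>z k\<close> is
  packed into such a vector.\<close>

lemma chart_bundle_whitney_family:
  assumes A: "\<And>k. k < length ws \<Longrightarrow> chart_bundle M [ws ! k] (\<xi> k) (\<tau> k) (E k)"
  shows "chart_bundle M ws (whitney_family X {..<length ws} \<xi>)
    (\<lambda>J e k. \<tau> k J (snd e k) 0)
    (\<lambda>J x z. (x, \<lambda>k\<in>{..<length ws}. E k J x (restrict (\<lambda>_. z k) {..<1})))"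
proof -
  let ?n = "length ws"
  let ?S = "whitney_family X {..<?n} \<xi>"
  have tot: "total ?S = subtopology (prod_topology X (product_topology (\<lambda>i. total (\<xi> i)) {..<?n}))
                {(x, u). \<forall>i\<in>{..<?n}. proj (\<xi> i) (u i) = x}"
    by (simp add: whitney_family_def)
  have top: "e \<in> topspace (total ?S) \<longleftrightarrow> fst e \<in> topspace X \<and> snd e \<in> extensional {..<?n} \<and>
      (\<forall>k<?n. snd e k \<in> topspace (total (\<xi> k)) \<and> proj (\<xi> k) (snd e k) = fst e)" for e
    by (cases e) (auto simp: tot PiE_iff)
  have pr: "proj ?S e = fst e" for e
    by (simp add: whitney_family_def)
  have sc: "vscale ?S c e = (fst e, \<lambda>i\<in>{..<?n}. vscale (\<xi> i) c (snd e i))" for c e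
    by (simp add: whitney_family_def case_prod_beta)
  have ad: "vadd ?S e e' = (fst e, \<lambda>i\<in>{..<?n}. vadd (\<xi> i) (snd e i) (snd e' i))" for e e'
    by (simp add: whitney_family_def case_prod_beta)
  have c1: "continuous_map (total ?S) X fst"
    unfolding tot by (intro continuous_map_from_subtopology continuous_map_fst)
  have c2: "continuous_map (total ?S) (total (\<xi> k)) (\<lambda>e. snd e k)" if "k < ?n" for k
    unfolding tot
    by (rule continuous_map_from_subtopology,
        rule continuous_map_compose_fun[OF continuous_map_snd continuous_map_product_projection]) (use that in simp)
  have ext0: "restrict t {..<1} = restrict (\<lambda>_. t 0) {..<1}" for t :: "nat \<Rightarrow> complex"
    by (auto simp: restrict_def)
  show ?thesis
  proof (unfold_locales, goal_cases)
    case 1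
    show ?case unfolding pr by (rule c1)
  next
    case (2 e c)
    then show ?case using chart_bundle.scale_in[OF A] by (simp add: top pr sc)
  next
    case (3 e e')
    then show ?case using chart_bundle.add_in[OF A] by (simp add: top pr ad)
  next
    case (4 J i)
    show ?case
      by (rule chart_bundle.continuous_tau[OF A[OF 4(2)] 4(1) _ continuous_map_from_subtopology[OF c2[OF 4(2)]]])
        (use 4 in \<open>simp_all add: pr top\<close>)
  next
    case (5 J)
    let ?Y = "prod_topology (subtopology X (chart J)) (product_topology (\<lambda>_. euclidean :: complex topology) {..<?n})"
    have "continuous_map ?Y (total (\<xi> k)) (\<lambda>y. E k J (fst y) (restrict (\<lambda>_. snd y k) {..<1}))" if "k < ?n" for k
      using chart_bundle.continuous_E[OF A[OF that] 5 continuous_map_fst, of "product_topology (\<lambda>_. euclidean :: complex topology) {..<?n}" "\<lambda>y _. snd y k"]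
        continuous_map_chart_coord[OF that] by simp
    then have "continuous_map ?Y (prod_topology X (product_topology (\<lambda>i. total (\<xi> i)) {..<?n}))
        (\<lambda>y. (fst y, \<lambda>k\<in>{..<?n}. E k J (fst y) (restrict (\<lambda>_. snd y k) {..<1})))"
      by (intro continuous_map_pairedI continuous_map_restrictI continuous_map_into_fulltopology[OF continuous_map_fst]) auto
    moreover have "proj (\<xi> k) (E k J (fst y) (restrict (\<lambda>_. snd y k) {..<1})) = fst y" if "y \<in> topspace ?Y" "k < ?n" for y k
      using that chart_bundle.proj_E[OF A[OF that(2)] 5] by (auto simp: PiE_iff)
    ultimately show ?case unfolding tot
      by (intro continuous_map_into_subtopology funcsetI) auto
  next
    case (6 J x z)
    then show ?case by (simp add: pr)
  next
    case (7 J x z i)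
    then show ?case using chart_bundle.tau_E[OF A, of i J x "restrict (\<lambda>_. z i) {..<1}" 0] by simp
  next
    case (8 J e)
    have "E k J (fst e) (restrict (\<lambda>_. \<tau> k J (snd e k) 0) {..<1}) = snd e k" if "k < ?n" for k
      using chart_bundle.E_tau[OF A[OF that] 8(1), of "snd e k"] 8 that ext0[of "\<tau> k J (snd e k)"] by (simp add: top pr)
    then have "(\<lambda>k\<in>{..<?n}. E k J (fst e) (restrict (\<lambda>_. restrict (\<lambda>k. \<tau> k J (snd e k) 0) {..<?n} k) {..<1})) = snd e"
      using 8 by (intro extensionalityI[of _ "{..<?n}"]) (auto simp: top)
    then show ?case by (simp add: pr)
  next
    case (9 J e i c)
    then show ?case using chart_bundle.tau_scale[OF A, of i J "snd e i" 0 c] by (simp add: top pr sc)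
  next
    case (10 J e e' i)
    then show ?case using chart_bundle.tau_add[OF A, of i J "snd e i" "snd e' i" 0] by (simp add: top pr ad)
  next
    case (11 J J' e i)
    then show ?case using chart_bundle.tau_trans[OF A, of i J J' "snd e i" 0] by (simp add: top pr)
  qed
qed

end

text \<open>\<open>TNS_manifold\<close> fixes the type of the points of the extra summands. A point
  is renamed by its base point together with its coordinate in the chart picked there.\<close>

lemma (in chart_bundle) relabel_line_bundle:
  assumes ws: "ws = [w]"
  shows "\<exists>(\<xi>' :: ('n point_class, 'n point_class \<times> complex) cbundle) \<tau>' E'.
    chart_bundle M [w] \<xi>' \<tau>' E'"
proof -
  define \<rho> where "\<rho> e = (proj \<xi> e, \<tau> (pick (proj \<xi> e)) e 0)" for e
  define \<sigma> where "\<sigma> y = E (pick (fst y)) (fst y) (restrict (\<lambda>_. snd y) {..<1})" for y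
  let ?T = "topspace (total \<xi>)"
  \<comment> \<open>The topology is transported along the relabelling \<open>\<rho>\<close>, whose
    inverse is \<open>\<sigma>\<close>; the product topology would in general be wrong, since
    \<open>pick\<close> jumps between charts. The fibrewise formulas are linear because
    \<open>pick\<close> depends on the base point only.\<close>
  define \<xi>' :: "('n point_class, 'n point_class \<times> complex) cbundle"
    where "\<xi>' = \<lparr>total = quotient_of (total \<xi>) \<rho>, proj = fst,
      vadd = (\<lambda>y y'. (fst y, snd y + snd y')), vscale = (\<lambda>c y. (fst y, c * snd y))\<rparr>"
  have r1: "r = 1" by (simp add: ws)
  have \<sigma>\<rho>: "\<sigma> (\<rho> e) = e" if e: "e \<in> ?T" for e
  proof -
    have "restrict (\<lambda>_. \<tau> (pick (proj \<xi> e)) e 0) {..<1} = restrict (\<tau> (pick (proj \<xi> e)) e) {..<r}"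
      by (auto simp: restrict_def r1)
    then show ?thesis using E_tau[OF pick(1) e pick(2)] proj_in[OF e] by (simp add: \<sigma>_def \<rho>_def)
  qed
  have top: "topspace (total \<xi>') = \<rho> ` ?T" by (simp add: \<xi>'_def topspace_quotient_of)
  have q: "quotient_map (total \<xi>) (total \<xi>') \<rho>" by (simp add: \<xi>'_def quotient_map_quotient_of)
  have \<rho>c: "continuous_map (total \<xi>) (total \<xi>') \<rho>" using q by (rule quotient_imp_continuous_map)
  have \<sigma>c: "continuous_map (total \<xi>') (total \<xi>) \<sigma>"
    by (rule continuous_compose_quotient_map[OF q], rule continuous_map_eq[OF continuous_map_id]) (simp add: \<sigma>\<rho>)
  have yT: "\<exists>e. e \<in> ?T \<and> y = \<rho> e" if "y \<in> topspace (total \<xi>')" for y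
    using that by (auto simp: top)
  have pr: "proj \<xi>' y = fst y" for y by (simp add: \<xi>'_def)
  have f\<rho>: "fst (\<rho> e) = proj \<xi> e" for e by (simp add: \<rho>_def)
  have sc: "vscale \<xi>' c (\<rho> e) = \<rho> (vscale \<xi> c e)" if e: "e \<in> ?T" for c e
    using tau_scale[OF pick(1) e pick(2), of 0] proj_in[OF e] scale_in[OF e] by (simp add: \<xi>'_def \<rho>_def ws)
  have ad: "vadd \<xi>' (\<rho> e) (\<rho> e') = \<rho> (vadd \<xi> e e')" if e: "e \<in> ?T" "e' \<in> ?T" "proj \<xi> e' = proj \<xi> e" for e e'
    using tau_add[OF pick(1) e(1,2) pick(2) e(3), of 0] proj_in[OF e(1)] add_in[OF e] e by (simp add: \<xi>'_def \<rho>_def ws)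
  have "chart_bundle M ws \<xi>' (\<lambda>J y. \<tau> J (\<sigma> y)) (\<lambda>J x z. \<rho> (E J x z))"
  proof (unfold_locales, goal_cases)
    case 1
    have "continuous_map (total \<xi>') X fst"
    proof (rule continuous_compose_quotient_map[OF q], rule continuous_map_eq[OF proj_cont])
      show "proj \<xi> e = (fst \<circ> \<rho>) e" for e by (simp add: f\<rho>)
    qed
    then show ?case by (simp add: \<xi>'_def)
  next
    case (2 y c)
    then obtain e where "e \<in> ?T" "y = \<rho> e" using yT by blast
    then show ?case using scale_in sc by (auto simp: pr f\<rho> top)
  next
    case (3 y y')
    then obtain e e' where "e \<in> ?T" "y = \<rho> e" "e' \<in> ?T" "y' = \<rho> e'" using yT by meson
    then show ?case using add_in ad 3(3) by (auto simp: pr f\<rho> top)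
  next
    case (4 J i)
    show ?case
    proof (rule continuous_tau[OF 4 continuous_map_from_subtopology[OF \<sigma>c]])
      fix y assume y: "y \<in> topspace (subtopology (total \<xi>') {y. proj \<xi>' y \<in> chart J})"
      then have "y \<in> topspace (total \<xi>')" by simp
      then obtain e where "e \<in> ?T" "y = \<rho> e" using yT by blast
      then show "proj \<xi> (\<sigma> y) \<in> chart J" using y \<sigma>\<rho> by (simp add: pr f\<rho>)
    qed
  next
    case (5 J)
    show ?case by (rule continuous_map_compose_fun[OF E_cont[OF 5] \<rho>c])
  next
    case (6 J x z)
    then show ?case using proj_E[OF 6] by (simp add: pr f\<rho>)
  next
    case (7 J x z i)
    then show ?case using tau_E[OF 7] \<sigma>\<rho>[OF E_in[OF 7(1-3)]] by simp
  next
    case (8 J y)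
    then obtain e where e: "e \<in> ?T" "y = \<rho> e" using yT by blast
    have "proj \<xi> e \<in> chart J" using 8(3) by (simp add: pr e(2) f\<rho>)
    from E_tau[OF 8(1) e(1) this] show ?case by (simp only: e(2) pr f\<rho> \<sigma>\<rho>[OF e(1)])
  next
    case (9 J y i c)
    then obtain e where e: "e \<in> ?T" "y = \<rho> e" using yT by blast
    have ch: "proj \<xi> e \<in> chart J" using 9(3) by (simp add: pr e(2) f\<rho>)
    have "vscale \<xi> c e \<in> ?T" using scale_in[OF e(1)] by blast
    then show ?case using tau_scale[OF 9(1) e(1) ch 9(4)] by (simp only: e(2) sc[OF e(1)] \<sigma>\<rho> e(1))
  next
    case (10 J y y' i)
    then obtain e e' where e: "e \<in> ?T" "y = \<rho> e" "e' \<in> ?T" "y' = \<rho> e'" using yT by meson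
    have ch: "proj \<xi> e \<in> chart J" and pe: "proj \<xi> e' = proj \<xi> e" using 10(4,5) by (simp_all add: pr e(2,4) f\<rho>)
    have "vadd \<xi> e e' \<in> ?T" using add_in[OF e(1,3) pe] by blast
    then show ?case using tau_add[OF 10(1) e(1,3) ch pe 10(6)] by (simp only: e(2,4) ad[OF e(1,3) pe] \<sigma>\<rho> e(1,3))
  next
    case (11 J J' y i)
    then obtain e where e: "e \<in> ?T" "y = \<rho> e" using yT by blast
    have ch: "proj \<xi> e \<in> chart J" "proj \<xi> e \<in> chart J'" using 11(4,5) by (simp_all add: pr e(2) f\<rho>)
    from tau_trans[OF 11(1,2) e(1) ch 11(6)] show ?case by (simp only: e(2) pr f\<rho> \<sigma>\<rho>[OF e(1)])
  qed
  then show ?thesis using ws by blast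
qed

section \<open>The line bundle of a weight\<close>

context char_pair
begin

text \<open>\<open>theta_point\<close> with an arbitrary character in place of the
  \<open>k\<close>-th coordinate, as required for the inverses and products among the extra
  summands.\<close>

definition line_point :: "weight \<Rightarrow> (real^'n) \<times> (nat \<Rightarrow> real) \<times> complex \<Rightarrow> ((real^'n) \<times> (nat \<Rightarrow> real) \<times> complex) set" where
  "line_point w = (\<lambda>(p, s, z).
     {(p, \<lambda>i\<in>{..<m}. s i + \<kappa> i + c i, cis (2 * pi * pairing w \<kappa>) * z) | \<kappa> c.
        \<kappa> \<in> kernel_lift M \<and> (\<forall>i<m. p \<notin> facet M i \<longrightarrow> c i = 0)})"

abbreviation line_cover :: "((real^'n) \<times> (nat \<Rightarrow> real) \<times> complex) topology" where
  "line_cover \<equiv> prod_topology (top_of_set P)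
     (prod_topology (product_topology (\<lambda>_. euclidean) {..<m}) euclidean)"

definition line_bundle :: "weight \<Rightarrow>
    ('n point_class, ((real^'n) \<times> (nat \<Rightarrow> real) \<times> complex) set) cbundle" where
  "line_bundle w =
    \<lparr> total = quotient_of line_cover (line_point w),
      proj = (\<lambda>E. \<Union>(p, s, z)\<in>E. qt_point M (p, torus_map M s)),
      vadd = (\<lambda>E E'. {(p, s, z + z') | p s z z'. (p, s, z) \<in> E \<and> (p, s, z') \<in> E'}),
      vscale = (\<lambda>c E. (\<lambda>(p, s, z). (p, s, c * z)) ` E) \<rparr>"

lemma theta_eq_line_bundle:
  assumes "k < m" shows "theta M k = line_bundle (frag_of k)"
proof -
  have "theta_point M k = line_point (frag_of k)"
    using assms by (simp add: theta_point_def line_point_def pairing_single fun_eq_iff)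
  then show ?thesis by (simp add: theta_def line_bundle_def)
qed

lemma pairing_0_right [simp]: "pairing w (\<lambda>_. 0) = 0"
  by (simp add: pairing_def)

text \<open>The fibre coordinate in the chart at \<open>J\<close>: the representative is moved along
  the kernel until its torus part is \<open>lift J (torus_map M s)\<close>, and the resulting
  complex number is read off.\<close>

definition coord :: "weight \<Rightarrow> nat set \<Rightarrow> (real^'n) \<times> (nat \<Rightarrow> real) \<times> complex \<Rightarrow> complex" where
  "coord w J = (\<lambda>(p, s, z). cis (2 * pi * pairing w (\<lambda>i. lift J (torus_map M s) i - s i)) * z)"

lemma coord_Pair: "coord w J (p, s, z) = cis (2 * pi * pairing w (\<lambda>i. lift J (torus_map M s) i - s i)) * z"
  by (simp add: coord_def)

text \<open>\<open>lift J\<close> reproduces the collapsed part \<open>c\<close>, which cancels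
  against \<open>s'\<close>. The kernel part leaves the phase of \<open>- \<kappa>\<close> up to an
  integer, and this cancels the given factor.\<close>

lemma coord_shift:
  assumes J: "J \<in> V" and p: "p \<in> chart_base J" and \<kappa>: "torus_map M \<kappa> \<in> range real_vec"
    and c: "\<And>i. i < m \<Longrightarrow> p \<notin> facet M i \<Longrightarrow> c i = 0" and s': "\<And>i. i < m \<Longrightarrow> s' i = s i + \<kappa> i + c i"
  shows "coord w J (p, s', cis (2 * pi * pairing w \<kappa>) * z) = coord w J (p, s, z)"
    and "torus_map M s' - torus_map M s \<in> stabilizer_lift M p"
proof -
  obtain a where a: "torus_map M \<kappa> = real_vec a" using \<kappa> by blast
  have t: "torus_map M s' = torus_map M s + real_vec a + torus_map M c"
  proof -
    have "torus_map M s' = torus_map M (\<lambda>i. (s i + \<kappa> i) + c i)" by (rule torus_map_cong) (rule s')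
    then show ?thesis by (simp add: torus_map_add a)
  qed
  then show "torus_map M s' - torus_map M s \<in> stabilizer_lift M p"
    unfolding stabilizer_lift_iff using c by (intro exI[of _ a] exI[of _ c]) simp
  have lc: "lift J (torus_map M c) i = c i" if "i < m" for i
    using c p by (intro lift_torus_map[OF J _ that]) (auto simp: chart_base_def facets_through_def)
  have "pairing w (\<lambda>i. lift J (torus_map M s') i - s' i)
      = pairing w (\<lambda>i. ((lift J (torus_map M s) i - s i) + lift J (real_vec a) i) - \<kappa> i)"
    by (rule pairing_cong) (simp add: t lift_add lc s')
  also have "\<dots> = pairing w (\<lambda>i. lift J (torus_map M s) i - s i) + pairing w (lift J (real_vec a)) - pairing w \<kappa>"
    by (simp only: pairing_diff_right pairing_add_right)
  finally have e: "pairing w (\<lambda>i. lift J (torus_map M s') i - s' i) + pairing w \<kappa>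
      = pairing w (\<lambda>i. lift J (torus_map M s) i - s i) + pairing w (lift J (real_vec a))" by simp
  have "coord w J (p, s', cis (2 * pi * pairing w \<kappa>) * z)
      = cis (2 * pi * (pairing w (\<lambda>i. lift J (torus_map M s') i - s' i) + pairing w \<kappa>)) * z"
    by (simp add: coord_Pair distrib_left cis_mult[symmetric] mult.assoc)
  also have "\<dots> = cis (2 * pi * pairing w (lift J (real_vec a))) * coord w J (p, s, z)"
    unfolding e by (simp add: coord_Pair distrib_left cis_mult[symmetric] mult_ac)
  also have "\<dots> = coord w J (p, s, z)" using cis_pairing_int[OF pairing_int[OF lift_int]] by simp
  finally show "coord w J (p, s', cis (2 * pi * pairing w \<kappa>) * z) = coord w J (p, s, z)" .
qed

lemma coord_inj: "coord w J (p, s, z) = coord w J (p, s, z') \<Longrightarrow> z = z'"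
  by (simp add: coord_Pair)

lemma coord_surj: "\<exists>z. coord w J (p, s, z) = y"
  by (rule exI[of _ "y / cis (2 * pi * pairing w (\<lambda>i. lift J (torus_map M s) i - s i))"]) (simp add: coord_Pair)

lemma coord_add: "coord w J (p, s, z + z') = coord w J (p, s, z) + coord w J (p, s, z')"
  and coord_scale: "coord w J (p, s, c * z) = c * coord w J (p, s, z)"
  by (simp_all add: coord_Pair distrib_left)

text \<open>Trades the existential \<open>\<kappa>\<close> and \<open>c\<close> for two invariants,
  the image in the manifold and the chart coordinate, so that the bundle operations become
  computations with \<open>coord\<close>.\<close>

lemma line_point_eq:
  assumes J: "J \<in> V" and p: "p \<in> chart_base J"
  shows "line_point w (p, s, z) = {(p, s', z') | s' z'. s' \<in> extensional {..<m} \<and>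
     torus_map M s' - torus_map M s \<in> stabilizer_lift M p \<and> coord w J (p, s', z') = coord w J (p, s, z)}"
    (is "_ = ?R")
proof
  show "line_point w (p, s, z) \<subseteq> ?R"
  proof
    fix y assume "y \<in> line_point w (p, s, z)"
    then obtain \<kappa> c where \<kappa>: "\<kappa> \<in> kernel_lift M" "\<And>i. i < m \<Longrightarrow> p \<notin> facet M i \<Longrightarrow> c i = 0"
      and y: "y = (p, \<lambda>i\<in>{..<m}. s i + \<kappa> i + c i, cis (2 * pi * pairing w \<kappa>) * z)"
      by (auto simp: line_point_def)
    have "torus_map M \<kappa> \<in> range real_vec" using \<kappa> by (simp add: kernel_lift_def)
    from coord_shift[OF J p this \<kappa>(2), where s' = "\<lambda>i\<in>{..<m}. s i + \<kappa> i + c i" and s = s] show "y \<in> ?R"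
      unfolding y by auto
  qed
  show "?R \<subseteq> line_point w (p, s, z)"
  proof
    fix y assume "y \<in> ?R"
    then obtain s' z' where y: "y = (p, s', z')" "s' \<in> extensional {..<m}"
      "torus_map M s' - torus_map M s \<in> stabilizer_lift M p" "coord w J (p, s', z') = coord w J (p, s, z)" by blast
    then obtain a c where c: "\<forall>i<m. p \<notin> facet M i \<longrightarrow> c i = 0" "torus_map M s' - torus_map M s = real_vec a + torus_map M c"
      unfolding stabilizer_lift_iff by blast
    \<comment> \<open>What is left of the difference after removing the collapsed part; its image is
      integral, so it belongs to the kernel.\<close>
    define \<kappa> where "\<kappa> = (\<lambda>i\<in>{..<m}. s' i - s i - c i)"
    have "torus_map M \<kappa> = torus_map M (\<lambda>i. s' i - s i - c i)" by (rule torus_map_cong) (simp add: \<kappa>_def)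
    then have t\<kappa>: "torus_map M \<kappa> = real_vec a" using c(2) by (simp add: torus_map_diff)
    then have \<kappa>: "\<kappa> \<in> kernel_lift M" "torus_map M \<kappa> \<in> range real_vec" by (auto simp: kernel_lift_def \<kappa>_def)
    have "coord w J (p, s', cis (2 * pi * pairing w \<kappa>) * z) = coord w J (p, s, z)"
      by (rule coord_shift(1)[OF J p \<kappa>(2), where c = c]) (use c in \<open>auto simp: \<kappa>_def\<close>)
    then have "z' = cis (2 * pi * pairing w \<kappa>) * z" using y(4) coord_inj by metis
    moreover have "s' = (\<lambda>i\<in>{..<m}. s i + \<kappa> i + c i)"
      using y(2) by (intro extensionalityI[of _ "{..<m}"]) (auto simp: \<kappa>_def)
    ultimately have "y = (p, \<lambda>i\<in>{..<m}. s i + \<kappa> i + c i, cis (2 * pi * pairing w \<kappa>) * z)" using y(1) by simp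
    then show "y \<in> line_point w (p, s, z)" using \<kappa>(1) c(1) by (auto simp: line_point_def)
  qed
qed

lemma line_point_cong:
  assumes J: "J \<in> V" and p: "p \<in> chart_base J"
    and "torus_map M s - torus_map M s' \<in> stabilizer_lift M p" "coord w J (p, s, z) = coord w J (p, s', z')"
  shows "line_point w (p, s, z) = line_point w (p, s', z')"
proof -
  have "u - torus_map M s \<in> stabilizer_lift M p \<longleftrightarrow> u - torus_map M s' \<in> stabilizer_lift M p" for u
    using stabilizer_lift_diff[of "u - torus_map M s'" p "torus_map M s - torus_map M s'"]
      stabilizer_lift_diff[of "u - torus_map M s" p "torus_map M s' - torus_map M s"]
      stabilizer_lift_diff[of 0 p "torus_map M s - torus_map M s'"] stabilizer_lift_0 assms(3) by auto
  then show ?thesis using line_point_eq[OF J p] assms(4) by simp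
qed

lemma line_point_self:
  assumes "s \<in> extensional {..<m}" shows "(p, s, z) \<in> line_point w (p, s, z)"
proof -
  define \<kappa> where "\<kappa> = (\<lambda>i\<in>{..<m}. 0 :: real)"
  have "torus_map M \<kappa> = real_vec 0" by (simp add: torus_map_def \<kappa>_def)
  then have "torus_map M \<kappa> \<in> range real_vec" by (metis rangeI)
  then have \<kappa>: "\<kappa> \<in> kernel_lift M" by (simp add: kernel_lift_def \<kappa>_def)
  have "pairing w \<kappa> = 0" by (simp add: pairing_def \<kappa>_def)
  moreover have "s = (\<lambda>i\<in>{..<m}. s i + \<kappa> i + 0)"
    using assms by (intro extensionalityI[of _ "{..<m}"]) (auto simp: \<kappa>_def)
  ultimately have "(p, s, z) = (p, \<lambda>i\<in>{..<m}. s i + \<kappa> i + 0, cis (2 * pi * pairing w \<kappa>) * z)" by simp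
  then show ?thesis unfolding line_point_def case_prod_conv mem_Collect_eq
    using \<kappa> by (intro exI[of _ \<kappa>] exI[of _ "\<lambda>_. 0"] conjI) simp_all
qed

lemma line_point_tau:
  assumes J: "J \<in> V" and p: "p \<in> chart_base J" and s: "s \<in> extensional {..<m}"
  shows "coord w J (SOME y. y \<in> line_point w (p, s, z)) = coord w J (p, s, z)"
proof -
  have "(SOME y. y \<in> line_point w (p, s, z)) \<in> line_point w (p, s, z)"
    by (rule someI) (rule line_point_self[OF s])
  then show ?thesis using line_point_eq[OF J p] by auto
qed

lemma proj_line_point:
  assumes p: "p \<in> P" and s: "s \<in> extensional {..<m}"
  shows "proj (line_bundle w) (line_point w (p, s, z)) = qt_point M (p, torus_map M s)"
proof -
  obtain J where J: "J \<in> V" "p \<in> chart_base J" using exists_vertex_set[OF p] p by (auto simp: chart_base_def)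
  let ?E = "line_point w (p, s, z)"
  have "(\<Union>(q, s', z')\<in>?E. qt_point M (q, torus_map M s')) = qt_point M (p, torus_map M s)"
  proof (rule SUP_eq_const)
    show "?E \<noteq> {}" using line_point_self[OF s] by blast
    fix y assume "y \<in> ?E"
    then obtain s' z' where "y = (p, s', z')" "torus_map M s' - torus_map M s \<in> stabilizer_lift M p"
      unfolding line_point_eq[OF J] by blast
    then show "(case y of (q, s', z') \<Rightarrow> qt_point M (q, torus_map M s')) = qt_point M (p, torus_map M s)"
      by (simp add: qt_point_eq_iff)
  qed
  then show ?thesis by (simp add: line_bundle_def)
qed

lemma vscale_line_point:
  assumes p: "p \<in> P"
  shows "vscale (line_bundle w) c (line_point w (p, s, z)) = line_point w (p, s, c * z)"
proof -
  obtain J where J: "J \<in> V" "p \<in> chart_base J" using exists_vertex_set[OF p] p by (auto simp: chart_base_def)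
  have "(\<lambda>(p, s, z). (p, s, c * z)) ` line_point w (p, s, z) = line_point w (p, s, c * z)"
  proof (intro equalityI subsetI)
    fix y assume "y \<in> (\<lambda>(p, s, z). (p, s, c * z)) ` line_point w (p, s, z)"
    then show "y \<in> line_point w (p, s, c * z)" unfolding line_point_eq[OF J] by (auto simp: coord_scale)
  next
    fix y assume "y \<in> line_point w (p, s, c * z)"
    then obtain s' z' where y: "y = (p, s', z')" "s' \<in> extensional {..<m}"
      "torus_map M s' - torus_map M s \<in> stabilizer_lift M p" "coord w J (p, s', z') = coord w J (p, s, c * z)"
      unfolding line_point_eq[OF J] by blast
    obtain z1 where z1: "coord w J (p, s', z1) = coord w J (p, s, z)" using coord_surj by blast
    then have "z' = c * z1" using y(4) coord_inj[of w J p s' z' "c * z1"] by (simp add: coord_scale)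
    moreover have "(p, s', z1) \<in> line_point w (p, s, z)" unfolding line_point_eq[OF J] using y z1 by blast
    ultimately show "y \<in> (\<lambda>(p, s, z). (p, s, c * z)) ` line_point w (p, s, z)" using y(1) by force
  qed
  then show ?thesis by (simp add: line_bundle_def)
qed

text \<open>\<open>vadd\<close> adds only at a common representative \<open>(p, s')\<close>;
  \<open>coord_surj\<close> provides both summands at any prescribed \<open>s'\<close>.\<close>

lemma vadd_line_point:
  assumes p: "p \<in> P"
  shows "vadd (line_bundle w) (line_point w (p, s, z)) (line_point w (p, s, z')) = line_point w (p, s, z + z')"
proof -
  obtain J where J: "J \<in> V" "p \<in> chart_base J" using exists_vertex_set[OF p] p by (auto simp: chart_base_def)
  have "{(q, s', y + y') | q s' y y'. (q, s', y) \<in> line_point w (p, s, z) \<and> (q, s', y') \<in> line_point w (p, s, z')}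
      = line_point w (p, s, z + z')" (is "?A = _")
  proof (intro equalityI subsetI)
    fix y assume "y \<in> ?A"
    then show "y \<in> line_point w (p, s, z + z')" unfolding line_point_eq[OF J] by (auto simp: coord_add)
  next
    fix y assume "y \<in> line_point w (p, s, z + z')"
    then obtain s' x where y: "y = (p, s', x)" "s' \<in> extensional {..<m}"
      "torus_map M s' - torus_map M s \<in> stabilizer_lift M p" "coord w J (p, s', x) = coord w J (p, s, z + z')"
      unfolding line_point_eq[OF J] by blast
    obtain z1 where z1: "coord w J (p, s', z1) = coord w J (p, s, z)" using coord_surj by blast
    obtain z2 where z2: "coord w J (p, s', z2) = coord w J (p, s, z')" using coord_surj by blast
    have "x = z1 + z2" using y(4) z1 z2 coord_inj[of w J p s' x "z1 + z2"] by (simp add: coord_add)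
    moreover have "(p, s', z1) \<in> line_point w (p, s, z)" "(p, s', z2) \<in> line_point w (p, s, z')"
      unfolding line_point_eq[OF J] using y z1 z2 by blast+
    ultimately show "y \<in> ?A" using y(1) by blast
  qed
  then show ?thesis by (simp add: line_bundle_def)
qed

lemma continuous_map_torus_map:
  "continuous_map (product_topology (\<lambda>_. euclidean) {..<m}) euclidean (torus_map M)"
  unfolding torus_map_def by (intro continuous_map_sum continuous_map_scaleR continuous_map_product_projection) auto

lemma continuous_map_coord:
  "continuous_map line_cover euclidean (coord w J)"
proof -
  have lift: "continuous_on UNIV (\<lambda>t. lift J t i)" if "i < m" for i
    by (rule continuous_on_lift[OF _ that]) (rule continuous_on_id)
  have s: "continuous_map line_cover (product_topology (\<lambda>_. euclidean) {..<m}) (\<lambda>y. fst (snd y))"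
    by (rule continuous_map_compose_fun[OF continuous_map_snd continuous_map_fst])
  have z: "continuous_map line_cover euclidean (\<lambda>y. snd (snd y))"
    by (rule continuous_map_compose_fun[OF continuous_map_snd continuous_map_snd])
  have si: "continuous_map line_cover euclidean (\<lambda>y. fst (snd y) i)" if "i < m" for i
    by (rule continuous_map_compose_fun[OF s continuous_map_product_projection]) (use that in simp)
  have li: "continuous_map line_cover euclidean (\<lambda>y. lift J (torus_map M (fst (snd y))) i)" if "i < m" for i
    by (rule continuous_map_compose_fun[OF continuous_map_compose_fun[OF s continuous_map_torus_map]]) (use lift[OF that] in simp)
  have "continuous_map line_cover euclideanreal
      (\<lambda>y. pairing w (\<lambda>i. lift J (torus_map M (fst (snd y))) i - fst (snd y) i))"
    unfolding pairing_def
    by (intro continuous_map_sum continuous_map_times continuous_map_diff continuous_map_canonical_const si li) auto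
  moreover have "continuous_map euclideanreal euclidean (\<lambda>t. cis (2 * pi * t))"
    by (auto intro!: continuous_intros)
  ultimately have "continuous_map line_cover euclidean
      (\<lambda>y. cis (2 * pi * pairing w (\<lambda>i. lift J (torus_map M (fst (snd y))) i - fst (snd y) i)))"
    by (rule continuous_map_compose_fun)
  from continuous_map_times[OF this z] show ?thesis by (simp add: coord_def case_prod_beta')
qed

lemma chart_bundle_line_bundle:
  "chart_bundle M [w] (line_bundle w) (\<lambda>J e i. coord w J (SOME y. y \<in> e))
    (\<lambda>J x z. line_point w (fst (rep x), lift J (snd (rep x)), z 0))"
proof -
  let ?L = "line_bundle w"
  have tot: "total ?L = quotient_of line_cover (line_point w)" by (simp add: line_bundle_def)
  have q: "quotient_map line_cover (total ?L) (line_point w)" unfolding tot by (rule quotient_map_quotient_of)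
  have tc: "y \<in> topspace line_cover \<longleftrightarrow> fst y \<in> P \<and> fst (snd y) \<in> extensional {..<m}" for y
    by (cases y) (auto simp: PiE_iff)
  have top: "topspace (total ?L) = line_point w ` topspace line_cover" by (simp add: tot topspace_quotient_of)
  have inT: "line_point w (p, s, z) \<in> topspace (total ?L)" if "p \<in> P" "s \<in> extensional {..<m}" for p s z
    unfolding top by (rule imageI) (simp only: tc, use that in simp)
  have form: "\<exists>p s z. e = line_point w (p, s, z) \<and> p \<in> P \<and> s \<in> extensional {..<m}" if e: "e \<in> topspace (total ?L)" for e
  proof -
    obtain y where y: "e = line_point w y" "y \<in> topspace line_cover" using e unfolding top by blast
    then show ?thesis using tc[of y] by (metis prod.collapse)
  qed
  have pcont: "continuous_map (total ?L) X (proj ?L)"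
  proof (rule continuous_compose_quotient_map[OF q])
    have "continuous_map line_cover (prod_topology (top_of_set P) euclidean) (\<lambda>y. (fst y, torus_map M (fst (snd y))))"
      by (intro continuous_map_pairedI continuous_map_fst continuous_map_compose_fun[OF
          continuous_map_compose_fun[OF continuous_map_snd continuous_map_fst] continuous_map_torus_map])
    moreover have "prod_topology (top_of_set P) euclidean = top_of_set (P \<times> (UNIV :: (real^'n) set))"
      using prod_topology_subtopology_eu[of P "UNIV :: (real^'n) set"] by simp
    ultimately have "continuous_map line_cover (top_of_set (P \<times> UNIV)) (\<lambda>y. (fst y, torus_map M (fst (snd y))))"
      by simp
    moreover have "continuous_map (top_of_set (P \<times> UNIV)) X (qt_point M)"
      unfolding qt_space_def by (rule quotient_imp_continuous_map[OF quotient_map_quotient_of])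
    ultimately have "continuous_map line_cover X (\<lambda>y. qt_point M (fst y, torus_map M (fst (snd y))))"
      by (rule continuous_map_compose_fun)
    then show "continuous_map line_cover X (proj ?L \<circ> line_point w)"
    proof (rule continuous_map_eq)
      fix y assume "y \<in> topspace line_cover"
      then show "qt_point M (fst y, torus_map M (fst (snd y))) = (proj ?L \<circ> line_point w) y"
        using proj_line_point[of "fst y" "fst (snd y)" w "snd (snd y)"] unfolding tc by simp
    qed
  qed
  \<comment> \<open>Over a chart each point has a representative with torus part
    \<open>lift J t\<close>, where \<open>t\<close> comes from \<open>rep\<close>; its complex
    number is then the chart coordinate itself. Points of one fibre share \<open>p\<close> and
    \<open>t\<close>, which is what addition requires.\<close>
  have form_chart: "\<exists>p t z. proj ?L e = qt_point M (p, t) \<and> p \<in> chart_base J \<and> p \<in> P \<and>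
      e = line_point w (p, lift J t, z) \<and> coord w J (SOME y. y \<in> e) = z \<and> rep (proj ?L e) = (p, t)"
    if J: "J \<in> V" and e: "e \<in> topspace (total ?L)" "proj ?L e \<in> chart J" for J e
  proof -
    obtain p s z where ps: "e = line_point w (p, s, z)" "p \<in> P" "s \<in> extensional {..<m}" using form[OF e(1)] by blast
    obtain p' t where pt: "rep (proj ?L e) = (p', t)" "p' \<in> chart_base J" "qt_point M (p', t) = proj ?L e" using rep[OF e(2)] .
    have "qt_point M (p', t) = qt_point M (p, torus_map M s)" using pt(3) proj_line_point[OF ps(2,3)] ps(1) by simp
    then have p': "p' = p" "t - torus_map M s \<in> stabilizer_lift M p" unfolding qt_point_eq_iff by auto
    have pJ: "p \<in> chart_base J" using pt(2) p' by simp
    define z' where "z' = coord w J (p, s, z)"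
    have c: "coord w J (p, lift J t, z') = z'"
      by (simp add: coord_Pair torus_map_lift[OF J])
    have "line_point w (p, lift J t, z') = line_point w (p, s, z)"
      by (rule line_point_cong[OF J pJ]) (use p' c in \<open>simp_all add: torus_map_lift[OF J] z'_def\<close>)
    moreover have "coord w J (SOME y. y \<in> e) = z'" using line_point_tau[OF J pJ ps(3)] ps(1) z'_def by simp
    ultimately show ?thesis using pt pJ p' ps
      by (intro exI[of _ p] exI[of _ t] exI[of _ z']) simp
  qed
  have tau: "coord w J (SOME y. y \<in> line_point w (p, lift J t, z)) = z" if "J \<in> V" "p \<in> chart_base J" for J p t z
    using line_point_tau[OF that lift_extensional] by (simp add: coord_Pair torus_map_lift[OF that(1)])
  have frm: "line_point w (fst (rep (qt_point M (p, t))), lift J (snd (rep (qt_point M (p, t)))), z) = line_point w (p, lift J t, z)"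
    if J: "J \<in> V" and p: "p \<in> chart_base J" for J p t z
  proof -
    have "p \<in> P" using p by (simp add: chart_base_def)
    then have "qt_point M (p, t) \<in> chart J" using qt_point_in_chart p by blast
    then obtain p' t' where r: "rep (qt_point M (p, t)) = (p', t')" "qt_point M (p', t') = qt_point M (p, t)" by (rule rep)
    then have p': "p' = p" "t' - t \<in> stabilizer_lift M p" unfolding qt_point_eq_iff by auto
    have "line_point w (p, lift J t', z) = line_point w (p, lift J t, z)"
      by (rule line_point_cong[OF J p]) (use p' in \<open>simp_all add: coord_Pair torus_map_lift[OF J]\<close>)
    then show ?thesis by (simp add: r p')
  qed
  show ?thesis
  proof (unfold_locales, goal_cases)
    case 1
    show ?case by (rule pcont)
  next
    case (2 e c)
    then obtain p s z where ps: "e = line_point w (p, s, z)" "p \<in> P" "s \<in> extensional {..<m}" using form by blast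
    then show ?case using inT by (simp add: vscale_line_point proj_line_point)
  next
    case (3 e e')
    have "proj ?L e \<in> topspace X"
      by (rule subsetD[OF continuous_map_image_subset_topspace[OF pcont] imageI[OF 3(1)]])
    then obtain J where J: "J \<in> V" "proj ?L e \<in> chart J" using chart_cover by blast
    obtain p t z where 1: "e = line_point w (p, lift J t, z)" "p \<in> P" "rep (proj ?L e) = (p, t)"
      using form_chart[OF J(1) 3(1) J(2)] by blast
    obtain p' t' z' where 2: "e' = line_point w (p', lift J t', z')" "rep (proj ?L e') = (p', t')"
      using form_chart[OF J(1) 3(2)] J(2) unfolding 3(3) by blast
    have "p' = p" "t' = t" using 1 2 3(3) by simp_all
    then show ?case using 1 2 inT by (simp add: vadd_line_point proj_line_point)
  next
    case (4 J i)
    let ?U = "{e \<in> topspace (total ?L). proj ?L e \<in> chart J}"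
    have op: "openin (total ?L) ?U" by (rule openin_continuous_map_preimage[OF pcont openin_chart])
    let ?W = "{y \<in> topspace line_cover. line_point w y \<in> ?U}"
    have qr: "quotient_map (subtopology line_cover ?W) (subtopology (total ?L) ?U) (line_point w)"
      by (rule quotient_map_restriction[OF q]) (use op in auto)
    have "continuous_map (subtopology (total ?L) ?U) euclidean (\<lambda>e. coord w J (SOME y. y \<in> e))"
    proof (rule continuous_compose_quotient_map[OF qr],
        rule continuous_map_eq[OF continuous_map_from_subtopology[OF continuous_map_coord]])
      fix y assume y: "y \<in> topspace (subtopology line_cover ?W)"
      obtain p s z where yy: "y = (p, s, z)" by (cases y)
      have p: "p \<in> P" "s \<in> extensional {..<m}" and ch: "proj ?L (line_point w (p, s, z)) \<in> chart J"
        using y tc[of y] by (simp_all add: yy)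
      have "p \<in> chart_base J" using ch proj_line_point[OF p] qt_point_in_chart[OF p(1)] by simp
      then show "coord w J y = ((\<lambda>e. coord w J (SOME y. y \<in> e)) \<circ> line_point w) y"
        using line_point_tau[OF 4(1) _ p(2)] by (simp add: yy)
    qed
    moreover have "?U = topspace (total ?L) \<inter> {e. proj ?L e \<in> chart J}" by blast
    ultimately show ?case by (simp only: subtopology_restrict)
  next
    case (5 J)
    \<comment> \<open>The product of a quotient map with the identity of \<open>\<complex>\<close>
      is again a quotient map because \<open>\<complex>\<close> is locally compact. Continuity of
      the inverse chart can thus be tested on representatives.\<close>
    let ?Z = "euclidean :: complex topology"
    have hd: "Hausdorff_space ?Z \<or> regular_space ?Z" by simp
    note Q = quotient_map_prod_left[OF locally_compact_space_euclidean hd quotient_map_chart[of J]]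
    let ?A = "prod_topology (top_of_set (chart_base J \<times> (UNIV :: (real^'n) set))) ?Z"
    have cE: "continuous_map (prod_topology (subtopology X (chart J)) ?Z) (total ?L)
        (\<lambda>y. line_point w (fst (rep (fst y)), lift J (snd (rep (fst y))), snd y))"
    proof (rule continuous_compose_quotient_map[OF Q])
      have fp: "continuous_map ?A (top_of_set (chart_base J \<times> UNIV)) fst" by (rule continuous_map_fst)
      have sub: "chart_base J \<times> (UNIV :: (real^'n) set) \<subseteq> P \<times> UNIV" by (auto simp: chart_base_def)
      have f1: "continuous_map (top_of_set (chart_base J \<times> UNIV)) (top_of_set P) fst"
        by (intro continuous_map_into_subtopology) (auto simp: chart_base_def intro!: continuous_intros)
      have f2: "continuous_map (top_of_set (chart_base J \<times> UNIV)) (product_topology (\<lambda>_. euclidean) {..<m}) (\<lambda>x. lift J (snd x))"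
      proof -
        have "continuous_map (top_of_set (chart_base J \<times> UNIV)) (product_topology (\<lambda>_. euclidean) {..<m})
            (\<lambda>x. restrict (lift J (snd x)) {..<m})"
          by (intro continuous_map_restrictI) (auto intro!: continuous_on_lift continuous_intros)
        then show ?thesis by (simp add: extensional_restrict)
      qed
      have "continuous_map ?A line_cover (\<lambda>y. (fst (fst y), lift J (snd (fst y)), snd y))"
        by (intro continuous_map_pairedI continuous_map_compose_fun[OF fp f1] continuous_map_compose_fun[OF fp f2] continuous_map_snd)
      from continuous_map_compose_fun[OF this quotient_imp_continuous_map[OF q]]
      have "continuous_map ?A (total ?L) (\<lambda>y. line_point w (fst (fst y), lift J (snd (fst y)), snd y))" .
      then show "continuous_map ?A (total ?L)
         ((\<lambda>y. line_point w (fst (rep (fst y)), lift J (snd (rep (fst y))), snd y)) \<circ> (\<lambda>(x, y). (qt_point M x, y)))"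
      proof (rule continuous_map_eq)
        fix y assume y: "y \<in> topspace ?A"
        obtain p t z where yy: "y = ((p, t), z)" by (metis prod.collapse)
        have "p \<in> chart_base J" using y by (simp add: yy)
        then show "line_point w (fst (fst y), lift J (snd (fst y)), snd y) =
          ((\<lambda>y. line_point w (fst (rep (fst y)), lift J (snd (rep (fst y))), snd y)) \<circ> (\<lambda>(x, y). (qt_point M x, y))) y"
          using frm[OF 5] by (simp add: yy)
      qed
    qed
    have "continuous_map (prod_topology (subtopology X (chart J)) (product_topology (\<lambda>_. ?Z) {..<length [w]}))
        (prod_topology (subtopology X (chart J)) ?Z) (\<lambda>y. (fst y, snd y 0))"
      by (intro continuous_map_pairedI continuous_map_fst continuous_map_chart_coord) simp
    from continuous_map_compose_fun[OF this cE] show ?case by (simp only: fst_conv snd_conv)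
  next
    case (6 J x z)
    obtain p t where pt: "rep x = (p, t)" "p \<in> chart_base J" "qt_point M (p, t) = x" using rep[OF 6(2)] .
    then show ?case using 6 by (simp add: chart_base_def proj_line_point torus_map_lift)
  next
    case (7 J x z i)
    obtain p t where pt: "rep x = (p, t)" "p \<in> chart_base J" "qt_point M (p, t) = x" using rep[OF 7(2)] .
    then show ?case using 7 tau by simp
  next
    case (8 J e)
    then obtain p t z where "e = line_point w (p, lift J t, z)" "coord w J (SOME y. y \<in> e) = z" "rep (proj ?L e) = (p, t)"
      using form_chart[OF 8] by blast
    then show ?case by simp
  next
    case (9 J e i c)
    then obtain p t z where e: "e = line_point w (p, lift J t, z)" "coord w J (SOME y. y \<in> e) = z" "p \<in> P" "p \<in> chart_base J"
      using form_chart[OF 9(1-3)] by blast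
    then show ?case using tau[OF 9(1) e(4)] by (simp add: vscale_line_point)
  next
    case (10 J e e' i)
    obtain p t z where 1: "e = line_point w (p, lift J t, z)" "p \<in> P" "rep (proj ?L e) = (p, t)"
        "coord w J (SOME y. y \<in> e) = z" "p \<in> chart_base J"
      using form_chart[OF 10(1,2,4)] by blast
    obtain p' t' z' where 2: "e' = line_point w (p', lift J t', z')" "rep (proj ?L e') = (p', t')"
        "coord w J (SOME y. y \<in> e') = z'"
      using form_chart[OF 10(1,3)] 10(4) unfolding 10(5) by blast
    have "p' = p" "t' = t" using 1 2 10(5) by simp_all
    then show ?case using 1 2 tau[OF 10(1) 1(5)] by (simp add: vadd_line_point)
  next
    case (11 J J' e i)
    obtain p t z where 1: "e = line_point w (p, lift J t, z)" "p \<in> P" "proj ?L e = qt_point M (p, t)"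
        "coord w J (SOME y. y \<in> e) = z" "p \<in> chart_base J"
      using form_chart[OF 11(1,3,4)] by blast
    have p': "p \<in> chart_base J'" using 11(5) 1 qt_point_in_chart by simp
    have "coord w J' (SOME y. y \<in> e) = coord w J' (p, lift J t, z)"
      using line_point_tau[OF 11(2) p' lift_extensional] 1(1) by simp
    also have "\<dots> = trans w J J' (proj ?L e) * z"
      unfolding 1(3) trans_qt_point[OF 11(1,2) 1(5) p'] by (simp add: coord_Pair torus_map_lift[OF 11(1)])
    finally show ?case using 1(4) 11(6) by simp
  qed
qed

lemma TNS_manifold_line_iso:
  assumes "line_iso (map (\<lambda>k. frag_of k) [0..<m] @ bs) (replicate N 0)"
  shows "TNS_manifold M"
proof -
  let ?es = "map (\<lambda>k. frag_of k :: weight) [0..<m]"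
  have "\<forall>w. \<exists>(\<xi> :: ('n point_class, 'n point_class \<times> complex) cbundle) \<tau> E. chart_bundle M [w] \<xi> \<tau> E"
    using chart_bundle.relabel_line_bundle[OF chart_bundle_line_bundle refl] by blast
  then obtain \<xi> :: "weight \<Rightarrow> ('n point_class, 'n point_class \<times> complex) cbundle" and \<tau> E
    where \<xi>: "\<And>w. chart_bundle M [w] (\<xi> w) (\<tau> w) (E w)" by metis
  define \<alpha> where "\<alpha> j = \<xi> (bs ! j)" for j
  have "complex_line_bundle X (\<alpha> j)" for j
    using chart_bundle.vector_bundle[OF \<xi>[of "bs ! j"]] by (simp add: \<alpha>_def)
  moreover have "bundle_iso (whitney_sum (whitney_family X {..<m} (theta M)) (whitney_family X {..<length bs} \<alpha>)) (trivial_bundle X N)"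
  proof -
    have "chart_bundle M [?es ! k] (theta M k) (\<lambda>J e i. coord (?es ! k) J (SOME y. y \<in> e))
        (\<lambda>J x z. line_point (?es ! k) (fst (rep x), lift J (snd (rep x)), z 0))" if "k < length ?es" for k
      using chart_bundle_line_bundle[of "?es ! k"] theta_eq_line_bundle[of k] that by simp
    from chart_bundle_whitney_family[of ?es "theta M", OF this]
    have 1: "\<exists>\<tau> E. chart_bundle M ?es (whitney_family X {..<m} (theta M)) \<tau> E" by (simp only: length_map length_upt diff_zero) blast
    have "chart_bundle M [bs ! k] (\<alpha> k) (\<tau> (bs ! k)) (E (bs ! k))" for k
      using \<xi> by (simp add: \<alpha>_def)
    from chart_bundle_whitney_family[of bs \<alpha>, OF this]
    have 2: "\<exists>\<tau> E. chart_bundle M bs (whitney_family X {..<length bs} \<alpha>) \<tau> E" by blast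
    show ?thesis using 1 2 chart_bundle.trivialisation[OF chart_bundle_whitney_sum assms] by blast
  qed
  ultimately show ?thesis unfolding TNS_manifold_def by blast
qed

end

theorem proposition4p6:
  fixes M B :: "2 quasitoric"
    and x xplus xminus :: "((real^2) \<times> (real^2)) set"
  assumes "oriented_quasitoric M" and "x \<in> fixed_points M"
    and "is_B4 B"
    and "xplus \<in> fixed_points B" and "fp_sign B xplus = 1"
    and "xminus \<in> fixed_points B" and "fp_sign B xminus = -1"
  shows "(fp_sign M x = -1 \<longrightarrow>
            (\<forall>N a1 a2. equivariant_connected_sum M x B xplus N a1 a2 \<longrightarrow>
               TNS_manifold N \<and>
               (\<exists>s\<in>{1, -1}. compatible_orientation M x B xplus (N\<lparr>orient := s\<rparr>) a1 a2))) \<and>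
         (fp_sign M x = 1 \<longrightarrow>
            (\<forall>N a1 a2. equivariant_connected_sum M x B xminus N a1 a2 \<longrightarrow>
               TNS_manifold N \<and>
               (\<exists>s\<in>{1, -1}. compatible_orientation M x B xminus (N\<lparr>orient := s\<rparr>) a1 a2)))"
proof -
  \<comment> \<open>Both cases say that the sign at \<open>x\<close> is opposite to that at the
    chosen point of \<open>B\<close>.\<close>
  have key: "TNS_manifold N \<and> (\<exists>s\<in>{1, -1}. compatible_orientation M x B y (N\<lparr>orient := s\<rparr>) a1 a2)"
    if sum: "equivariant_connected_sum M x B y N a1 a2" and sg: "fp_sign M x = - fp_sign B y" for y N a1 a2
  proof
    obtain F C Q D where h: "handle_facets N F C Q D"
      using sum_handle_facets[OF assms(3) sum] by blast
    have N: "char_pair N" using equivariant_connected_sumD(3)[OF sum] by (simp add: char_pair_def)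
    interpret handle_pair N F C Q D
      using N h by (simp add: handle_pair_def polygon_pair_def handle_pair_axioms_def)
    show "TNS_manifold N" using stably_trivial TNS_manifold_line_iso by blast
    have "orient M = 1 \<or> orient M = -1" "orient B = 1 \<or> orient B = -1"
      using assms(1,3) by (auto simp: oriented_quasitoric_def is_B4_def)
    from compatible_orientation_exists[OF sum this sg]
    show "\<exists>s\<in>{1, -1}. compatible_orientation M x B y (N\<lparr>orient := s\<rparr>) a1 a2" .
  qed
  show ?thesis using key assms(5,7) by simp
qed

end
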